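(* Let $R$ be a ring, $\delta$ a derivation on $R$, $M$ an $R$-bimodule, $d$ a $\delta$-derivation on $M$, and ${}_l\mathfrak{F}_r$ the symmetric Gabriel filter induced by a Gabriel filter $\mathfrak{F}_l$ of left ideals and a Gabriel filter $\mathfrak{F}_r$ of right ideals of $R$, with corresponding torsion theory ${}_l\tau_r$. (1) If $M$ is torsion-free with respect to ${}_l\tau_r$, then $d$ extends to a $\delta$-derivation (again denoted $d$) on the symmetric module of quotients ${}_lM_r$ such that $dq_M=q_Md$. (2) If $d({}_l\mathcal{T}_r(M))\subseteq{}_l\mathcal{T}_r(M)$, then $d$ extends to a $\delta$-derivation (again denoted $d$) on the symmetric module of quotients ${}_lM_r$ such that $dq_M=q_Md$. (3) If a derivation on a bimodule $M$ extends to a derivation on the symmetric module of quotients ${}_lM_r$, then such an extension is unique. (4) The filter ${}_l\mathfrak{F}_r$ is differential if and only if every derivation on any $R$-bimodule $N$ (that is, every $\gamma$-derivation on $N$, for any derivation $\gamma$ on $R$) extends uniquely to a derivation (a $\gamma$-derivation) on the symmetric module of quotients ${}_lN_r$.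
   Context: Rings are associative with identity and modules are unital. Derivations. A derivation on a ring $R$ is an additive map $\delta:R\to R$ with $\delta(rs)=\delta(r)s+r\delta(s)$. For an $R$-bimodule $M$, a $\delta$-derivation on $M$ is an additive map $d:M\to M$ with $d(xr)=d(x)r+x\delta(r)$ and $d(rx)=\delta(r)x+rd(x)$ for all $x\in M$, $r\in R$. Symmetric filter. An $R$-bimodule $M$ is a right $R\otimes_{\mathbb{Z}}R^{op}$-module via $x(r\otimes s)=sxr$. ${}_l\mathfrak{F}_r$ is the set of right ideals of $R\otimes_{\mathbb{Z}}R^{op}$ containing one of the form $J\otimes R^{op}+R\otimes I$ (the sum of the images in $R\otimes_{\mathbb{Z}}R^{op}$) with $I\in\mathfrak{F}_l$, $J\in\mathfrak{F}_r$. It is a Gabriel filter, and its torsion submodule is ${}_l\mathcal{T}_r(M)=\{x\in M:\{t\in R\otimes_{\mathbb{Z}}R^{op}: xt=0\}\in{}_l\mathfrak{F}_r\}=\mathcal{T}_l(M)\cap\mathcal{T}_r(M)$, where $\mathcal{T}_l,\mathcal{T}_r$ are the torsion submodules for $\mathfrak{F}_l,\mathfrak{F}_r$. Symmetric module of quotients. ${}_lM_r=\varinjlim_{K\in{}_l\mathfrak{F}_r}\mathrm{Hom}(K,M/{}_l\mathcal{T}_r(M))$ (homomorphisms of right $R\otimes_{\mathbb{Z}}R^{op}$-modules), i.e. the module of quotients of the right $R\otimes_{\mathbb{Z}}R^{op}$-module $M$ with respect to ${}_l\mathfrak{F}_r$. The map $q_M:M\to{}_lM_r$ sends $m$ to the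 class of $t\mapsto (m+{}_l\mathcal{T}_r(M))t$. Extension. A $\delta$-derivation $d$ on $M$ extends to ${}_lM_r$ if there is a $\delta$-derivation $d'$ on ${}_lM_r$ with $d'q_M=q_Md$. Differential. ${}_l\mathfrak{F}_r$ is differential if for every $I\in{}_l\mathfrak{F}_r$ there is $J\in{}_l\mathfrak{F}_r$ such that $\overline{\delta}(J)\subseteq I$ for all derivations $\overline{\delta}$ of the ring $R\otimes_{\mathbb{Z}}R^{op}$. (Every derivation $\delta$ on $R$ determines such a derivation by $\overline{\delta}(r\otimes s)=\delta(r)\otimes s+r\otimes\delta(s)$.)
   Formalization: "Differential" is taken one derivation at a time: for every derivation of R⊗R^op and every I in the filter there is J, possibly depending on the derivation, mapped into I; with one J for all derivations the converse half of (4) fails, e.g. for the first Weyl algebra over Q with all nonzero ideals. *)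

theory Defs
  imports "HOL-Algebra.QuotRing" "HOL-Algebra.Free_Abelian_Groups"
begin

section \<open>Right modules and bimodules over a noncommutative ring\<close>

text \<open>As for the record of modules in HOL-Algebra, only the additive part of the inherited ring
  record is meaningful; the fields for multiplication and unit are junk.\<close>

record ('a, 'm) rmodule = "'m ring" +
  ract :: "['m, 'a] \<Rightarrow> 'm" (infixl \<open>\<triangleleft>\<index>\<close> 70)

record ('a, 'm) bimod = "('a, 'm) rmodule" +
  lact :: "['a, 'm] \<Rightarrow> 'm" (infixr \<open>\<triangleright>\<index>\<close> 75)

locale right_module = R?: ring R + M?: abelian_group M
  for R :: "('a, 'b) ring_scheme" (structure) and M :: "('a, 'm, 'c) rmodule_scheme" (structure) +
  assumes ract_closed:
      "\<lbrakk>x \<in> carrier M; r \<in> carrier R\<rbrakk> \<Longrightarrow> x \<triangleleft>\<^bsub>M\<^esub> r \<in> carrier M"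
    and ract_add_left:
      "\<lbrakk>x \<in> carrier M; y \<in> carrier M; r \<in> carrier R\<rbrakk>
        \<Longrightarrow> (x \<oplus>\<^bsub>M\<^esub> y) \<triangleleft>\<^bsub>M\<^esub> r = x \<triangleleft>\<^bsub>M\<^esub> r \<oplus>\<^bsub>M\<^esub> y \<triangleleft>\<^bsub>M\<^esub> r"
    and ract_add_right:
      "\<lbrakk>x \<in> carrier M; r \<in> carrier R; s \<in> carrier R\<rbrakk>
        \<Longrightarrow> x \<triangleleft>\<^bsub>M\<^esub> (r \<oplus>\<^bsub>R\<^esub> s) = x \<triangleleft>\<^bsub>M\<^esub> r \<oplus>\<^bsub>M\<^esub> x \<triangleleft>\<^bsub>M\<^esub> s"
    and ract_mult:
      "\<lbrakk>x \<in> carrier M; r \<in> carrier R; s \<in> carrier R\<rbrakk>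
        \<Longrightarrow> x \<triangleleft>\<^bsub>M\<^esub> (r \<otimes>\<^bsub>R\<^esub> s) = (x \<triangleleft>\<^bsub>M\<^esub> r) \<triangleleft>\<^bsub>M\<^esub> s"
    and ract_one:
      "x \<in> carrier M \<Longrightarrow> x \<triangleleft>\<^bsub>M\<^esub> \<one>\<^bsub>R\<^esub> = x"

locale bimodule = right_module R M
  for R :: "('a, 'b) ring_scheme" (structure) and M :: "('a, 'm, 'c) bimod_scheme" (structure) +
  assumes lact_closed:
      "\<lbrakk>r \<in> carrier R; x \<in> carrier M\<rbrakk> \<Longrightarrow> r \<triangleright>\<^bsub>M\<^esub> x \<in> carrier M"
    and lact_add_left:
      "\<lbrakk>r \<in> carrier R; s \<in> carrier R; x \<in> carrier M\<rbrakk>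
        \<Longrightarrow> (r \<oplus>\<^bsub>R\<^esub> s) \<triangleright>\<^bsub>M\<^esub> x = (r \<triangleright>\<^bsub>M\<^esub> x) \<oplus>\<^bsub>M\<^esub> (s \<triangleright>\<^bsub>M\<^esub> x)"
    and lact_add_right:
      "\<lbrakk>r \<in> carrier R; x \<in> carrier M; y \<in> carrier M\<rbrakk>
        \<Longrightarrow> r \<triangleright>\<^bsub>M\<^esub> (x \<oplus>\<^bsub>M\<^esub> y) = (r \<triangleright>\<^bsub>M\<^esub> x) \<oplus>\<^bsub>M\<^esub> (r \<triangleright>\<^bsub>M\<^esub> y)"
    and lact_mult:
      "\<lbrakk>r \<in> carrier R; s \<in> carrier R; x \<in> carrier M\<rbrakk>
        \<Longrightarrow> (r \<otimes>\<^bsub>R\<^esub> s) \<triangleright>\<^bsub>M\<^esub> x = r \<triangleright>\<^bsub>M\<^esub> (s \<triangleright>\<^bsub>M\<^esub> x)"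
    and lact_one:
      "x \<in> carrier M \<Longrightarrow> \<one>\<^bsub>R\<^esub> \<triangleright>\<^bsub>M\<^esub> x = x"
    and lact_ract:
      "\<lbrakk>r \<in> carrier R; x \<in> carrier M; s \<in> carrier R\<rbrakk>
        \<Longrightarrow> (r \<triangleright>\<^bsub>M\<^esub> x) \<triangleleft>\<^bsub>M\<^esub> s = r \<triangleright>\<^bsub>M\<^esub> (x \<triangleleft>\<^bsub>M\<^esub> s)"


section \<open>Derivations\<close>

text \<open>Maps are total functions of which only the values on the carrier matter.\<close>

definition ring_derivation :: "('a, 'b) ring_scheme \<Rightarrow> ('a \<Rightarrow> 'a) \<Rightarrow> bool" where
  "ring_derivation R \<delta> \<longleftrightarrow>
     \<delta> \<in> carrier R \<rightarrow> carrier R \<and>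
     (\<forall>r\<in>carrier R. \<forall>s\<in>carrier R. \<delta> (r \<oplus>\<^bsub>R\<^esub> s) = \<delta> r \<oplus>\<^bsub>R\<^esub> \<delta> s) \<and>
     (\<forall>r\<in>carrier R. \<forall>s\<in>carrier R. \<delta> (r \<otimes>\<^bsub>R\<^esub> s) = \<delta> r \<otimes>\<^bsub>R\<^esub> s \<oplus>\<^bsub>R\<^esub> r \<otimes>\<^bsub>R\<^esub> \<delta> s)"

definition bimodule_derivation ::
    "('a, 'b) ring_scheme \<Rightarrow> ('a \<Rightarrow> 'a) \<Rightarrow> ('a, 'm, 'c) bimod_scheme \<Rightarrow> ('m \<Rightarrow> 'm) \<Rightarrow> bool" where
  "bimodule_derivation R \<delta> M d \<longleftrightarrow>
     d \<in> carrier M \<rightarrow> carrier M \<and>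
     (\<forall>x\<in>carrier M. \<forall>y\<in>carrier M. d (x \<oplus>\<^bsub>M\<^esub> y) = d x \<oplus>\<^bsub>M\<^esub> d y) \<and>
     (\<forall>x\<in>carrier M. \<forall>r\<in>carrier R. d (x \<triangleleft>\<^bsub>M\<^esub> r) = (d x \<triangleleft>\<^bsub>M\<^esub> r) \<oplus>\<^bsub>M\<^esub> (x \<triangleleft>\<^bsub>M\<^esub> \<delta> r)) \<and>
     (\<forall>x\<in>carrier M. \<forall>r\<in>carrier R. d (r \<triangleright>\<^bsub>M\<^esub> x) = (\<delta> r \<triangleright>\<^bsub>M\<^esub> x) \<oplus>\<^bsub>M\<^esub> (r \<triangleright>\<^bsub>M\<^esub> d x))"


section \<open>Gabriel filters\<close>

definition opposite_ring :: "('a, 'b) ring_scheme \<Rightarrow> ('a, 'b) ring_scheme" where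
  "opposite_ring R = R\<lparr>monoid.mult := (\<lambda>x y. y \<otimes>\<^bsub>R\<^esub> x)\<rparr>"

definition right_ideal :: "'a set \<Rightarrow> ('a, 'b) ring_scheme \<Rightarrow> bool" where
  "right_ideal I R \<longleftrightarrow>
     additive_subgroup I R \<and> (\<forall>a\<in>I. \<forall>r\<in>carrier R. a \<otimes>\<^bsub>R\<^esub> r \<in> I)"

definition right_gabriel_filter :: "('a, 'b) ring_scheme \<Rightarrow> 'a set set \<Rightarrow> bool" where
  "right_gabriel_filter R F \<longleftrightarrow>
     F \<noteq> {} \<and>
     (\<forall>I\<in>F. right_ideal I R) \<and>
     (\<forall>I\<in>F. \<forall>J. right_ideal J R \<and> I \<subseteq> J \<longrightarrow> J \<in> F) \<and>
     (\<forall>I\<in>F. \<forall>J\<in>F. I \<inter> J \<in> F) \<and>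
     (\<forall>I\<in>F. \<forall>a\<in>carrier R. {r \<in> carrier R. a \<otimes>\<^bsub>R\<^esub> r \<in> I} \<in> F) \<and>
     (\<forall>I. \<forall>J\<in>F. right_ideal I R \<and> (\<forall>a\<in>J. {r \<in> carrier R. a \<otimes>\<^bsub>R\<^esub> r \<in> I} \<in> F) \<longrightarrow> I \<in> F)"

text \<open>The left ideals of a ring are the right ideals of its opposite ring.\<close>

definition left_gabriel_filter :: "('a, 'b) ring_scheme \<Rightarrow> 'a set set \<Rightarrow> bool" where
  "left_gabriel_filter R F \<longleftrightarrow> right_gabriel_filter (opposite_ring R) F"

text \<open>The ideal \<open>J\<close> may depend on the derivation \<open>D\<close>. A single \<open>J\<close> serving all derivations at
  once would, by the inner derivations, force every member of the filter to contain a two-sided ideal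
  generated by a member. This fails, for instance, for the filter induced on the enveloping ring of the
  first Weyl algebra over the rationals by its nonzero left and right ideals, although derivations on
  bimodules always extend for that filter.\<close>

definition differential_filter :: "('a, 'b) ring_scheme \<Rightarrow> 'a set set \<Rightarrow> bool" where
  "differential_filter R F \<longleftrightarrow>
     (\<forall>D. ring_derivation R D \<longrightarrow> (\<forall>I\<in>F. \<exists>J\<in>F. D ` J \<subseteq> I))"


section \<open>Modules of quotients of right modules\<close>

definition torsion :: "('a, 'b) ring_scheme \<Rightarrow> 'a set set \<Rightarrow> ('a, 'm, 'c) rmodule_scheme \<Rightarrow> 'm set"
  where
  "torsion R F M = {x \<in> carrier M. {r \<in> carrier R. x \<triangleleft>\<^bsub>M\<^esub> r = \<zero>\<^bsub>M\<^esub>} \<in> F}"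

definition quotient_rmodule ::
    "('a, 'm, 'c) rmodule_scheme \<Rightarrow> 'm set \<Rightarrow> ('a, 'm set) rmodule" where
  "quotient_rmodule M T =
     \<lparr>carrier = a_rcosets\<^bsub>M\<^esub> T, monoid.mult = undefined, one = undefined, ring.zero = T, add = set_add M,
      ract = (\<lambda>U r. \<Union>x\<in>U. T +>\<^bsub>M\<^esub> (x \<triangleleft>\<^bsub>M\<^esub> r))\<rparr>"

definition ideal_hom ::
    "('a, 'b) ring_scheme \<Rightarrow> 'a set \<Rightarrow> ('a, 'm, 'c) rmodule_scheme \<Rightarrow> ('a \<Rightarrow> 'm) set" where
  "ideal_hom R K N =
     {f \<in> K \<rightarrow>\<^sub>E carrier N.
        (\<forall>s\<in>K. \<forall>t\<in>K. f (s \<oplus>\<^bsub>R\<^esub> t) = f s \<oplus>\<^bsub>N\<^esub> f t) \<and>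
        (\<forall>t\<in>K. \<forall>r\<in>carrier R. f (t \<otimes>\<^bsub>R\<^esub> r) = f t \<triangleleft>\<^bsub>N\<^esub> r)}"

text \<open>The direct limit of the groups of homomorphisms from the members \<open>K\<close> of \<open>F\<close> to \<open>M/T(M)\<close> is the
  set of pairs \<open>(K, f)\<close> modulo agreement on some smaller member of \<open>F\<close>.\<close>

definition limit_pairs ::
    "('a, 'b) ring_scheme \<Rightarrow> 'a set set \<Rightarrow> ('a, 'm, 'c) rmodule_scheme
      \<Rightarrow> ('a set \<times> ('a \<Rightarrow> 'm set)) set" where
  "limit_pairs R F M = (SIGMA K:F. ideal_hom R K (quotient_rmodule M (torsion R F M)))"

definition limit_rel ::
    "('a, 'b) ring_scheme \<Rightarrow> 'a set set \<Rightarrow> ('a, 'm, 'c) rmodule_scheme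
      \<Rightarrow> (('a set \<times> ('a \<Rightarrow> 'm set)) \<times> ('a set \<times> ('a \<Rightarrow> 'm set))) set" where
  "limit_rel R F M =
     {((K, f), (L, g)). (K, f) \<in> limit_pairs R F M \<and> (L, g) \<in> limit_pairs R F M \<and>
        (\<exists>H\<in>F. H \<subseteq> K \<inter> L \<and> (\<forall>t\<in>H. f t = g t))}"

text \<open>The scalar action is \<open>(f r)(t) = f (r t)\<close>.\<close>

definition module_of_quotients ::
    "('a, 'b) ring_scheme \<Rightarrow> 'a set set \<Rightarrow> ('a, 'm, 'c) rmodule_scheme
      \<Rightarrow> ('a, ('a set \<times> ('a \<Rightarrow> 'm set)) set) rmodule" where
  "module_of_quotients R F M =
    (let N = quotient_rmodule M (torsion R F M); E = limit_rel R F M in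
     \<lparr>carrier = limit_pairs R F M // E, monoid.mult = undefined, one = undefined,
      ring.zero = E `` {(carrier R, \<lambda>t\<in>carrier R. \<zero>\<^bsub>N\<^esub>)},
      add = (\<lambda>U V. \<Union>(K, f)\<in>U. \<Union>(L, g)\<in>V. E `` {(K \<inter> L, \<lambda>t\<in>K \<inter> L. f t \<oplus>\<^bsub>N\<^esub> g t)}),
      ract = (\<lambda>U r. \<Union>(K, f)\<in>U.
        E `` {({t \<in> carrier R. r \<otimes>\<^bsub>R\<^esub> t \<in> K}, \<lambda>t\<in>{t \<in> carrier R. r \<otimes>\<^bsub>R\<^esub> t \<in> K}. f (r \<otimes>\<^bsub>R\<^esub> t))})\<rparr>)"

definition quotient_map ::
    "('a, 'b) ring_scheme \<Rightarrow> 'a set set \<Rightarrow> ('a, 'm, 'c) rmodule_scheme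
      \<Rightarrow> 'm \<Rightarrow> ('a set \<times> ('a \<Rightarrow> 'm set)) set" where
  "quotient_map R F M m =
    (let T = torsion R F M in
     limit_rel R F M `` {(carrier R, \<lambda>t\<in>carrier R. (T +>\<^bsub>M\<^esub> m) \<triangleleft>\<^bsub>quotient_rmodule M T\<^esub> t)})"


section \<open>Tensor products of rings over the integers\<close>

text \<open>The free abelian group on pairs, with the multiplication \<open>(a, b) (a', b') = (a a', b b')\<close>
  extended biadditively.\<close>

definition free_pair_ring ::
    "('a, 'c) ring_scheme \<Rightarrow> ('b, 'd) ring_scheme \<Rightarrow> ('a \<times> 'b \<Rightarrow>\<^sub>0 int) ring" where
  "free_pair_ring A B =
     \<lparr>carrier = {c. Poly_Mapping.keys c \<subseteq> carrier A \<times> carrier B},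
      monoid.mult = (\<lambda>c c'. frag_extend (\<lambda>(a, b). frag_extend (\<lambda>(a', b').
                frag_of (a \<otimes>\<^bsub>A\<^esub> a', b \<otimes>\<^bsub>B\<^esub> b')) c') c),
      one = frag_of (\<one>\<^bsub>A\<^esub>, \<one>\<^bsub>B\<^esub>), ring.zero = 0, add = (+)\<rparr>"

definition tensor_relations ::
    "('a, 'c) ring_scheme \<Rightarrow> ('b, 'd) ring_scheme \<Rightarrow> ('a \<times> 'b \<Rightarrow>\<^sub>0 int) set" where
  "tensor_relations A B = generate (add_monoid (free_pair_ring A B))
     ({frag_of (a \<oplus>\<^bsub>A\<^esub> a', b) - frag_of (a, b) - frag_of (a', b) | a a' b.
         a \<in> carrier A \<and> a' \<in> carrier A \<and> b \<in> carrier B} \<union>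
      {frag_of (a, b \<oplus>\<^bsub>B\<^esub> b') - frag_of (a, b) - frag_of (a, b') | a b b'.
         a \<in> carrier A \<and> b \<in> carrier B \<and> b' \<in> carrier B})"

text \<open>The subgroup of relations is an ideal, so the quotient is the usual tensor product of abelian
  groups with the usual multiplication.\<close>

definition tensor_ring ::
    "('a, 'c) ring_scheme \<Rightarrow> ('b, 'd) ring_scheme \<Rightarrow> ('a \<times> 'b \<Rightarrow>\<^sub>0 int) set ring" where
  "tensor_ring A B = free_pair_ring A B Quot tensor_relations A B"

definition tensor ::
    "('a, 'c) ring_scheme \<Rightarrow> ('b, 'd) ring_scheme \<Rightarrow> 'a \<Rightarrow> 'b \<Rightarrow> ('a \<times> 'b \<Rightarrow>\<^sub>0 int) set" where
  "tensor A B a b = tensor_relations A B +>\<^bsub>free_pair_ring A B\<^esub> frag_of (a, b)"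

abbreviation env_ring :: "('a, 'b) ring_scheme \<Rightarrow> ('a \<times> 'a \<Rightarrow>\<^sub>0 int) set ring" where
  "env_ring R \<equiv> tensor_ring R (opposite_ring R)"

abbreviation env_tensor :: "('a, 'b) ring_scheme \<Rightarrow> 'a \<Rightarrow> 'a \<Rightarrow> ('a \<times> 'a \<Rightarrow>\<^sub>0 int) set" where
  "env_tensor R \<equiv> tensor R (opposite_ring R)"

text \<open>The image of \<open>U \<otimes> V\<close> in the enveloping ring, for additive subgroups \<open>U\<close> and \<open>V\<close>.\<close>

definition env_tensor_image :: "('a, 'b) ring_scheme \<Rightarrow> 'a set \<Rightarrow> 'a set
    \<Rightarrow> ('a \<times> 'a \<Rightarrow>\<^sub>0 int) set set" where
  "env_tensor_image R U V =
     generate (add_monoid (env_ring R)) {env_tensor R x y | x y. x \<in> U \<and> y \<in> V}"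


section \<open>Bimodules as right modules over the enveloping ring\<close>

text \<open>The action is determined by \<open>x (r \<otimes> s) = s x r\<close>; its value is computed on the
  representatives of an element of the enveloping ring, all of which give the same result.\<close>

definition env_rmodule ::
    "('a, 'm, 'c) bimod_scheme \<Rightarrow> (('a \<times> 'a \<Rightarrow>\<^sub>0 int) set, 'm) rmodule" where
  "env_rmodule M =
     \<lparr>carrier = carrier M, monoid.mult = undefined, one = undefined, ring.zero = \<zero>\<^bsub>M\<^esub>, add = add M,
      ract = (\<lambda>x t. the_elem ((\<lambda>c. \<Oplus>\<^bsub>M\<^esub>p\<in>Poly_Mapping.keys c.
        [Poly_Mapping.lookup c p] \<cdot>\<^bsub>M\<^esub> ((snd p \<triangleright>\<^bsub>M\<^esub> x) \<triangleleft>\<^bsub>M\<^esub> fst p)) ` t))\<rparr>"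

definition bimod_of_env ::
    "('a, 'b) ring_scheme \<Rightarrow> (('a \<times> 'a \<Rightarrow>\<^sub>0 int) set, 'm, 'c) rmodule_scheme \<Rightarrow> ('a, 'm) bimod" where
  "bimod_of_env R Q =
     \<lparr>carrier = carrier Q, monoid.mult = undefined, one = undefined, ring.zero = \<zero>\<^bsub>Q\<^esub>, add = add Q,
      ract = (\<lambda>x r. x \<triangleleft>\<^bsub>Q\<^esub> env_tensor R r \<one>\<^bsub>R\<^esub>),
      lact = (\<lambda>r x. x \<triangleleft>\<^bsub>Q\<^esub> env_tensor R \<one>\<^bsub>R\<^esub> r)\<rparr>"


section \<open>Symmetric filters and symmetric modules of quotients\<close>

definition sym_filter ::
    "('a, 'b) ring_scheme \<Rightarrow> 'a set set \<Rightarrow> 'a set set \<Rightarrow> ('a \<times> 'a \<Rightarrow>\<^sub>0 int) set set set" where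
  "sym_filter R Fl Fr =
     {K. right_ideal K (env_ring R) \<and>
         (\<exists>I\<in>Fl. \<exists>J\<in>Fr. env_tensor_image R J (carrier R)
            <+>\<^bsub>env_ring R\<^esub> env_tensor_image R (carrier R) I \<subseteq> K)}"

definition sym_torsion ::
    "('a, 'b) ring_scheme \<Rightarrow> 'a set set \<Rightarrow> 'a set set \<Rightarrow> ('a, 'm, 'c) bimod_scheme \<Rightarrow> 'm set" where
  "sym_torsion R Fl Fr M = torsion (env_ring R) (sym_filter R Fl Fr) (env_rmodule M)"

type_synonym ('a, 'm) sym_quotient =
  "(('a \<times> 'a \<Rightarrow>\<^sub>0 int) set set \<times> (('a \<times> 'a \<Rightarrow>\<^sub>0 int) set \<Rightarrow> 'm set)) set"

definition sym_module_of_quotients ::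
    "('a, 'b) ring_scheme \<Rightarrow> 'a set set \<Rightarrow> 'a set set \<Rightarrow> ('a, 'm, 'c) bimod_scheme
      \<Rightarrow> ('a, ('a, 'm) sym_quotient) bimod" where
  "sym_module_of_quotients R Fl Fr M =
     bimod_of_env R (module_of_quotients (env_ring R) (sym_filter R Fl Fr) (env_rmodule M))"

definition sym_quotient_map ::
    "('a, 'b) ring_scheme \<Rightarrow> 'a set set \<Rightarrow> 'a set set \<Rightarrow> ('a, 'm, 'c) bimod_scheme
      \<Rightarrow> 'm \<Rightarrow> ('a, 'm) sym_quotient" where
  "sym_quotient_map R Fl Fr M = quotient_map (env_ring R) (sym_filter R Fl Fr) (env_rmodule M)"

definition extends_derivation ::
    "('a, 'b) ring_scheme \<Rightarrow> 'a set set \<Rightarrow> 'a set set \<Rightarrow> ('a \<Rightarrow> 'a) \<Rightarrow> ('a, 'm, 'c) bimod_scheme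
      \<Rightarrow> ('m \<Rightarrow> 'm) \<Rightarrow> (('a, 'm) sym_quotient \<Rightarrow> ('a, 'm) sym_quotient) \<Rightarrow> bool" where
  "extends_derivation R Fl Fr \<delta> M d d' \<longleftrightarrow>
     bimodule_derivation R \<delta> (sym_module_of_quotients R Fl Fr M) d' \<and>
     (\<forall>x\<in>carrier M. d' (sym_quotient_map R Fl Fr M x) = sym_quotient_map R Fl Fr M (d x))"

end

theory Submission
  imports Defs
begin

text \<open>Every right Gabriel filter is differential: for \<open>I\<close> in the filter and a derivation \<open>D\<close> of the ring,
  \<open>J = {a \<in> I. D a \<in> I}\<close> is a right ideal with \<open>(J : a) = (I : D a)\<close> for \<open>a \<in> I\<close>, so \<open>J\<close> is in the filter.
  Consequently derivations preserve torsion, the induced derivation of \<open>M/T(M)\<close> extends to the module of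
  quotients by \<open>d'[K, f] = [{a \<in> K. D a \<in> K}, t \<mapsto> d (f t) - f (D t)]\<close>, and the extension is unique because the
  module of quotients is torsion-free and every element is moved into the image of \<open>M\<close> by a member of the
  filter. The symmetric case is the instance of the enveloping ring, where \<open>\<delta>\<close> acts as
  \<open>\<delta> \<otimes> 1 + 1 \<otimes> \<delta>\<close>; there a right ideal \<open>K\<close> belongs to the symmetric filter iff \<open>{a. a \<otimes> 1 \<in> K}\<close> and
  \<open>{b. 1 \<otimes> b \<in> K}\<close> belong to the two given filters, which makes the Gabriel axioms easy to verify.\<close>

section \<open>Tensor products of rings\<close>

text \<open>What lets \<open>J\<close> into the filter is the local axiom of Gabriel filters: an
  ideal belongs to the filter once all its colons along a known member do. The derivation
  \<open>D\<close> is fixed throughout, so no infinite intersection of ideals occurs. The limit is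
  manageable because \<open>M/T(M)\<close> is torsion-free: homomorphisms that agree on some member
  of the filter agree wherever both are defined, so equality of classes is a pointwise test on the
  common domain. Bimodules are turned into right modules over the enveloping ring because the two
  Leibniz rules of a bimodule derivation then merge into one. The price is the tensor product, whose
  elements are cosets of formal sums: maps on it come from the universal property, and identities
  are checked on pure tensors. A colon along a sum of pure tensors has no explicit form, which hides
  the Gabriel axioms of the symmetric filter. They are therefore inherited along the embeddings
  \<open>a \<otimes> 1\<close> and \<open>1 \<otimes> b\<close>: their images commute, so a pure
  tensor is an image element times one that centralises the image, in two ways.\<close>

definition frag_lift :: "('g, 'z) ring_scheme \<Rightarrow> ('p \<Rightarrow> 'g) \<Rightarrow> ('p \<Rightarrow>\<^sub>0 int) \<Rightarrow> 'g" where
  "frag_lift G f c = (\<Oplus>\<^bsub>G\<^esub>p\<in>Poly_Mapping.keys c. [Poly_Mapping.lookup c p] \<cdot>\<^bsub>G\<^esub> f p)"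

context abelian_group
begin

text \<open>Keys outside the support have coefficient 0. Two formal sums are added over a common
  index set, since the support of \<open>c + c'\<close> may shrink by cancellation.\<close>

lemma frag_lift_superset:
  assumes f: "f \<in> S \<rightarrow> carrier G" and A: "finite A" "Poly_Mapping.keys c \<subseteq> A" "A \<subseteq> S"
  shows "frag_lift G f c = (\<Oplus>p\<in>A. [Poly_Mapping.lookup c p] \<cdot> f p)"
  unfolding frag_lift_def
proof (rule add.finprod_mono_neutral_cong_left[OF A(1,2)])
  show "[Poly_Mapping.lookup c i] \<cdot> f i = \<zero>" if "i \<in> A - Poly_Mapping.keys c" for i
  proof -
    have "f i \<in> carrier G" using that f A by auto
    moreover have "Poly_Mapping.lookup c i = 0"
      using that by (simp add: in_keys_iff)
    ultimately show ?thesis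
      by (simp add: add_pow_def)
  qed
  show "(\<lambda>p. [Poly_Mapping.lookup c p] \<cdot> f p) \<in> A \<rightarrow> carrier G"
    using f A by (auto intro!: add.int_pow_closed)
qed simp

lemma frag_lift_closed:
  assumes "f \<in> S \<rightarrow> carrier G" "Poly_Mapping.keys c \<subseteq> S"
  shows "frag_lift G f c \<in> carrier G"
  unfolding frag_lift_def using assms by (auto intro!: finsum_closed add.int_pow_closed)

lemma frag_lift_add:
  assumes f: "f \<in> S \<rightarrow> carrier G" and S: "Poly_Mapping.keys c \<subseteq> S" "Poly_Mapping.keys c' \<subseteq> S"
  shows "frag_lift G f (c + c') = frag_lift G f c \<oplus> frag_lift G f c'"
proof -
  let ?A = "Poly_Mapping.keys c \<union> Poly_Mapping.keys c'"
  have A: "finite ?A" "Poly_Mapping.keys c \<subseteq> ?A" "Poly_Mapping.keys c' \<subseteq> ?A"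
      "Poly_Mapping.keys (c + c') \<subseteq> ?A" "?A \<subseteq> S"
    using S keys_add[of c c'] by auto
  have fc: "f p \<in> carrier G" if "p \<in> ?A" for p
    using that f S by auto
  have "(\<Oplus>p\<in>?A. [Poly_Mapping.lookup (c + c') p] \<cdot> f p)
      = (\<Oplus>p\<in>?A. [Poly_Mapping.lookup c p] \<cdot> f p \<oplus> [Poly_Mapping.lookup c' p] \<cdot> f p)"
    by (rule finsum_cong') (auto simp: lookup_add add.int_pow_mult fc intro!: add.int_pow_closed)
  also have "\<dots> = (\<Oplus>p\<in>?A. [Poly_Mapping.lookup c p] \<cdot> f p)
      \<oplus> (\<Oplus>p\<in>?A. [Poly_Mapping.lookup c' p] \<cdot> f p)"
    by (rule finsum_addf) (auto simp: fc intro!: add.int_pow_closed)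
  finally show ?thesis
    using frag_lift_superset[OF f A(1) _ A(5)] A(2-4) by simp
qed

lemma frag_lift_zero: "frag_lift G f 0 = \<zero>"
  by (simp add: frag_lift_def)

lemma frag_lift_of:
  assumes "f p \<in> carrier G"
  shows "frag_lift G f (frag_of p) = f p"
  using assms add.int_pow_1[OF assms] by (simp add: frag_lift_def)

lemma frag_lift_diff:
  assumes f: "f \<in> S \<rightarrow> carrier G" and S: "Poly_Mapping.keys c \<subseteq> S" "Poly_Mapping.keys c' \<subseteq> S"
  shows "frag_lift G f (c - c') = frag_lift G f c \<ominus> frag_lift G f c'"
proof -
  have k: "Poly_Mapping.keys (c - c') \<subseteq> S"
    using S keys_diff[of c c'] by blast
  have "frag_lift G f c = frag_lift G f (c - c') \<oplus> frag_lift G f c'"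
    using frag_lift_add[OF f k S(2)] by simp
  then show ?thesis
    using frag_lift_closed[OF f] k S by (simp add: minus_eq a_assoc r_neg)
qed

end

text \<open>The step for differences covers sums and negatives at once. This is why many facts below
  are stated for \<open>-\<close> and \<open>\<ominus>\<close>.\<close>

lemmas frag_induct = free_Abelian_group_induct [consumes 1, case_names zero diff gen]

text \<open>The product of formal sums nests two \<open>frag_extend\<close>s: the left factor is the
  outer argument and the right factor sits inside the function. Distributivity in the right factor
  is additivity in the function.\<close>

lemma frag_extend_pointwise_add:
  "frag_extend (\<lambda>x. f x + g x) c = frag_extend f c + frag_extend g c"
  by (simp add: frag_extend_def frag_cmul_distrib2 sum.distrib)

lemma frag_extend_pointwise_diff:
  "frag_extend (\<lambda>x. f x - g x) c = frag_extend f c - frag_extend g c"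
  using frag_extend_pointwise_add[of "\<lambda>x. f x - g x" g c] by simp

definition biadditive ::
    "('a, 'c) ring_scheme \<Rightarrow> ('b, 'd) ring_scheme \<Rightarrow> ('g, 'z) ring_scheme \<Rightarrow> ('a \<times> 'b \<Rightarrow> 'g) \<Rightarrow> bool"
  where "biadditive A B G f \<longleftrightarrow> f \<in> carrier A \<times> carrier B \<rightarrow> carrier G \<and>
    (\<forall>a\<in>carrier A. \<forall>a'\<in>carrier A. \<forall>b\<in>carrier B. f (a \<oplus>\<^bsub>A\<^esub> a', b) = f (a, b) \<oplus>\<^bsub>G\<^esub> f (a', b)) \<and>
    (\<forall>a\<in>carrier A. \<forall>b\<in>carrier B. \<forall>b'\<in>carrier B. f (a, b \<oplus>\<^bsub>B\<^esub> b') = f (a, b) \<oplus>\<^bsub>G\<^esub> f (a, b'))"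

text \<open>The universal property of the tensor product. For biadditive \<open>f\<close> the image
  of a coset is a singleton, so \<open>the_elem\<close> returns the common value. The action in
  \<open>env_rmodule\<close> is spelled out in this very form.\<close>

definition tensor_lift :: "('g, 'z) ring_scheme \<Rightarrow> ('p \<Rightarrow> 'g) \<Rightarrow> ('p \<Rightarrow>\<^sub>0 int) set \<Rightarrow> 'g" where
  "tensor_lift G f t = the_elem (frag_lift G f ` t)"

section \<open>The ring of formal sums of pairs and its ideal of relations\<close>

locale ring_pair = A: ring A + B: ring B
  for A :: "('a, 'c) ring_scheme" and B :: "('b, 'd) ring_scheme"
begin

abbreviation free_ring ("\<F>") where "\<F> \<equiv> free_pair_ring A B"
abbreviation relations ("\<N>") where "\<N> \<equiv> tensor_relations A B"

lemma free_simps [simp]: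
  "c \<in> carrier \<F> \<longleftrightarrow> Poly_Mapping.keys c \<subseteq> carrier A \<times> carrier B"
  "\<one>\<^bsub>\<F>\<^esub> = frag_of (\<one>\<^bsub>A\<^esub>, \<one>\<^bsub>B\<^esub>)" "\<zero>\<^bsub>\<F>\<^esub> = 0" "x \<oplus>\<^bsub>\<F>\<^esub> y = x + y"
  by (auto simp: free_pair_ring_def)

lemma free_mult_of [simp]:
  "frag_of (a, b) \<otimes>\<^bsub>\<F>\<^esub> frag_of (a', b') = frag_of (a \<otimes>\<^bsub>A\<^esub> a', b \<otimes>\<^bsub>B\<^esub> b')"
  by (simp add: free_pair_ring_def)

lemma free_mult_distrib:
  "(x + y) \<otimes>\<^bsub>\<F>\<^esub> z = x \<otimes>\<^bsub>\<F>\<^esub> z + y \<otimes>\<^bsub>\<F>\<^esub> z" "z \<otimes>\<^bsub>\<F>\<^esub> (x + y) = z \<otimes>\<^bsub>\<F>\<^esub> x + z \<otimes>\<^bsub>\<F>\<^esub> y"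
  "(x - y) \<otimes>\<^bsub>\<F>\<^esub> z = x \<otimes>\<^bsub>\<F>\<^esub> z - y \<otimes>\<^bsub>\<F>\<^esub> z" "z \<otimes>\<^bsub>\<F>\<^esub> (x - y) = z \<otimes>\<^bsub>\<F>\<^esub> x - z \<otimes>\<^bsub>\<F>\<^esub> y"
  "0 \<otimes>\<^bsub>\<F>\<^esub> z = 0" "z \<otimes>\<^bsub>\<F>\<^esub> 0 = 0"
  by (auto simp: free_pair_ring_def frag_extend_add frag_extend_diff case_prod_beta'
      frag_extend_pointwise_add frag_extend_pointwise_diff intro!: frag_extend_eq_0)

lemma free_mult_closed:
  assumes "Poly_Mapping.keys x \<subseteq> carrier A \<times> carrier B" "Poly_Mapping.keys y \<subseteq> carrier A \<times> carrier B"
  shows "Poly_Mapping.keys (x \<otimes>\<^bsub>\<F>\<^esub> y) \<subseteq> carrier A \<times> carrier B"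
  using assms(1)
proof (induction x rule: frag_induct)
  case zero
  then show ?case by (simp add: free_mult_distrib)
next
  case (diff x x')
  then show ?case
    using keys_diff[of "x \<otimes>\<^bsub>\<F>\<^esub> y" "x' \<otimes>\<^bsub>\<F>\<^esub> y"] by (auto simp: free_mult_distrib)
next
  case (gen p)
  from assms(2) show ?case
  proof (induction y rule: frag_induct)
    case zero
    then show ?case by (simp add: free_mult_distrib)
  next
    case (diff x x')
    then show ?case
      using keys_diff[of "frag_of p \<otimes>\<^bsub>\<F>\<^esub> x" "frag_of p \<otimes>\<^bsub>\<F>\<^esub> x'"] by (auto simp: free_mult_distrib)
  next
    case (gen q)
    then show ?case
      using \<open>p \<in> carrier A \<times> carrier B\<close> by (cases p; cases q) auto
  qed
qed

lemma free_mult_assoc: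
  assumes x: "Poly_Mapping.keys x \<subseteq> carrier A \<times> carrier B"
    and y: "Poly_Mapping.keys y \<subseteq> carrier A \<times> carrier B"
    and z: "Poly_Mapping.keys z \<subseteq> carrier A \<times> carrier B"
  shows "(x \<otimes>\<^bsub>\<F>\<^esub> y) \<otimes>\<^bsub>\<F>\<^esub> z = x \<otimes>\<^bsub>\<F>\<^esub> (y \<otimes>\<^bsub>\<F>\<^esub> z)"
  using x
proof (induction x rule: frag_induct)
  case (gen p)
  note p = this
  from y show ?case
  proof (induction y rule: frag_induct)
    case (gen q)
    note q = this
    from z show ?case
    proof (induction z rule: frag_induct)
      case (gen r)
      with p q show ?case
        by (cases p; cases q; cases r) (auto simp: A.m_assoc B.m_assoc)
    qed (auto simp: free_mult_distrib)
  qed (auto simp: free_mult_distrib)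
qed (auto simp: free_mult_distrib)

lemma free_ring: "ring \<F>"
proof (intro ringI abelian_groupI)
  show "\<exists>y\<in>carrier \<F>. y \<oplus>\<^bsub>\<F>\<^esub> x = \<zero>\<^bsub>\<F>\<^esub>" if "x \<in> carrier \<F>" for x
    using that by (intro bexI[of _ "- x"]) auto
  show "monoid \<F>"
  proof (rule monoidI)
    fix x assume "x \<in> carrier \<F>"
    then have x: "Poly_Mapping.keys x \<subseteq> carrier A \<times> carrier B" by simp
    from x show "\<one>\<^bsub>\<F>\<^esub> \<otimes>\<^bsub>\<F>\<^esub> x = x"
      by (induction x rule: frag_induct) (auto simp: free_mult_distrib)
    from x show "x \<otimes>\<^bsub>\<F>\<^esub> \<one>\<^bsub>\<F>\<^esub> = x"
      by (induction x rule: frag_induct) (auto simp: free_mult_distrib)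
  qed (auto simp: free_mult_assoc dest: free_mult_closed[THEN subsetD, rotated 2])
qed (auto simp: free_mult_distrib add_ac dest: keys_add[THEN subsetD])

sublocale F: ring \<F> by (rule free_ring)

lemma free_a_inv: "x \<in> carrier \<F> \<Longrightarrow> \<ominus>\<^bsub>\<F>\<^esub> x = - x"
  by (rule F.minus_equality) auto

definition basic_relations where
  "basic_relations =
     {frag_of (a \<oplus>\<^bsub>A\<^esub> a', b) - frag_of (a, b) - frag_of (a', b) | a a' b.
         a \<in> carrier A \<and> a' \<in> carrier A \<and> b \<in> carrier B} \<union>
      {frag_of (a, b \<oplus>\<^bsub>B\<^esub> b') - frag_of (a, b) - frag_of (a, b') | a b b'.
         a \<in> carrier A \<and> b \<in> carrier B \<and> b' \<in> carrier B}"

lemma relations_eq: "\<N> = generate (add_monoid \<F>) basic_relations"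
  by (simp add: tensor_relations_def basic_relations_def)

lemma basic_relations_subset: "basic_relations \<subseteq> carrier \<F>"
  unfolding basic_relations_def by (auto dest!: keys_diff[THEN subsetD])

lemma relations_additive_subgroup: "additive_subgroup \<N> \<F>"
  unfolding relations_eq using basic_relations_subset
  by (intro additive_subgroupI F.add.generate_is_subgroup) simp

sublocale N: additive_subgroup \<N> \<F> by (rule relations_additive_subgroup)

lemma basic_relations_in: "r \<in> basic_relations \<Longrightarrow> r \<in> \<N>"
  unfolding relations_eq by (rule generate.incl)

lemma relations_induct [consumes 1, case_names zero basic minus add]:
  assumes "c \<in> \<N>" and "P 0" and b: "\<And>c. c \<in> basic_relations \<Longrightarrow> P c"
    and m: "\<And>c. c \<in> basic_relations \<Longrightarrow> P c \<Longrightarrow> P (- c)"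
    and a: "\<And>c c'. c \<in> \<N> \<Longrightarrow> c' \<in> \<N> \<Longrightarrow> P c \<Longrightarrow> P c' \<Longrightarrow> P (c + c')"
  shows "P c"
  using assms(1) unfolding relations_eq
proof (induction rule: generate.induct)
  case one
  then show ?case using assms(2) by simp
next
  case (incl h)
  then show ?case by (rule b)
next
  case (inv h)
  then have "inv\<^bsub>add_monoid \<F>\<^esub> h = - h"
    using basic_relations_subset free_a_inv[of h] by (auto simp: a_inv_def)
  then show ?case using inv b m by simp
next
  case (eng c c')
  then show ?case using a[of c c'] by (simp add: relations_eq)
qed

lemma relations_closed:
  "c \<in> \<N> \<Longrightarrow> c' \<in> \<N> \<Longrightarrow> c + c' \<in> \<N>" "c \<in> \<N> \<Longrightarrow> - c \<in> \<N>" "c \<in> \<N> \<Longrightarrow> c' \<in> \<N> \<Longrightarrow> c - c' \<in> \<N>"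
  "0 \<in> \<N>"
proof -
  show a: "c \<in> \<N> \<Longrightarrow> c' \<in> \<N> \<Longrightarrow> c + c' \<in> \<N>" for c c'
    using N.a_closed[of c c'] by simp
  show m: "c \<in> \<N> \<Longrightarrow> - c \<in> \<N>" for c
    by (metis N.a_inv_closed N.a_Hcarr free_a_inv)
  show "c \<in> \<N> \<Longrightarrow> c' \<in> \<N> \<Longrightarrow> c - c' \<in> \<N>"
    using a[of c "- c'"] m by simp
  show "0 \<in> \<N>" using N.zero_closed by simp
qed

text \<open>Multiplication by a fixed element is additive in each factor, so a generator times a
  defining relation is again a defining relation. Inductions on the multiplier and on the relation
  extend this to the ideal property.\<close>

lemma basic_mult_of:
  assumes "c \<in> basic_relations" "a \<in> carrier A" "b \<in> carrier B"
  shows "c \<otimes>\<^bsub>\<F>\<^esub> frag_of (a, b) \<in> basic_relations" "frag_of (a, b) \<otimes>\<^bsub>\<F>\<^esub> c \<in> basic_relations"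
  using assms unfolding basic_relations_def
  by (auto simp: free_mult_distrib A.l_distr A.r_distr B.l_distr B.r_distr)
    (metis A.m_closed B.m_closed)+

lemma relations_ideal: "ideal \<N> \<F>"
proof (intro idealI F.ring_axioms)
  show "subgroup \<N> (add_monoid \<F>)"
    by (rule N.a_subgroup)
next
  fix c x assume c: "c \<in> \<N>" and "x \<in> carrier \<F>"
  then have x: "Poly_Mapping.keys x \<subseteq> carrier A \<times> carrier B" by simp
  have "x \<otimes>\<^bsub>\<F>\<^esub> c \<in> \<N> \<and> c \<otimes>\<^bsub>\<F>\<^esub> x \<in> \<N>"
    using x
  proof (induction x rule: frag_induct)
    case (gen p)
    obtain a b where p: "p = (a, b)" "a \<in> carrier A" "b \<in> carrier B" using gen by (cases p) auto
    from c show ?case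
    proof (induction rule: relations_induct)
      case (basic c)
      then show ?case using p basic_mult_of basic_relations_in by auto
    next
      case (minus c)
      have "x \<otimes>\<^bsub>\<F>\<^esub> - y = - (x \<otimes>\<^bsub>\<F>\<^esub> y)" "- y \<otimes>\<^bsub>\<F>\<^esub> x = - (y \<otimes>\<^bsub>\<F>\<^esub> x)" for x y
        using free_mult_distrib(4)[of x 0 y] free_mult_distrib(3)[of 0 y x]
        by (simp_all add: free_mult_distrib)
      with minus show ?case by (simp add: relations_closed)
    qed (auto simp: free_mult_distrib relations_closed)
  qed (auto simp: free_mult_distrib relations_closed)
  then show "x \<otimes>\<^bsub>\<F>\<^esub> c \<in> \<N>" "c \<otimes>\<^bsub>\<F>\<^esub> x \<in> \<N>" by auto
qed

sublocale N: ideal \<N> \<F> by (rule relations_ideal)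

section \<open>The tensor product as a quotient ring\<close>

abbreviation tensor_prod ("\<S>") where "\<S> \<equiv> tensor_ring A B"
abbreviation tensor_elem (infixl "\<odot>" 75) where "a \<odot> b \<equiv> tensor A B a b"

lemma tensor_ring: "ring \<S>"
  unfolding tensor_ring_def by (rule N.quotient_is_ring)

sublocale S: ring \<S> by (rule tensor_ring)

abbreviation coset where "coset \<equiv> (+>\<^bsub>\<F>\<^esub>) \<N>"

lemma coset_hom: "ring_hom_ring \<F> \<S> coset"
  unfolding tensor_ring_def by (rule N.rcos_ring_hom_ring)

sublocale q: ring_hom_ring \<F> \<S> coset by (rule coset_hom)

lemma coset_surj: "t \<in> carrier \<S> \<Longrightarrow> \<exists>c\<in>carrier \<F>. t = coset c"
  unfolding tensor_ring_def FactRing_def A_RCOSETS_def' by auto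

lemma coset_eq: "t \<in> \<N> \<Longrightarrow> coset t = \<zero>\<^bsub>\<S>\<^esub>"
  using N.a_rcos_const by (simp add: tensor_ring_def FactRing_def)

lemma coset_diff:
  assumes "c \<in> carrier \<F>" "c' \<in> carrier \<F>"
  shows "coset (c - c') = coset c \<ominus>\<^bsub>\<S>\<^esub> coset c'"
proof -
  have "coset (c \<oplus>\<^bsub>\<F>\<^esub> \<ominus>\<^bsub>\<F>\<^esub> c') = coset c \<oplus>\<^bsub>\<S>\<^esub> \<ominus>\<^bsub>\<S>\<^esub> coset c'"
    using assms q.hom_add q.hom_a_inv by (simp del: free_simps)
  then show ?thesis
    using free_a_inv[OF assms(2)] by (simp add: S.minus_eq)
qed

lemma tensor_closed [simp, intro]:
  "a \<in> carrier A \<Longrightarrow> b \<in> carrier B \<Longrightarrow> a \<odot> b \<in> carrier \<S>"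
  unfolding tensor_def by (intro q.hom_closed) simp

lemma tensor_mult:
  assumes "a \<in> carrier A" "b \<in> carrier B" "a' \<in> carrier A" "b' \<in> carrier B"
  shows "(a \<odot> b) \<otimes>\<^bsub>\<S>\<^esub> (a' \<odot> b') = (a \<otimes>\<^bsub>A\<^esub> a') \<odot> (b \<otimes>\<^bsub>B\<^esub> b')"
  unfolding tensor_def using assms q.hom_mult[of "frag_of (a, b)" "frag_of (a', b')"] by simp

lemma tensor_one: "\<one>\<^bsub>\<S>\<^esub> = \<one>\<^bsub>A\<^esub> \<odot> \<one>\<^bsub>B\<^esub>"
  unfolding tensor_def using q.hom_one by simp

lemma coset_relation:
  assumes "x - y - z \<in> basic_relations"
    and "x \<in> carrier \<F>" "y \<in> carrier \<F>" "z \<in> carrier \<F>"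
  shows "coset x = coset y \<oplus>\<^bsub>\<S>\<^esub> coset z"
proof -
  have k: "x - y - z \<in> carrier \<F>"
    using assms(1) basic_relations_subset by blast
  have "coset x = coset ((x - y - z) \<oplus>\<^bsub>\<F>\<^esub> (y \<oplus>\<^bsub>\<F>\<^esub> z))"
    by simp
  also have "\<dots> = coset (x - y - z) \<oplus>\<^bsub>\<S>\<^esub> (coset y \<oplus>\<^bsub>\<S>\<^esub> coset z)"
    using k assms q.hom_add F.a_closed by (simp del: free_simps)
  also have "\<dots> = coset y \<oplus>\<^bsub>\<S>\<^esub> coset z"
    using coset_eq[OF basic_relations_in[OF assms(1)]] assms q.hom_closed by (simp del: free_simps)
  finally show ?thesis .
qed

lemma tensor_add_left:
  assumes "a \<in> carrier A" "a' \<in> carrier A" "b \<in> carrier B"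
  shows "(a \<oplus>\<^bsub>A\<^esub> a') \<odot> b = a \<odot> b \<oplus>\<^bsub>\<S>\<^esub> a' \<odot> b"
  unfolding tensor_def
  by (rule coset_relation) (use assms in \<open>auto simp: basic_relations_def\<close>)

lemma tensor_add_right:
  assumes "a \<in> carrier A" "b \<in> carrier B" "b' \<in> carrier B"
  shows "a \<odot> (b \<oplus>\<^bsub>B\<^esub> b') = a \<odot> b \<oplus>\<^bsub>\<S>\<^esub> a \<odot> b'"
  unfolding tensor_def
  by (rule coset_relation) (use assms in \<open>auto simp: basic_relations_def\<close>)

lemma tensor_zero_left: "b \<in> carrier B \<Longrightarrow> \<zero>\<^bsub>A\<^esub> \<odot> b = \<zero>\<^bsub>\<S>\<^esub>"
  using tensor_add_left[of "\<zero>\<^bsub>A\<^esub>" "\<zero>\<^bsub>A\<^esub>" b] S.add.l_cancel_one[of "\<zero>\<^bsub>A\<^esub> \<odot> b" "\<zero>\<^bsub>A\<^esub> \<odot> b"] by auto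

lemma tensor_zero_right: "a \<in> carrier A \<Longrightarrow> a \<odot> \<zero>\<^bsub>B\<^esub> = \<zero>\<^bsub>\<S>\<^esub>"
  using tensor_add_right[of a "\<zero>\<^bsub>B\<^esub>" "\<zero>\<^bsub>B\<^esub>"] S.add.l_cancel_one[of "a \<odot> \<zero>\<^bsub>B\<^esub>" "a \<odot> \<zero>\<^bsub>B\<^esub>"] by auto

text \<open>The coset map is onto and turns generators into pure tensors, so the induction on formal
  sums descends. Nearly every identity over the enveloping ring is proved with it.\<close>

lemma tensor_induct [consumes 1, case_names zero tensor diff]:
  assumes "t \<in> carrier \<S>" and "P \<zero>\<^bsub>\<S>\<^esub>"
    and "\<And>a b. a \<in> carrier A \<Longrightarrow> b \<in> carrier B \<Longrightarrow> P (a \<odot> b)"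
    and "\<And>t u. t \<in> carrier \<S> \<Longrightarrow> u \<in> carrier \<S> \<Longrightarrow> P t \<Longrightarrow> P u \<Longrightarrow> P (t \<ominus>\<^bsub>\<S>\<^esub> u)"
  shows "P t"
proof -
  obtain c where "Poly_Mapping.keys c \<subseteq> carrier A \<times> carrier B" and t: "t = coset c"
    using coset_surj[OF assms(1)] by auto
  from this(1) have "P (coset c)"
  proof (induction c rule: frag_induct)
    case zero
    then show ?case using q.hom_zero assms(2) by simp
  next
    case (diff x y)
    then show ?case using assms(4)[of "coset x" "coset y"] q.hom_closed by (simp add: coset_diff)
  next
    case (gen p)
    then show ?case using assms(3) by (cases p) (auto simp: tensor_def)
  qed
  with t show ?thesis by simp
qed

section \<open>The universal property of the tensor product\<close>

context
  fixes G :: "('g, 'z) ring_scheme" and f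
  assumes G: "abelian_group G" and f: "biadditive A B G f"
begin

interpretation G: abelian_group G by (rule G)

text \<open>Biadditivity of \<open>f\<close> says exactly that the lift kills the defining
  relations; additivity of the lift carries this to the subgroup they generate.\<close>

lemma frag_lift_relations: "c \<in> \<N> \<Longrightarrow> frag_lift G f c = \<zero>\<^bsub>G\<^esub>"
proof (induction rule: relations_induct)
  case zero
  then show ?case by (rule G.frag_lift_zero)
next
  case (basic c)
  have ff: "f \<in> carrier A \<times> carrier B \<rightarrow> carrier G"
    using f by (simp add: biadditive_def)
  have *: "frag_lift G f (frag_of p - frag_of q - frag_of r) = \<zero>\<^bsub>G\<^esub>"
    if "p \<in> carrier A \<times> carrier B" "q \<in> carrier A \<times> carrier B" "r \<in> carrier A \<times> carrier B"
      "f p = f q \<oplus>\<^bsub>G\<^esub> f r" for p q r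
  proof -
    have c: "f p \<in> carrier G" "f q \<in> carrier G" "f r \<in> carrier G" using that ff by auto
    have "frag_lift G f (frag_of p - (frag_of q + frag_of r)) = f p \<ominus>\<^bsub>G\<^esub> (f q \<oplus>\<^bsub>G\<^esub> f r)"
      using c that keys_add[of "frag_of q" "frag_of r"]
      by (subst G.frag_lift_diff[OF ff]) (auto simp: G.frag_lift_add[OF ff] G.frag_lift_of)
    then show ?thesis
      using c that by (simp add: diff_diff_eq G.minus_eq G.r_neg)
  qed
  from basic f show ?case
    unfolding basic_relations_def by (auto simp: biadditive_def intro!: *)
next
  case (minus c)
  then have "c \<in> carrier \<F>" using basic_relations_subset by blast
  with minus show ?case
    using G.frag_lift_diff[of f "carrier A \<times> carrier B" 0 c] f
    by (auto simp: biadditive_def G.minus_eq G.frag_lift_zero)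
next
  case (add c c')
  then show ?case
    using G.frag_lift_add[of f "carrier A \<times> carrier B" c c'] f N.a_Hcarr[of c] N.a_Hcarr[of c']
    by (auto simp: biadditive_def)
qed

lemma tensor_lift_coset:
  assumes "c \<in> carrier \<F>"
  shows "tensor_lift G f (coset c) = frag_lift G f c"
proof -
  have ff: "f \<in> carrier A \<times> carrier B \<rightarrow> carrier G"
    using f by (simp add: biadditive_def)
  have "frag_lift G f (h + c) = frag_lift G f c" if "h \<in> \<N>" for h
    using G.frag_lift_add[OF ff, of h c] that N.a_Hcarr[of h] assms frag_lift_relations
      G.frag_lift_closed[OF ff] by simp
  then have "frag_lift G f ` coset c = {frag_lift G f c}"
    using relations_closed(4) by (auto simp: a_r_coset_def')
  then show ?thesis by (simp add: tensor_lift_def)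
qed

lemma tensor_lift_tensor:
  assumes "a \<in> carrier A" "b \<in> carrier B"
  shows "tensor_lift G f (a \<odot> b) = f (a, b)"
  unfolding tensor_def using assms f
  by (subst tensor_lift_coset) (auto simp: biadditive_def intro!: G.frag_lift_of)

lemma tensor_lift_hom: "abelian_group_hom \<S> G (tensor_lift G f)"
proof (intro abelian_group_homI group_hom.intro group_hom_axioms.intro homI)
  have ff: "f \<in> carrier A \<times> carrier B \<rightarrow> carrier G"
    using f by (simp add: biadditive_def)
  show "abelian_group \<S>" "abelian_group G" "Group.group (add_monoid \<S>)" "Group.group (add_monoid G)"
    by unfold_locales
  fix t u assume "t \<in> carrier (add_monoid \<S>)"
  then obtain c where c: "c \<in> carrier \<F>" "t = coset c" using coset_surj[of t] by auto
  then show "tensor_lift G f t \<in> carrier (add_monoid G)"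
    using tensor_lift_coset G.frag_lift_closed[OF ff] by auto
  assume "u \<in> carrier (add_monoid \<S>)"
  then obtain c' where c': "c' \<in> carrier \<F>" "u = coset c'" using coset_surj[of u] by auto
  have "tensor_lift G f (coset (c + c')) = frag_lift G f c \<oplus>\<^bsub>G\<^esub> frag_lift G f c'"
    using c c' F.a_closed[of c c'] G.frag_lift_add[OF ff] by (subst tensor_lift_coset) auto
  moreover have "coset (c + c') = coset c \<oplus>\<^bsub>\<S>\<^esub> coset c'"
    using q.hom_add[of c c'] c c' by simp
  ultimately show "tensor_lift G f (t \<otimes>\<^bsub>add_monoid \<S>\<^esub> u)
      = tensor_lift G f t \<otimes>\<^bsub>add_monoid G\<^esub> tensor_lift G f u"
    using c c' tensor_lift_coset by simp
qed

end

end

section \<open>Modules of quotients\<close>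

context right_module
begin

lemma ract_zero_left: "r \<in> carrier R \<Longrightarrow> \<zero>\<^bsub>M\<^esub> \<triangleleft>\<^bsub>M\<^esub> r = \<zero>\<^bsub>M\<^esub>"
  using ract_add_left[of "\<zero>\<^bsub>M\<^esub>" "\<zero>\<^bsub>M\<^esub>" r] ract_closed[of "\<zero>\<^bsub>M\<^esub>" r]
    M.add.l_cancel_one[of "\<zero>\<^bsub>M\<^esub> \<triangleleft>\<^bsub>M\<^esub> r" "\<zero>\<^bsub>M\<^esub> \<triangleleft>\<^bsub>M\<^esub> r"] by auto

lemma ract_zero_right: "x \<in> carrier M \<Longrightarrow> x \<triangleleft>\<^bsub>M\<^esub> \<zero>\<^bsub>R\<^esub> = \<zero>\<^bsub>M\<^esub>"
  using ract_add_right[of x "\<zero>\<^bsub>R\<^esub>" "\<zero>\<^bsub>R\<^esub>"] ract_closed[of x "\<zero>\<^bsub>R\<^esub>"]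
    M.add.l_cancel_one[of "x \<triangleleft>\<^bsub>M\<^esub> \<zero>\<^bsub>R\<^esub>" "x \<triangleleft>\<^bsub>M\<^esub> \<zero>\<^bsub>R\<^esub>"] by auto

lemma ract_minus_left:
  assumes "x \<in> carrier M" "r \<in> carrier R"
  shows "(\<ominus>\<^bsub>M\<^esub> x) \<triangleleft>\<^bsub>M\<^esub> r = \<ominus>\<^bsub>M\<^esub> (x \<triangleleft>\<^bsub>M\<^esub> r)"
  using ract_add_left[of "\<ominus>\<^bsub>M\<^esub> x" x r] assms
  by (intro M.minus_equality[symmetric]) (auto simp: ract_closed M.l_neg ract_zero_left)

lemma ract_minus_right:
  assumes "x \<in> carrier M" "r \<in> carrier R"
  shows "x \<triangleleft>\<^bsub>M\<^esub> (\<ominus>\<^bsub>R\<^esub> r) = \<ominus>\<^bsub>M\<^esub> (x \<triangleleft>\<^bsub>M\<^esub> r)"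
  using ract_add_right[of x "\<ominus>\<^bsub>R\<^esub> r" r] assms
  by (intro M.minus_equality[symmetric]) (auto simp: ract_closed R.l_neg ract_zero_right)

lemma right_ideal_annihilator:
  assumes "x \<in> carrier M"
  shows "right_ideal {r \<in> carrier R. x \<triangleleft>\<^bsub>M\<^esub> r = \<zero>\<^bsub>M\<^esub>} R"
  unfolding right_ideal_def
  by (intro conjI additive_subgroupI R.add.subgroupI)
    (use assms in \<open>auto simp: ract_add_right ract_mult ract_zero_left ract_zero_right ract_minus_right
      simp flip: a_inv_def\<close>)

end

text \<open>The one-sided counterpart of \<open>bimodule_derivation\<close>. Over the enveloping
  ring its single Leibniz rule replaces the two rules over \<open>R\<close>, see
  \<open>bimodule_derivation_iff\<close>.\<close>

definition module_derivation ::
    "('a, 'b) ring_scheme \<Rightarrow> ('a \<Rightarrow> 'a) \<Rightarrow> ('a, 'm, 'c) rmodule_scheme \<Rightarrow> ('m \<Rightarrow> 'm) \<Rightarrow> bool" where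
  "module_derivation R D M d \<longleftrightarrow>
     d \<in> carrier M \<rightarrow> carrier M \<and>
     (\<forall>x\<in>carrier M. \<forall>y\<in>carrier M. d (x \<oplus>\<^bsub>M\<^esub> y) = d x \<oplus>\<^bsub>M\<^esub> d y) \<and>
     (\<forall>x\<in>carrier M. \<forall>r\<in>carrier R. d (x \<triangleleft>\<^bsub>M\<^esub> r) = (d x \<triangleleft>\<^bsub>M\<^esub> r) \<oplus>\<^bsub>M\<^esub> (x \<triangleleft>\<^bsub>M\<^esub> D r))"

lemma module_derivationD:
  assumes "module_derivation R D M d" and "x \<in> carrier M"
  shows "d x \<in> carrier M"
    "y \<in> carrier M \<Longrightarrow> d (x \<oplus>\<^bsub>M\<^esub> y) = d x \<oplus>\<^bsub>M\<^esub> d y"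
    "r \<in> carrier R \<Longrightarrow> d (x \<triangleleft>\<^bsub>M\<^esub> r) = (d x \<triangleleft>\<^bsub>M\<^esub> r) \<oplus>\<^bsub>M\<^esub> (x \<triangleleft>\<^bsub>M\<^esub> D r)"
  using assms unfolding module_derivation_def by auto

lemma ring_derivationD:
  assumes "ring_derivation R D" and "r \<in> carrier R"
  shows "D r \<in> carrier R"
    "s \<in> carrier R \<Longrightarrow> D (r \<oplus>\<^bsub>R\<^esub> s) = D r \<oplus>\<^bsub>R\<^esub> D s"
    "s \<in> carrier R \<Longrightarrow> D (r \<otimes>\<^bsub>R\<^esub> s) = D r \<otimes>\<^bsub>R\<^esub> s \<oplus>\<^bsub>R\<^esub> r \<otimes>\<^bsub>R\<^esub> D s"
  using assms unfolding ring_derivation_def by auto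

context abelian_group
begin

lemma eq_of_diff_zero:
  assumes "x \<in> carrier G" "y \<in> carrier G" "x \<ominus> y = \<zero>"
  shows "x = y"
  using minus_equality[of x "\<ominus> y"] assms by (simp add: minus_eq)

lemma additive_zero:
  assumes "f \<in> carrier G \<rightarrow> carrier G" and "\<And>x y. x \<in> carrier G \<Longrightarrow> y \<in> carrier G \<Longrightarrow> f (x \<oplus> y) = f x \<oplus> f y"
  shows "f \<zero> = \<zero>"
proof -
  have "f \<zero> = f \<zero> \<oplus> f \<zero>" using assms(2)[of \<zero> \<zero>] by simp
  moreover have "f \<zero> \<in> carrier G" using assms(1) by auto
  ultimately show ?thesis using add.l_cancel_one[of "f \<zero>" "f \<zero>"] by simp
qed

lemma additive_minus:
  assumes "f \<in> carrier G \<rightarrow> carrier G" and "\<And>x y. x \<in> carrier G \<Longrightarrow> y \<in> carrier G \<Longrightarrow> f (x \<oplus> y) = f x \<oplus> f y"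
    and "x \<in> carrier G"
  shows "f (\<ominus> x) = \<ominus> f x"
proof -
  have "f \<zero> = \<zero>" using assms by (intro additive_zero) auto
  then show ?thesis
    using assms(2)[of "\<ominus> x" x] assms by (intro minus_equality[symmetric]) (auto simp: l_neg)
qed

end

context ring
begin

lemma right_idealI:
  assumes "K \<subseteq> carrier R" "\<zero> \<in> K" "\<And>a. a \<in> K \<Longrightarrow> \<ominus> a \<in> K" "\<And>a b. a \<in> K \<Longrightarrow> b \<in> K \<Longrightarrow> a \<oplus> b \<in> K"
    "\<And>a r. a \<in> K \<Longrightarrow> r \<in> carrier R \<Longrightarrow> a \<otimes> r \<in> K"
  shows "right_ideal K R"
  unfolding right_ideal_def
proof (intro conjI additive_subgroupI add.subgroupI ballI)
  show "K \<noteq> {}" using assms(2) by blast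
qed (fact assms)+

lemma right_idealD:
  assumes "right_ideal K R"
  shows "a \<in> K \<Longrightarrow> a \<in> carrier R" "\<zero> \<in> K" "a \<in> K \<Longrightarrow> b \<in> K \<Longrightarrow> a \<oplus> b \<in> K"
    "a \<in> K \<Longrightarrow> \<ominus> a \<in> K" "a \<in> K \<Longrightarrow> r \<in> carrier R \<Longrightarrow> a \<otimes> r \<in> K"
proof -
  interpret additive_subgroup K R
    using assms by (simp add: right_ideal_def)
  show "a \<in> K \<Longrightarrow> a \<in> carrier R" using a_subset by blast
  show "\<zero> \<in> K" by (rule additive_subgroup.zero_closed[OF additive_subgroup_axioms])
  show "a \<in> K \<Longrightarrow> b \<in> K \<Longrightarrow> a \<oplus> b \<in> K" by (rule additive_subgroup.a_closed[OF additive_subgroup_axioms])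
  show "a \<in> K \<Longrightarrow> r \<in> carrier R \<Longrightarrow> a \<otimes> r \<in> K"
    using assms unfolding right_ideal_def by blast
  show "a \<in> K \<Longrightarrow> \<ominus> a \<in> K"
    using add.subgroupE(3)[OF a_subgroup] by (simp add: a_inv_def)
qed

end

section \<open>Gabriel filters and derivations of the ring\<close>

locale gabriel_filter = S: ring S for S :: "('a, 'b) ring_scheme" and F +
  assumes gabriel: "right_gabriel_filter S F"
begin

lemma filter_right_ideal: "K \<in> F \<Longrightarrow> right_ideal K S"
  and filter_superset: "K \<in> F \<Longrightarrow> right_ideal L S \<Longrightarrow> K \<subseteq> L \<Longrightarrow> L \<in> F"
  and filter_Int: "K \<in> F \<Longrightarrow> L \<in> F \<Longrightarrow> K \<inter> L \<in> F"
  and filter_colon: "K \<in> F \<Longrightarrow> a \<in> carrier S \<Longrightarrow> {r \<in> carrier S. a \<otimes>\<^bsub>S\<^esub> r \<in> K} \<in> F"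
  and filter_local: "right_ideal L S \<Longrightarrow> K \<in> F \<Longrightarrow>
    (\<And>a. a \<in> K \<Longrightarrow> {r \<in> carrier S. a \<otimes>\<^bsub>S\<^esub> r \<in> L} \<in> F) \<Longrightarrow> L \<in> F"
proof -
  note g = gabriel[unfolded right_gabriel_filter_def, THEN conjunct2]
  note g' = g[THEN conjunct2, THEN conjunct2]
  show "K \<in> F \<Longrightarrow> right_ideal K S"
    by (rule g[THEN conjunct1, rule_format])
  show "K \<in> F \<Longrightarrow> right_ideal L S \<Longrightarrow> K \<subseteq> L \<Longrightarrow> L \<in> F"
    by (rule g[THEN conjunct2, THEN conjunct1, rule_format, OF _ conjI])
  show "K \<in> F \<Longrightarrow> L \<in> F \<Longrightarrow> K \<inter> L \<in> F"
    by (rule g'[THEN conjunct1, rule_format])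
  show "K \<in> F \<Longrightarrow> a \<in> carrier S \<Longrightarrow> {r \<in> carrier S. a \<otimes>\<^bsub>S\<^esub> r \<in> K} \<in> F"
    by (rule g'[THEN conjunct2, THEN conjunct1, rule_format])
  show "right_ideal L S \<Longrightarrow> K \<in> F \<Longrightarrow>
    (\<And>a. a \<in> K \<Longrightarrow> {r \<in> carrier S. a \<otimes>\<^bsub>S\<^esub> r \<in> L} \<in> F) \<Longrightarrow> L \<in> F"
    by (rule g'[THEN conjunct2, THEN conjunct2, THEN spec, THEN bspec, THEN mp]) blast+
qed

lemmas filterD = S.right_idealD[OF filter_right_ideal]

lemma carrier_in_filter: "carrier S \<in> F"
proof -
  have "F \<noteq> {}"
    using gabriel unfolding right_gabriel_filter_def by (rule conjunct1)
  then obtain K where "K \<in> F" by blast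
  moreover have "right_ideal (carrier S) S"
    unfolding right_ideal_def
    by (intro conjI additive_subgroupI S.add.subgroupI) (auto simp flip: a_inv_def)
  ultimately show ?thesis
    using filter_superset filterD(1) by blast
qed

text \<open>In \<open>D(a r) = D(a) r + a D(r)\<close> with \<open>a \<in> K\<close> the last
  summand lies in the right ideal \<open>K\<close>, so \<open>D(a r) \<in> K\<close> amounts to
  \<open>D(a) r \<in> K\<close>. Hence the colon of the restricted ideal at \<open>a\<close> is the
  colon of \<open>K\<close> at \<open>D a\<close>, a member of the filter, and the local axiom
  applies with \<open>K\<close> itself as the test ideal.\<close>

lemma derivation_restrict_in_filter:
  assumes D: "ring_derivation S D" and K: "K \<in> F"
  shows "{a \<in> K. D a \<in> K} \<in> F" (is "?J \<in> F")
proof (rule filter_local[OF _ K])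
  note Kc = filterD[OF K]
  have D0: "D \<zero>\<^bsub>S\<^esub> = \<zero>\<^bsub>S\<^esub>"
    using ring_derivationD[OF D] by (intro S.additive_zero) auto
  have Dm: "D (\<ominus>\<^bsub>S\<^esub> a) = \<ominus>\<^bsub>S\<^esub> D a" if "a \<in> carrier S" for a
    using ring_derivationD[OF D] that by (intro S.additive_minus) auto
  show "right_ideal ?J S"
    unfolding right_ideal_def
  proof (intro conjI additive_subgroupI S.add.subgroupI)
    show "?J \<noteq> {}" using Kc(2) D0 by auto
  qed (use Kc Dm ring_derivationD[OF D] in \<open>auto simp flip: a_inv_def\<close>)
  fix a assume a: "a \<in> K"
  have "{r \<in> carrier S. a \<otimes>\<^bsub>S\<^esub> r \<in> ?J} = {r \<in> carrier S. D a \<otimes>\<^bsub>S\<^esub> r \<in> K}"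
  proof (intro Collect_cong conj_cong refl)
    fix r assume r: "r \<in> carrier S"
    have c: "D a \<otimes>\<^bsub>S\<^esub> r \<in> carrier S" "a \<otimes>\<^bsub>S\<^esub> D r \<in> K" "a \<otimes>\<^bsub>S\<^esub> D r \<in> carrier S"
      using a r Kc ring_derivationD(1)[OF D] by (auto intro: S.m_closed)
    have e: "D (a \<otimes>\<^bsub>S\<^esub> r) = D a \<otimes>\<^bsub>S\<^esub> r \<oplus>\<^bsub>S\<^esub> a \<otimes>\<^bsub>S\<^esub> D r"
      using ring_derivationD(3)[OF D] a r Kc by auto
    have "D a \<otimes>\<^bsub>S\<^esub> r = D (a \<otimes>\<^bsub>S\<^esub> r) \<oplus>\<^bsub>S\<^esub> \<ominus>\<^bsub>S\<^esub> (a \<otimes>\<^bsub>S\<^esub> D r)"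
      using c by (simp add: e S.a_assoc S.r_neg)
    then have "D a \<otimes>\<^bsub>S\<^esub> r \<in> K" if "D (a \<otimes>\<^bsub>S\<^esub> r) \<in> K"
      using Kc(3)[OF that Kc(4)[OF c(2)]] by simp
    moreover have "D (a \<otimes>\<^bsub>S\<^esub> r) \<in> K" if "D a \<otimes>\<^bsub>S\<^esub> r \<in> K"
      using Kc(3)[OF that c(2)] by (simp add: e)
    ultimately show "(a \<otimes>\<^bsub>S\<^esub> r \<in> ?J) = (D a \<otimes>\<^bsub>S\<^esub> r \<in> K)"
      using Kc(5)[OF a r] by blast
  qed
  also have "\<dots> \<in> F"
    using K a Kc ring_derivationD[OF D] by (intro filter_colon) auto
  finally show "{r \<in> carrier S. a \<otimes>\<^bsub>S\<^esub> r \<in> ?J} \<in> F" .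
qed

text \<open>The witness \<open>{a \<in> I. D a \<in> I}\<close> is chosen after \<open>D\<close>, as
  the quantifiers of \<open>differential_filter\<close> allow. A witness common to all derivations
  would call for an intersection over all \<open>D\<close>, whereas a filter is closed only under
  finite ones.\<close>

lemma differential: "differential_filter S F"
  unfolding differential_filter_def
proof (intro allI impI ballI)
  fix D I assume "ring_derivation S D" "I \<in> F"
  then show "\<exists>J\<in>F. D ` J \<subseteq> I"
    by (intro bexI[OF _ derivation_restrict_in_filter]) auto
qed

end

section \<open>The torsion submodule and the torsion-free quotient\<close>

locale gabriel_module = gabriel_filter S F + M: right_module S M
  for S :: "('a, 'b) ring_scheme" and F and M :: "('a, 'm, 'c) rmodule_scheme"
begin

abbreviation torsion_part ("T") where "T \<equiv> torsion S F M"
abbreviation torsion_quotient ("N") where "N \<equiv> quotient_rmodule M T"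
abbreviation proj ("\<pi>") where "\<pi> m \<equiv> T +>\<^bsub>M\<^esub> m"

text \<open>Upward closure replaces the full annihilator by any member of the filter that kills
  \<open>x\<close>; such a member is easier to exhibit.\<close>

lemma torsion_iff: "x \<in> T \<longleftrightarrow> x \<in> carrier M \<and> (\<exists>K\<in>F. \<forall>r\<in>K. x \<triangleleft>\<^bsub>M\<^esub> r = \<zero>\<^bsub>M\<^esub>)"
proof
  assume "x \<in> carrier M \<and> (\<exists>K\<in>F. \<forall>r\<in>K. x \<triangleleft>\<^bsub>M\<^esub> r = \<zero>\<^bsub>M\<^esub>)"
  then show "x \<in> T"
    using filter_superset[OF _ M.right_ideal_annihilator[of x]] filterD(1)
    unfolding torsion_def by blast
next
  assume "x \<in> T"
  then show "x \<in> carrier M \<and> (\<exists>K\<in>F. \<forall>r\<in>K. x \<triangleleft>\<^bsub>M\<^esub> r = \<zero>\<^bsub>M\<^esub>)"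
    by (auto simp: torsion_def intro: bexI[of _ "{r \<in> carrier S. x \<triangleleft>\<^bsub>M\<^esub> r = \<zero>\<^bsub>M\<^esub>}"])
qed

text \<open>If \<open>K\<close> kills \<open>x\<close>, then the colon of \<open>K\<close> at
  \<open>s\<close> kills \<open>x s\<close>.\<close>

lemma torsion_ract:
  assumes "x \<in> T" "s \<in> carrier S"
  shows "x \<triangleleft>\<^bsub>M\<^esub> s \<in> T"
proof -
  obtain K where K: "K \<in> F" "\<forall>r\<in>K. x \<triangleleft>\<^bsub>M\<^esub> r = \<zero>\<^bsub>M\<^esub>" and x: "x \<in> carrier M"
    using assms torsion_iff by blast
  have "\<forall>r\<in>{r \<in> carrier S. s \<otimes>\<^bsub>S\<^esub> r \<in> K}. x \<triangleleft>\<^bsub>M\<^esub> s \<triangleleft>\<^bsub>M\<^esub> r = \<zero>\<^bsub>M\<^esub>"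
    using K x assms(2) by (auto simp flip: M.ract_mult)
  then show ?thesis
    unfolding torsion_iff using filter_colon[OF K(1) assms(2)] x assms(2) M.ract_closed by blast
qed

lemma torsion_additive_subgroup: "additive_subgroup T M"
proof (intro additive_subgroupI M.M.add.subgroupI)
  show "T \<subseteq> carrier M" by (auto simp: torsion_def)
  have "\<zero>\<^bsub>M\<^esub> \<in> T"
    unfolding torsion_iff by (auto simp: M.ract_zero_left intro: bexI[OF _ carrier_in_filter])
  then show "T \<noteq> {}" by auto
  fix x assume x: "x \<in> T"
  then show "\<ominus>\<^bsub>M\<^esub> x \<in> T"
    unfolding torsion_iff using filterD(1) by (fastforce simp: M.ract_minus_left)
  fix y assume "y \<in> T"
  with x obtain K L where "K \<in> F" "\<forall>r\<in>K. x \<triangleleft>\<^bsub>M\<^esub> r = \<zero>\<^bsub>M\<^esub>" "L \<in> F" "\<forall>r\<in>L. y \<triangleleft>\<^bsub>M\<^esub> r = \<zero>\<^bsub>M\<^esub>"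
    "x \<in> carrier M" "y \<in> carrier M"
    unfolding torsion_iff by blast
  then have "\<forall>r\<in>K \<inter> L. (x \<oplus>\<^bsub>M\<^esub> y) \<triangleleft>\<^bsub>M\<^esub> r = \<zero>\<^bsub>M\<^esub>" "K \<inter> L \<in> F" "x \<oplus>\<^bsub>M\<^esub> y \<in> carrier M"
    using filterD(1) filter_Int by (auto simp: M.ract_add_left)
  then show "x \<oplus>\<^bsub>M\<^esub> y \<in> T"
    unfolding torsion_iff by auto
qed

sublocale T: abelian_subgroup T M
  by (intro abelian_subgroupI3 torsion_additive_subgroup M.M.abelian_group_axioms)

lemma N_simps:
  "carrier N = a_rcosets\<^bsub>M\<^esub> T" "\<zero>\<^bsub>N\<^esub> = T" "x \<oplus>\<^bsub>N\<^esub> y = x <+>\<^bsub>M\<^esub> y"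
  by (simp_all add: quotient_rmodule_def)

lemma proj_closed [simp]: "x \<in> carrier M \<Longrightarrow> \<pi> x \<in> carrier N"
  using T.a_subset M.M.a_rcosetsI by (simp add: N_simps)

lemma proj_surj: "u \<in> carrier N \<Longrightarrow> \<exists>x\<in>carrier M. u = \<pi> x"
  by (auto simp: N_simps A_RCOSETS_def')

lemma proj_add [simp]: "x \<in> carrier M \<Longrightarrow> y \<in> carrier M \<Longrightarrow> \<pi> x \<oplus>\<^bsub>N\<^esub> \<pi> y = \<pi> (x \<oplus>\<^bsub>M\<^esub> y)"
  by (simp add: N_simps T.a_rcos_sum)

lemma proj_eq_iff:
  "x \<in> carrier M \<Longrightarrow> y \<in> carrier M \<Longrightarrow> \<pi> x = \<pi> y \<longleftrightarrow> x \<ominus>\<^bsub>M\<^esub> y \<in> T"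
  using T.a_rcos_module[of y x] T.a_rcos_self[of x] T.a_repr_independence'[of x y]
  by (auto simp: M.M.minus_eq)

lemma proj_zero_iff: "x \<in> carrier M \<Longrightarrow> \<pi> x = \<zero>\<^bsub>N\<^esub> \<longleftrightarrow> x \<in> T"
  by (metis N_simps(2) T.a_rcos_const T.a_rcos_self)

text \<open>Operations on cosets are defined as unions over representatives. Once the value is
  independent of the representative, the union collapses to it; \<open>cls_UN\<close> does the same
  for classes of the direct limit.\<close>

lemma proj_image:
  assumes "x \<in> carrier M"
    and "\<And>y. y \<in> carrier M \<Longrightarrow> \<pi> y = \<pi> x \<Longrightarrow> g y = c"
  shows "(\<Union>y\<in>\<pi> x. g y) = c"
proof -
  have "y \<in> carrier M \<and> \<pi> y = \<pi> x" if "y \<in> \<pi> x" for y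
    using that assms(1) T.a_elemrcos_carrier T.a_repr_independence' by auto
  moreover have "x \<in> \<pi> x" using assms(1) by (rule T.a_rcos_self)
  ultimately show ?thesis
    using assms by blast
qed

lemma ract_diff:
  assumes "x \<in> carrier M" "y \<in> carrier M" "r \<in> carrier S"
  shows "(x \<ominus>\<^bsub>M\<^esub> y) \<triangleleft>\<^bsub>M\<^esub> r = x \<triangleleft>\<^bsub>M\<^esub> r \<ominus>\<^bsub>M\<^esub> y \<triangleleft>\<^bsub>M\<^esub> r"
  using assms by (simp add: M.M.minus_eq M.ract_add_left M.ract_minus_left)

lemma proj_ract [simp]:
  assumes "x \<in> carrier M" "r \<in> carrier S"
  shows "\<pi> x \<triangleleft>\<^bsub>N\<^esub> r = \<pi> (x \<triangleleft>\<^bsub>M\<^esub> r)"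
proof -
  have "\<pi> (y \<triangleleft>\<^bsub>M\<^esub> r) = \<pi> (x \<triangleleft>\<^bsub>M\<^esub> r)" if "y \<in> carrier M" "\<pi> y = \<pi> x" for y
    using that assms torsion_ract[of "y \<ominus>\<^bsub>M\<^esub> x" r]
    by (simp add: proj_eq_iff M.ract_closed ract_diff)
  then have "(\<Union>y\<in>\<pi> x. \<pi> (y \<triangleleft>\<^bsub>M\<^esub> r)) = \<pi> (x \<triangleleft>\<^bsub>M\<^esub> r)"
    by (rule proj_image[OF assms(1)])
  then show ?thesis
    by (simp add: quotient_rmodule_def)
qed

lemma N_abelian_group: "abelian_group N"
proof (rule abelian_groupI)
  show z: "\<zero>\<^bsub>N\<^esub> \<in> carrier N"
    using T.a_subgroup_in_rcosets by (simp add: N_simps)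
  have z': "\<zero>\<^bsub>N\<^esub> = \<pi> \<zero>\<^bsub>M\<^esub>"
    using proj_zero_iff[of "\<zero>\<^bsub>M\<^esub>"] T.zero_closed by simp
  fix x assume "x \<in> carrier N"
  then obtain a where a: "a \<in> carrier M" "x = \<pi> a" using proj_surj by blast
  then show "\<zero>\<^bsub>N\<^esub> \<oplus>\<^bsub>N\<^esub> x = x" by (simp add: z')
  from a show "\<exists>y\<in>carrier N. y \<oplus>\<^bsub>N\<^esub> x = \<zero>\<^bsub>N\<^esub>"
    by (intro bexI[of _ "\<pi> (\<ominus>\<^bsub>M\<^esub> a)"]) (auto simp: z' M.M.l_neg)
  fix y assume "y \<in> carrier N"
  then obtain b where b: "b \<in> carrier M" "y = \<pi> b" using proj_surj by blast
  with a show "x \<oplus>\<^bsub>N\<^esub> y \<in> carrier N" "x \<oplus>\<^bsub>N\<^esub> y = y \<oplus>\<^bsub>N\<^esub> x"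
    by (auto simp: M.M.a_comm)
  fix z assume "z \<in> carrier N"
  then obtain c where c: "c \<in> carrier M" "z = \<pi> c" using proj_surj by blast
  with a b show "x \<oplus>\<^bsub>N\<^esub> y \<oplus>\<^bsub>N\<^esub> z = x \<oplus>\<^bsub>N\<^esub> (y \<oplus>\<^bsub>N\<^esub> z)"
    by (simp add: M.M.a_assoc)
qed

lemma N_right_module: "right_module S N"
proof (intro right_module.intro right_module_axioms.intro S.ring_axioms N_abelian_group)
  fix x r s assume "x \<in> carrier N" and r: "r \<in> carrier S"
  then obtain a where a: "a \<in> carrier M" "x = \<pi> a" using proj_surj by blast
  with r show "x \<triangleleft>\<^bsub>N\<^esub> r \<in> carrier N"
    by (auto simp: M.ract_closed)
  assume s: "s \<in> carrier S"
  with a r show "x \<triangleleft>\<^bsub>N\<^esub> (r \<oplus>\<^bsub>S\<^esub> s) = x \<triangleleft>\<^bsub>N\<^esub> r \<oplus>\<^bsub>N\<^esub> x \<triangleleft>\<^bsub>N\<^esub> s"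
    "x \<triangleleft>\<^bsub>N\<^esub> (r \<otimes>\<^bsub>S\<^esub> s) = x \<triangleleft>\<^bsub>N\<^esub> r \<triangleleft>\<^bsub>N\<^esub> s"
    by (auto simp: M.ract_closed M.ract_add_right M.ract_mult)
next
  fix x y r assume "x \<in> carrier N" "y \<in> carrier N" and r: "r \<in> carrier S"
  then obtain a b where "a \<in> carrier M" "x = \<pi> a" "b \<in> carrier M" "y = \<pi> b" using proj_surj by blast
  with r show "(x \<oplus>\<^bsub>N\<^esub> y) \<triangleleft>\<^bsub>N\<^esub> r = x \<triangleleft>\<^bsub>N\<^esub> r \<oplus>\<^bsub>N\<^esub> y \<triangleleft>\<^bsub>N\<^esub> r"
    by (auto simp: M.ract_closed M.ract_add_left)
next
  fix x assume "x \<in> carrier N"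
  then obtain a where a: "a \<in> carrier M" "x = \<pi> a" using proj_surj by blast
  then show "x \<triangleleft>\<^bsub>N\<^esub> \<one>\<^bsub>S\<^esub> = x"
    by (simp add: M.ract_one)
qed

sublocale N: right_module S N by (rule N_right_module)

text \<open>If \<open>K\<close> kills the coset of \<open>x\<close>, then \<open>x a\<close> is
  torsion for each \<open>a \<in> K\<close>. The annihilator of \<open>x a\<close> is the colon at
  \<open>a\<close> of the annihilator of \<open>x\<close>, so the local axiom puts the annihilator
  of \<open>x\<close> itself into the filter.\<close>

lemma N_torsion_free:
  assumes "u \<in> carrier N" "K \<in> F" "\<And>r. r \<in> K \<Longrightarrow> u \<triangleleft>\<^bsub>N\<^esub> r = \<zero>\<^bsub>N\<^esub>"
  shows "u = \<zero>\<^bsub>N\<^esub>"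
proof -
  obtain x where x: "x \<in> carrier M" "u = \<pi> x" using proj_surj assms(1) by blast
  let ?I = "{r \<in> carrier S. x \<triangleleft>\<^bsub>M\<^esub> r = \<zero>\<^bsub>M\<^esub>}"
  have "?I \<in> F"
  proof (rule filter_local[OF M.right_ideal_annihilator[OF x(1)] assms(2)])
    fix a assume a: "a \<in> K"
    then have ac: "a \<in> carrier S" using filterD(1) assms(2) by blast
    then have "x \<triangleleft>\<^bsub>M\<^esub> a \<in> T"
      using assms(3)[OF a] x proj_zero_iff by (simp add: M.ract_closed)
    then have "{r \<in> carrier S. x \<triangleleft>\<^bsub>M\<^esub> a \<triangleleft>\<^bsub>M\<^esub> r = \<zero>\<^bsub>M\<^esub>} \<in> F"
      unfolding torsion_def by blast
    also have "{r \<in> carrier S. x \<triangleleft>\<^bsub>M\<^esub> a \<triangleleft>\<^bsub>M\<^esub> r = \<zero>\<^bsub>M\<^esub>} = {r \<in> carrier S. a \<otimes>\<^bsub>S\<^esub> r \<in> ?I}"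
      using x ac by (auto simp: M.ract_mult)
    finally show "{r \<in> carrier S. a \<otimes>\<^bsub>S\<^esub> r \<in> ?I} \<in> F" .
  qed
  with x have "x \<in> T" unfolding torsion_def by blast
  with x show ?thesis
    by (simp add: proj_zero_iff)
qed

subsection \<open>The direct limit\<close>

abbreviation "H K \<equiv> ideal_hom S K N"
abbreviation "E \<equiv> limit_rel S F M"
abbreviation "P \<equiv> limit_pairs S F M"
abbreviation "Q \<equiv> module_of_quotients S F M"
abbreviation "cls K f \<equiv> E `` {(K, f)}"
abbreviation "colon K r \<equiv> {t \<in> carrier S. r \<otimes>\<^bsub>S\<^esub> t \<in> K}"

lemma pairs_iff: "(K, f) \<in> P \<longleftrightarrow> K \<in> F \<and> f \<in> H K"
  by (simp add: limit_pairs_def)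

lemma homD:
  assumes "f \<in> H K" and "t \<in> K"
  shows "f t \<in> carrier N" "s \<in> K \<Longrightarrow> f (t \<oplus>\<^bsub>S\<^esub> s) = f t \<oplus>\<^bsub>N\<^esub> f s"
    "r \<in> carrier S \<Longrightarrow> f (t \<otimes>\<^bsub>S\<^esub> r) = f t \<triangleleft>\<^bsub>N\<^esub> r"
  using assms unfolding ideal_hom_def by auto

lemma restrict_pairI:
  assumes "K \<in> F" and "\<And>t. t \<in> K \<Longrightarrow> f t \<in> carrier N"
    and "\<And>s t. s \<in> K \<Longrightarrow> t \<in> K \<Longrightarrow> f (s \<oplus>\<^bsub>S\<^esub> t) = f s \<oplus>\<^bsub>N\<^esub> f t"
    and "\<And>t r. t \<in> K \<Longrightarrow> r \<in> carrier S \<Longrightarrow> f (t \<otimes>\<^bsub>S\<^esub> r) = f t \<triangleleft>\<^bsub>N\<^esub> r"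
  shows "(K, restrict f K) \<in> P"
  using assms filterD(3,5)[OF assms(1)] unfolding pairs_iff ideal_hom_def by auto

lemma rel_eq:
  "((K, f), (L, g)) \<in> E \<longleftrightarrow> (K, f) \<in> P \<and> (L, g) \<in> P \<and> (\<exists>J\<in>F. J \<subseteq> K \<inter> L \<and> (\<forall>t\<in>J. f t = g t))"
  unfolding limit_rel_def by simp

text \<open>For \<open>t\<close> in both domains, \<open>f t - g t\<close> is killed by the colon at
  \<open>t\<close> of the ideal on which \<open>f\<close> and \<open>g\<close> agree, and
  \<open>N\<close> is torsion-free. The existential in \<open>limit_rel\<close> thus disappears, and
  independence of representatives becomes a pointwise check.\<close>

lemma rel_iff:
  assumes "(K, f) \<in> P" "(L, g) \<in> P"
  shows "((K, f), (L, g)) \<in> E \<longleftrightarrow> (\<forall>t\<in>K \<inter> L. f t = g t)"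
proof
  assume "((K, f), (L, g)) \<in> E"
  then obtain J where J: "J \<in> F" "J \<subseteq> K \<inter> L" "\<forall>t\<in>J. f t = g t"
    unfolding rel_eq by blast
  show "\<forall>t\<in>K \<inter> L. f t = g t"
  proof
    fix t assume t: "t \<in> K \<inter> L"
    have K: "K \<in> F" "L \<in> F" "f \<in> H K" "g \<in> H L"
      using assms by (auto simp: pairs_iff)
    have tc: "t \<in> carrier S" using t K filterD(1) by blast
    have c: "f t \<in> carrier N" "g t \<in> carrier N"
      using t K homD by auto
    have "f t \<ominus>\<^bsub>N\<^esub> g t = \<zero>\<^bsub>N\<^esub>"
    proof (rule N_torsion_free[OF _ filter_colon[OF J(1) tc]])
      fix r assume r: "r \<in> colon J t"
      then have "f t \<triangleleft>\<^bsub>N\<^esub> r = g t \<triangleleft>\<^bsub>N\<^esub> r"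
        using homD(3)[OF K(3), of t r] homD(3)[OF K(4), of t r] t J by auto
      then show "(f t \<ominus>\<^bsub>N\<^esub> g t) \<triangleleft>\<^bsub>N\<^esub> r = \<zero>\<^bsub>N\<^esub>"
        using c r N.ract_closed[of "g t" r]
        by (simp add: N.M.minus_eq N.ract_add_left N.ract_minus_left N.M.r_neg)
    qed (use c in simp)
    with c show "f t = g t" by (rule N.M.eq_of_diff_zero)
  qed
next
  have "K \<in> F" "L \<in> F"
    using assms by (simp_all only: pairs_iff)
  then have KL: "K \<inter> L \<in> F" by (rule filter_Int)
  assume "\<forall>t\<in>K \<inter> L. f t = g t"
  then show "((K, f), (L, g)) \<in> E"
    unfolding rel_eq by (intro conjI assms bexI[OF _ KL]) auto
qed

lemma equiv_rel: "equiv P E"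
proof (rule equivI)
  show "E \<subseteq> P \<times> P" using rel_eq by auto
  show "refl_on P E"
    using rel_iff by (auto intro: refl_onI)
  show "sym E"
  proof (rule symI, clarify)
    fix K f L g assume "((K, f), (L, g)) \<in> E"
    moreover from this have P: "(K, f) \<in> P" "(L, g) \<in> P" unfolding rel_eq by blast+
    ultimately have "\<forall>t\<in>K \<inter> L. f t = g t" using rel_iff by blast
    then show "((L, g), (K, f)) \<in> E"
      unfolding rel_iff[OF P(2,1)] by (metis Int_commute)
  qed
  show "trans E"
  proof (rule transI, clarify)
    fix K f L g K' f' assume "((K, f), (L, g)) \<in> E" "((L, g), (K', f')) \<in> E"
    \<comment> \<open>Here the existential form is the useful one: the middle domain
      \<open>L\<close> need not contain \<open>K \<inter> K'\<close>, so pointwise agreement with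
      \<open>g\<close> would not reach all of it.\<close>
    then obtain J J' where J: "J \<in> F" "J \<subseteq> K \<inter> L" "\<forall>t\<in>J. f t = g t" "J' \<in> F" "J' \<subseteq> L \<inter> K'"
      "\<forall>t\<in>J'. g t = f' t" and P: "(K, f) \<in> P" "(K', f') \<in> P"
      unfolding rel_eq by blast
    have "J \<inter> J' \<subseteq> K \<inter> K'" "\<forall>t\<in>J \<inter> J'. f t = f' t"
      using J by fastforce+
    with P filter_Int[OF J(1,4)] show "((K, f), (K', f')) \<in> E"
      unfolding rel_eq by blast
  qed
qed

lemma cls_eq_iff:
  assumes "(K, f) \<in> P" "(L, g) \<in> P"
  shows "cls K f = cls L g \<longleftrightarrow> (\<forall>t\<in>K \<inter> L. f t = g t)"
  using eq_equiv_class_iff[OF equiv_rel assms] rel_iff[OF assms] by simp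

lemma cls_eqI:
  assumes "(K, f) \<in> P" "(L, g) \<in> P" "\<And>t. t \<in> K \<Longrightarrow> t \<in> L \<Longrightarrow> f t = g t"
  shows "cls K f = cls L g"
  using assms by (simp add: cls_eq_iff)

lemma Q_carrier: "carrier Q = P // E"
  by (simp add: module_of_quotients_def Let_def)

lemma Q_closed: "(K, f) \<in> P \<Longrightarrow> cls K f \<in> carrier Q"
  by (simp add: Q_carrier quotientI)

lemma Q_cases:
  assumes "x \<in> carrier Q"
  obtains K f where "(K, f) \<in> P" "x = cls K f"
  using assms unfolding Q_carrier quotient_def by auto

lemma cls_UN:
  assumes "(K, f) \<in> P" and "\<And>L g. (L, g) \<in> P \<Longrightarrow> cls L g = cls K f \<Longrightarrow> h L g = c"
  shows "(\<Union>(L, g)\<in>cls K f. h L g) = c"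
proof -
  have "(K, f) \<in> cls K f"
    by (rule equiv_class_self[OF equiv_rel assms(1)])
  moreover have "(L, g) \<in> P \<and> cls L g = cls K f" if "(L, g) \<in> cls K f" for L g
    using that equiv_class_eq_iff[OF equiv_rel, of "(K, f)" "(L, g)"] by auto
  ultimately show ?thesis
    using assms(2) by (intro UN_constant_eq) (blast, clarify, blast)
qed

lemma Q_zero_pair: "(carrier S, \<lambda>t\<in>carrier S. \<zero>\<^bsub>N\<^esub>) \<in> P"
  by (rule restrict_pairI) (auto simp: carrier_in_filter N.ract_zero_left)

lemma Q_zero: "\<zero>\<^bsub>Q\<^esub> = cls (carrier S) (\<lambda>t\<in>carrier S. \<zero>\<^bsub>N\<^esub>)"
  by (simp add: module_of_quotients_def Let_def)

lemma Q_add_pair: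
  assumes "(K, f) \<in> P" "(L, g) \<in> P"
  shows "(K \<inter> L, \<lambda>t\<in>K \<inter> L. f t \<oplus>\<^bsub>N\<^esub> g t) \<in> P"
proof (rule restrict_pairI)
  show KL: "K \<inter> L \<in> F" using assms filter_Int by (auto simp: pairs_iff)
  have h: "f \<in> H K" "g \<in> H L" using assms by (auto simp: pairs_iff)
  fix t assume t: "t \<in> K \<inter> L"
  then have c: "f t \<in> carrier N" "g t \<in> carrier N" using homD h by auto
  then show "f t \<oplus>\<^bsub>N\<^esub> g t \<in> carrier N" by simp
  { fix r assume "r \<in> carrier S"
    then show "f (t \<otimes>\<^bsub>S\<^esub> r) \<oplus>\<^bsub>N\<^esub> g (t \<otimes>\<^bsub>S\<^esub> r) = (f t \<oplus>\<^bsub>N\<^esub> g t) \<triangleleft>\<^bsub>N\<^esub> r"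
      using t c homD(3)[OF h(1), of t r] homD(3)[OF h(2), of t r] by (simp add: N.ract_add_left) }
  { fix s assume s: "s \<in> K \<inter> L"
    then have "f s \<in> carrier N" "g s \<in> carrier N" using homD h by auto
    then show "f (t \<oplus>\<^bsub>S\<^esub> s) \<oplus>\<^bsub>N\<^esub> g (t \<oplus>\<^bsub>S\<^esub> s) = f t \<oplus>\<^bsub>N\<^esub> g t \<oplus>\<^bsub>N\<^esub> (f s \<oplus>\<^bsub>N\<^esub> g s)"
      using s t c homD(2)[OF h(1), of t s] homD(2)[OF h(2), of t s] by (simp add: N.M.a_ac) }
qed

lemma Q_add:
  assumes "(K, f) \<in> P" "(L, g) \<in> P"
  shows "cls K f \<oplus>\<^bsub>Q\<^esub> cls L g = cls (K \<inter> L) (\<lambda>t\<in>K \<inter> L. f t \<oplus>\<^bsub>N\<^esub> g t)"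
proof -
  have *: "cls (K' \<inter> L') (\<lambda>t\<in>K' \<inter> L'. f' t \<oplus>\<^bsub>N\<^esub> g' t) = cls (K \<inter> L) (\<lambda>t\<in>K \<inter> L. f t \<oplus>\<^bsub>N\<^esub> g t)"
    if "(K', f') \<in> P" "cls K' f' = cls K f" "(L', g') \<in> P" "cls L' g' = cls L g" for K' f' L' g'
    using that assms by (auto simp: cls_eq_iff Q_add_pair)
  have "(\<Union>(K', f')\<in>cls K f. \<Union>(L', g')\<in>cls L g. cls (K' \<inter> L') (\<lambda>t\<in>K' \<inter> L'. f' t \<oplus>\<^bsub>N\<^esub> g' t))
      = cls (K \<inter> L) (\<lambda>t\<in>K \<inter> L. f t \<oplus>\<^bsub>N\<^esub> g t)"
    by (rule cls_UN[OF assms(1)], rule cls_UN[OF assms(2)], rule *)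
  then show ?thesis
    by (simp add: module_of_quotients_def Let_def)
qed

lemma Q_ract_pair:
  assumes "(K, f) \<in> P" "r \<in> carrier S"
  shows "(colon K r, \<lambda>t\<in>colon K r. f (r \<otimes>\<^bsub>S\<^esub> t)) \<in> P"
proof (rule restrict_pairI)
  have h: "f \<in> H K" "K \<in> F" using assms by (auto simp: pairs_iff)
  then show "colon K r \<in> F" using assms(2) filter_colon by blast
  fix t assume t: "t \<in> colon K r"
  then show "f (r \<otimes>\<^bsub>S\<^esub> t) \<in> carrier N" using homD h by auto
  show "f (r \<otimes>\<^bsub>S\<^esub> (t \<otimes>\<^bsub>S\<^esub> s)) = f (r \<otimes>\<^bsub>S\<^esub> t) \<triangleleft>\<^bsub>N\<^esub> s" if "s \<in> carrier S" for s
    using that t assms homD(3)[OF h(1), of "r \<otimes>\<^bsub>S\<^esub> t" s] by (simp add: S.m_assoc)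
  show "f (r \<otimes>\<^bsub>S\<^esub> (t \<oplus>\<^bsub>S\<^esub> s)) = f (r \<otimes>\<^bsub>S\<^esub> t) \<oplus>\<^bsub>N\<^esub> f (r \<otimes>\<^bsub>S\<^esub> s)" if "s \<in> colon K r" for s
    using that t assms homD(2)[OF h(1), of "r \<otimes>\<^bsub>S\<^esub> t" "r \<otimes>\<^bsub>S\<^esub> s"] by (simp add: S.r_distr)
qed

lemma Q_ract:
  assumes "(K, f) \<in> P" "r \<in> carrier S"
  shows "cls K f \<triangleleft>\<^bsub>Q\<^esub> r = cls (colon K r) (\<lambda>t\<in>colon K r. f (r \<otimes>\<^bsub>S\<^esub> t))"
proof -
  have *: "cls (colon L r) (\<lambda>t\<in>colon L r. g (r \<otimes>\<^bsub>S\<^esub> t)) = cls (colon K r) (\<lambda>t\<in>colon K r. f (r \<otimes>\<^bsub>S\<^esub> t))"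
    if "(L, g) \<in> P" "cls L g = cls K f" for L g
    using that assms by (auto simp: cls_eq_iff Q_ract_pair)
  have "(\<Union>(L, g)\<in>cls K f. cls (colon L r) (\<lambda>t\<in>colon L r. g (r \<otimes>\<^bsub>S\<^esub> t)))
      = cls (colon K r) (\<lambda>t\<in>colon K r. f (r \<otimes>\<^bsub>S\<^esub> t))"
    by (rule cls_UN[OF assms(1)], rule *)
  then show ?thesis
    by (simp add: module_of_quotients_def Let_def)
qed

text \<open>By \<open>cls_eqI\<close> every axiom reduces to the same axiom in \<open>N\<close>,
  pointwise on the common domain of the representatives.\<close>

lemma Q_abelian_group: "abelian_group Q"
proof (rule abelian_groupI)
  show "\<zero>\<^bsub>Q\<^esub> \<in> carrier Q" unfolding Q_zero by (rule Q_closed[OF Q_zero_pair])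
  fix x assume "x \<in> carrier Q"
  then obtain K f where x: "(K, f) \<in> P" "x = cls K f" by (rule Q_cases)
  then have f: "f t \<in> carrier N" if "t \<in> K" for t using homD(1) that by (auto simp: pairs_iff)
  have K: "K \<in> F" "f \<in> H K" using x by (auto simp: pairs_iff)
  show "\<zero>\<^bsub>Q\<^esub> \<oplus>\<^bsub>Q\<^esub> x = x"
    unfolding x(2) Q_zero Q_add[OF Q_zero_pair x(1)]
    by (intro cls_eqI Q_add_pair Q_zero_pair x(1)) (use f filterD(1)[OF K(1)] in auto)
  have m: "(K, \<lambda>t\<in>K. \<ominus>\<^bsub>N\<^esub> f t) \<in> P"
  proof (rule restrict_pairI[OF K(1)])
    fix s t assume "s \<in> K" "t \<in> K"
    then show "\<ominus>\<^bsub>N\<^esub> f (s \<oplus>\<^bsub>S\<^esub> t) = \<ominus>\<^bsub>N\<^esub> f s \<oplus>\<^bsub>N\<^esub> \<ominus>\<^bsub>N\<^esub> f t"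
      using homD[OF K(2)] by (simp add: N.M.minus_add)
  next
    fix t r assume "t \<in> K" "r \<in> carrier S"
    then show "\<ominus>\<^bsub>N\<^esub> f (t \<otimes>\<^bsub>S\<^esub> r) = (\<ominus>\<^bsub>N\<^esub> f t) \<triangleleft>\<^bsub>N\<^esub> r"
      using homD[OF K(2)] by (simp add: N.ract_minus_left)
  qed (use f in auto)
  show "\<exists>y\<in>carrier Q. y \<oplus>\<^bsub>Q\<^esub> x = \<zero>\<^bsub>Q\<^esub>"
  proof (rule bexI[OF _ Q_closed[OF m]])
    show "cls K (\<lambda>t\<in>K. \<ominus>\<^bsub>N\<^esub> f t) \<oplus>\<^bsub>Q\<^esub> x = \<zero>\<^bsub>Q\<^esub>"
      unfolding x(2) Q_zero Q_add[OF m x(1)]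
      by (intro cls_eqI Q_add_pair Q_zero_pair m x(1)) (use f N.M.l_neg in auto)
  qed
  fix y assume "y \<in> carrier Q"
  then obtain L g where y: "(L, g) \<in> P" "y = cls L g" by (rule Q_cases)
  then have g: "g t \<in> carrier N" if "t \<in> L" for t using homD(1) that by (auto simp: pairs_iff)
  show "x \<oplus>\<^bsub>Q\<^esub> y \<in> carrier Q"
    unfolding x(2) y(2) Q_add[OF x(1) y(1)] by (intro Q_closed Q_add_pair x(1) y(1))
  show "x \<oplus>\<^bsub>Q\<^esub> y = y \<oplus>\<^bsub>Q\<^esub> x"
    unfolding x(2) y(2) Q_add[OF x(1) y(1)] Q_add[OF y(1) x(1)]
    by (intro cls_eqI Q_add_pair x(1) y(1)) (use f g N.M.a_comm in auto)
  fix z assume "z \<in> carrier Q"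
  then obtain L' g' where z: "(L', g') \<in> P" "z = cls L' g'" by (rule Q_cases)
  then have g': "g' t \<in> carrier N" if "t \<in> L'" for t using homD(1) that by (auto simp: pairs_iff)
  show "x \<oplus>\<^bsub>Q\<^esub> y \<oplus>\<^bsub>Q\<^esub> z = x \<oplus>\<^bsub>Q\<^esub> (y \<oplus>\<^bsub>Q\<^esub> z)"
    unfolding x(2) y(2) z(2) Q_add[OF x(1) y(1)] Q_add[OF y(1) z(1)]
      Q_add[OF Q_add_pair[OF x(1) y(1)] z(1)] Q_add[OF x(1) Q_add_pair[OF y(1) z(1)]]
    by (intro cls_eqI Q_add_pair x(1) y(1) z(1)) (use f g g' N.M.a_assoc in auto)
qed

text \<open>The two sides of an axiom live on different ideals, such as
  \<open>colon K (r \<oplus> s)\<close> and \<open>colon K r \<inter> colon K s\<close>. Agreement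
  on their intersection suffices by \<open>cls_eqI\<close>.\<close>

lemma Q_right_module: "right_module S Q"
proof (intro right_module.intro right_module_axioms.intro S.ring_axioms Q_abelian_group)
  fix x r assume "x \<in> carrier Q" and r: "r \<in> carrier S"
  then obtain K f where x: "(K, f) \<in> P" "x = cls K f" by (meson Q_cases)
  have K: "K \<in> F" "f \<in> H K" using x by (auto simp: pairs_iff)
  show "x \<triangleleft>\<^bsub>Q\<^esub> r \<in> carrier Q"
    unfolding x(2) Q_ract[OF x(1) r] by (intro Q_closed Q_ract_pair x(1) r)
  { fix s assume s: "s \<in> carrier S"
    show "x \<triangleleft>\<^bsub>Q\<^esub> (r \<oplus>\<^bsub>S\<^esub> s) = x \<triangleleft>\<^bsub>Q\<^esub> r \<oplus>\<^bsub>Q\<^esub> x \<triangleleft>\<^bsub>Q\<^esub> s"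
      unfolding x(2) Q_ract[OF x(1) r] Q_ract[OF x(1) s] Q_ract[OF x(1) S.a_closed[OF r s]]
        Q_add[OF Q_ract_pair[OF x(1) r] Q_ract_pair[OF x(1) s]]
      by (intro cls_eqI Q_add_pair Q_ract_pair x(1) r s S.a_closed)
        (use r s homD(2)[OF K(2)] in \<open>auto simp: S.l_distr\<close>)
    show "x \<triangleleft>\<^bsub>Q\<^esub> (r \<otimes>\<^bsub>S\<^esub> s) = x \<triangleleft>\<^bsub>Q\<^esub> r \<triangleleft>\<^bsub>Q\<^esub> s"
      unfolding x(2) Q_ract[OF x(1) r] Q_ract[OF x(1) S.m_closed[OF r s]]
        Q_ract[OF Q_ract_pair[OF x(1) r] s]
      by (intro cls_eqI Q_ract_pair x(1) r s S.m_closed) (use r s in \<open>auto simp: S.m_assoc\<close>) }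
  { fix y assume "y \<in> carrier Q"
    then obtain L g where y: "(L, g) \<in> P" "y = cls L g" by (rule Q_cases)
    show "(x \<oplus>\<^bsub>Q\<^esub> y) \<triangleleft>\<^bsub>Q\<^esub> r = x \<triangleleft>\<^bsub>Q\<^esub> r \<oplus>\<^bsub>Q\<^esub> y \<triangleleft>\<^bsub>Q\<^esub> r"
      unfolding x(2) y(2) Q_add[OF x(1) y(1)] Q_ract[OF Q_add_pair[OF x(1) y(1)] r]
        Q_ract[OF x(1) r] Q_ract[OF y(1) r] Q_add[OF Q_ract_pair[OF x(1) r] Q_ract_pair[OF y(1) r]]
      by (intro cls_eqI Q_add_pair Q_ract_pair x(1) y(1) r) auto }
next
  fix x assume "x \<in> carrier Q"
  then obtain K f where x: "(K, f) \<in> P" "x = cls K f" by (rule Q_cases)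
  have K: "K \<in> F" using x by (auto simp: pairs_iff)
  show "x \<triangleleft>\<^bsub>Q\<^esub> \<one>\<^bsub>S\<^esub> = x"
    unfolding x(2) Q_ract[OF x(1) S.one_closed]
    by (intro cls_eqI Q_ract_pair x(1) S.one_closed) (use filterD(1)[OF K] in auto)
qed

sublocale Q: right_module S Q by (rule Q_right_module)

section \<open>The canonical map, its dense image, and torsion-freeness of the quotients\<close>

abbreviation "q \<equiv> quotient_map S F M"

lemma q_pair: "m \<in> carrier M \<Longrightarrow> (carrier S, \<lambda>t\<in>carrier S. \<pi> m \<triangleleft>\<^bsub>N\<^esub> t) \<in> P"
  by (rule restrict_pairI)
    (auto simp: carrier_in_filter M.ract_closed M.ract_add_right M.ract_mult)

lemma q_eq: "q m = cls (carrier S) (\<lambda>t\<in>carrier S. \<pi> m \<triangleleft>\<^bsub>N\<^esub> t)"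
  by (simp add: quotient_map_def Let_def)

text \<open>Acting by \<open>t \<in> K\<close> turns \<open>f\<close> into
  \<open>s \<mapsto> f (t s) = f(t) s\<close>, which is the action on the element \<open>f t\<close>
  of \<open>N\<close>, hence comes from \<open>M\<close>. So the domain \<open>K\<close> of a
  representative itself moves the class into the image of \<open>q\<close>.\<close>

lemma ract_in_range:
  assumes K: "(K, f) \<in> P" and t: "t \<in> K" and m: "m \<in> carrier M" "f t = \<pi> m"
  shows "cls K f \<triangleleft>\<^bsub>Q\<^esub> t = q m"
proof -
  have h: "f \<in> H K" "K \<in> F" using K by (auto simp: pairs_iff)
  have tc: "t \<in> carrier S" using filterD(1) h t by blast
  show ?thesis
    unfolding q_eq Q_ract[OF K tc]
    by (intro cls_eqI Q_ract_pair q_pair K tc m(1)) (use m homD(3)[OF h(1) t] in auto)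
qed

lemma Q_range_dense:
  assumes "x \<in> carrier Q"
  shows "\<exists>K\<in>F. \<forall>t\<in>K. \<exists>m\<in>carrier M. x \<triangleleft>\<^bsub>Q\<^esub> t = q m"
proof -
  obtain K f where x: "(K, f) \<in> P" "x = cls K f" using assms by (rule Q_cases)
  then have "K \<in> F" "f \<in> H K" by (auto simp: pairs_iff)
  then show ?thesis
    using x ract_in_range[OF x(1)] proj_surj homD(1) by (metis (no_types, lifting))
qed

text \<open>If \<open>x t = 0\<close> then \<open>f (t s) = 0\<close> for all \<open>s\<close> in
  the colon of \<open>K\<close> at \<open>t\<close>. For \<open>t \<in> K\<close> this colon
  contains 1, and \<open>s = 1\<close> gives \<open>f t = 0\<close>. So \<open>f\<close> vanishes on
  \<open>K \<inter> L\<close>, which is in the filter.\<close>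

lemma Q_torsion_free:
  assumes "x \<in> carrier Q" "L \<in> F" "\<And>t. t \<in> L \<Longrightarrow> x \<triangleleft>\<^bsub>Q\<^esub> t = \<zero>\<^bsub>Q\<^esub>"
  shows "x = \<zero>\<^bsub>Q\<^esub>"
proof -
  obtain K f where x: "(K, f) \<in> P" "x = cls K f" using assms(1) by (rule Q_cases)
  have h: "K \<in> F" "f \<in> H K" using x by (auto simp: pairs_iff)
  have "f t = \<zero>\<^bsub>N\<^esub>" if t: "t \<in> K \<inter> L" for t
  proof -
    have tc: "t \<in> carrier S" using filterD(1) h t by blast
    have "cls (colon K t) (\<lambda>s\<in>colon K t. f (t \<otimes>\<^bsub>S\<^esub> s)) = cls (carrier S) (\<lambda>t\<in>carrier S. \<zero>\<^bsub>N\<^esub>)"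
      using assms(3)[of t] t x tc by (simp add: Q_ract Q_zero)
    then have "\<forall>s\<in>colon K t \<inter> carrier S. (\<lambda>s\<in>colon K t. f (t \<otimes>\<^bsub>S\<^esub> s)) s = (\<lambda>t\<in>carrier S. \<zero>\<^bsub>N\<^esub>) s"
      unfolding cls_eq_iff[OF Q_ract_pair[OF x(1) tc] Q_zero_pair] .
    moreover have "\<one>\<^bsub>S\<^esub> \<in> colon K t \<inter> carrier S"
      using t tc by simp
    ultimately have "(\<lambda>s\<in>colon K t. f (t \<otimes>\<^bsub>S\<^esub> s)) \<one>\<^bsub>S\<^esub> = (\<lambda>t\<in>carrier S. \<zero>\<^bsub>N\<^esub>) \<one>\<^bsub>S\<^esub>"
      by (rule bspec)
    then show "f t = \<zero>\<^bsub>N\<^esub>"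
      using t tc by simp
  qed
  then have "\<forall>t\<in>K \<inter> L. f t = (\<lambda>t\<in>carrier S. \<zero>\<^bsub>N\<^esub>) t"
    using filterD(1)[OF h(1)] by auto
  moreover have "K \<inter> L \<subseteq> K \<inter> carrier S"
    using filterD(1)[OF h(1)] by blast
  ultimately have "((K, f), (carrier S, \<lambda>t\<in>carrier S. \<zero>\<^bsub>N\<^esub>)) \<in> E"
    unfolding rel_eq using x(1) Q_zero_pair filter_Int[OF h(1) assms(2)] by blast
  then show ?thesis
    unfolding x(2) Q_zero by (rule equiv_class_eq[OF equiv_rel])
qed

end

section \<open>Extending derivations\<close>

context abelian_group
begin

lemma diff_add_diff:
  "\<lbrakk>a \<in> carrier G; b \<in> carrier G; c \<in> carrier G; e \<in> carrier G\<rbrakk>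
    \<Longrightarrow> (a \<oplus> b) \<ominus> (c \<oplus> e) = (a \<ominus> c) \<oplus> (b \<ominus> e)"
  by (simp add: minus_eq minus_add a_ac)

lemma add_diff_add_cancel:
  assumes "a \<in> carrier G" "b \<in> carrier G" "c \<in> carrier G"
  shows "(a \<oplus> b) \<ominus> (c \<oplus> b) = a \<ominus> c"
  using diff_add_diff[of a b c b] assms by (simp add: minus_eq r_neg)

lemma diff_add_cancel_left:
  assumes "a \<in> carrier G" "b \<in> carrier G" "c \<in> carrier G"
  shows "(a \<ominus> (b \<oplus> c)) \<oplus> b = a \<ominus> c"
proof -
  have "(a \<ominus> (b \<oplus> c)) \<oplus> b = a \<oplus> (\<ominus> c \<oplus> (\<ominus> b \<oplus> b))"
    using assms by (simp only: minus_eq minus_add a_ac a_inv_closed a_closed)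
  then show ?thesis
    using assms by (simp add: minus_eq l_neg)
qed

end

context gabriel_module
begin

section \<open>The extension of a fixed derivation\<close>

context
  fixes D d
  assumes D: "ring_derivation S D" and d: "module_derivation S D M d"
begin

lemma derivation_diff:
  assumes "x \<in> carrier M" "y \<in> carrier M"
  shows "d (x \<ominus>\<^bsub>M\<^esub> y) = d x \<ominus>\<^bsub>M\<^esub> d y"
proof -
  have "d (\<ominus>\<^bsub>M\<^esub> y) = \<ominus>\<^bsub>M\<^esub> d y"
    using d assms(2) unfolding module_derivation_def by (intro M.M.additive_minus) auto
  then show ?thesis
    using module_derivationD(2)[OF d assms(1) M.M.a_inv_closed[OF assms(2)]] by (simp add: M.M.minus_eq)
qed

text \<open>Let \<open>K\<close> kill \<open>x\<close>. In
  \<open>0 = d(x a) = d(x) a + x D(a)\<close> the last term vanishes as soon as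
  \<open>D a \<in> K\<close>, so \<open>d x\<close> is killed by
  \<open>{a \<in> K. D a \<in> K}\<close>.\<close>

lemma derivation_torsion:
  assumes "x \<in> T"
  shows "d x \<in> T"
proof -
  obtain K where x: "x \<in> carrier M" and K: "K \<in> F" "\<And>r. r \<in> K \<Longrightarrow> x \<triangleleft>\<^bsub>M\<^esub> r = \<zero>\<^bsub>M\<^esub>"
    using assms unfolding torsion_iff by blast
  have d0: "d \<zero>\<^bsub>M\<^esub> = \<zero>\<^bsub>M\<^esub>"
    using d unfolding module_derivation_def by (intro M.M.additive_zero) auto
  have "d x \<triangleleft>\<^bsub>M\<^esub> a = \<zero>\<^bsub>M\<^esub>" if a: "a \<in> {a \<in> K. D a \<in> K}" for a
  proof -
    have ac: "a \<in> carrier S" using filterD(1) K a by blast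
    have "d x \<triangleleft>\<^bsub>M\<^esub> a \<oplus>\<^bsub>M\<^esub> x \<triangleleft>\<^bsub>M\<^esub> D a = d (x \<triangleleft>\<^bsub>M\<^esub> a)"
      using module_derivationD(3)[OF d x ac] by simp
    moreover have "d (x \<triangleleft>\<^bsub>M\<^esub> a) = \<zero>\<^bsub>M\<^esub>" "x \<triangleleft>\<^bsub>M\<^esub> D a = \<zero>\<^bsub>M\<^esub>"
      using K(2) a d0 by simp_all
    ultimately show ?thesis
      using module_derivationD(1)[OF d x] ac by (simp add: M.ract_closed)
  qed
  then show ?thesis
    unfolding torsion_iff using derivation_restrict_in_filter[OF D K(1)] module_derivationD(1)[OF d x] by blast
qed

text \<open>The derivation induced on \<open>M/T(M)\<close>. The union is over representatives and
  has one value because \<open>d\<close> preserves torsion.\<close>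

definition dbar where "dbar U = (\<Union>x\<in>U. \<pi> (d x))"

lemma dbar_proj:
  assumes x: "x \<in> carrier M"
  shows "dbar (\<pi> x) = \<pi> (d x)"
  unfolding dbar_def
proof (rule proj_image[OF x])
  fix y assume y: "y \<in> carrier M" "\<pi> y = \<pi> x"
  then have "d (y \<ominus>\<^bsub>M\<^esub> x) \<in> T"
    using x derivation_torsion by (simp add: proj_eq_iff)
  then show "\<pi> (d y) = \<pi> (d x)"
    using x y module_derivationD(1)[OF d] by (simp add: proj_eq_iff derivation_diff)
qed

lemma dbar_derivation: "module_derivation S D N dbar"
  unfolding module_derivation_def
proof (intro conjI ballI funcsetI)
  note dD = module_derivationD[OF d]
  fix u assume "u \<in> carrier N"
  then obtain x where x: "x \<in> carrier M" "u = \<pi> x" using proj_surj by blast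
  then show "dbar u \<in> carrier N"
    using dD(1) by (simp add: dbar_proj)
  show "dbar (u \<triangleleft>\<^bsub>N\<^esub> r) = dbar u \<triangleleft>\<^bsub>N\<^esub> r \<oplus>\<^bsub>N\<^esub> u \<triangleleft>\<^bsub>N\<^esub> D r" if "r \<in> carrier S" for r
    using x that dD ring_derivationD(1)[OF D] by (simp add: dbar_proj M.ract_closed)
  fix v assume "v \<in> carrier N"
  then obtain y where y: "y \<in> carrier M" "v = \<pi> y" using proj_surj by blast
  show "dbar (u \<oplus>\<^bsub>N\<^esub> v) = dbar u \<oplus>\<^bsub>N\<^esub> dbar v"
    using x y dD by (simp add: dbar_proj)
qed

text \<open>The formula for the extension evaluates \<open>f\<close> at both \<open>t\<close> and
  \<open>D t\<close>, so its domain is cut down to where both lie in \<open>K\<close>.\<close>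

abbreviation "leibniz_part K \<equiv> {a \<in> K. D a \<in> K}"

text \<open>The value at \<open>t\<close> is forced: an extension \<open>d'\<close> satisfies \<open>d'(x) t = d'(x t) - x D(t)\<close>, where \<open>x t\<close> and
  \<open>x D(t)\<close> lie in the image of \<open>M\<close>.\<close>

definition ext where
  "ext U = (\<Union>(K, f)\<in>U. cls (leibniz_part K) (\<lambda>t\<in>leibniz_part K. dbar (f t) \<ominus>\<^bsub>N\<^esub> f (D t)))"

text \<open>Neither \<open>dbar (f t)\<close> nor \<open>f (D t)\<close> is linear in
  \<open>t\<close>. Replacing \<open>t\<close> by \<open>t r\<close> adds \<open>f(t) D(r)\<close>
  to the factor \<open>r\<close> in each of them, and the difference cancels this defect.\<close>

lemma ext_pair:
  assumes "(K, f) \<in> P"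
  shows "(leibniz_part K, \<lambda>t\<in>leibniz_part K. dbar (f t) \<ominus>\<^bsub>N\<^esub> f (D t)) \<in> P"
proof (rule restrict_pairI)
  note dD = module_derivationD[OF dbar_derivation] and DD = ring_derivationD[OF D]
  have h: "K \<in> F" "f \<in> H K" using assms by (simp_all add: pairs_iff)
  then show "leibniz_part K \<in> F" using derivation_restrict_in_filter[OF D] by blast
  fix t assume t: "t \<in> leibniz_part K"
  then have tc: "t \<in> carrier S" "D t \<in> carrier S" using filterD(1)[OF h(1)] by blast+
  have c: "f t \<in> carrier N" "f (D t) \<in> carrier N" "dbar (f t) \<in> carrier N"
    using t homD(1)[OF h(2)] dD(1) by blast+
  then show "dbar (f t) \<ominus>\<^bsub>N\<^esub> f (D t) \<in> carrier N" by (intro N.M.minus_closed)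
  { fix s assume s: "s \<in> leibniz_part K"
    then have sc: "s \<in> carrier S" using filterD(1)[OF h(1)] by blast
    have c': "f s \<in> carrier N" "f (D s) \<in> carrier N" "dbar (f s) \<in> carrier N"
      using s homD(1)[OF h(2)] dD(1) by blast+
    have "f (t \<oplus>\<^bsub>S\<^esub> s) = f t \<oplus>\<^bsub>N\<^esub> f s" "f (D (t \<oplus>\<^bsub>S\<^esub> s)) = f (D t) \<oplus>\<^bsub>N\<^esub> f (D s)"
      using s t tc sc homD(2)[OF h(2)] DD(2) by simp_all
    then show "dbar (f (t \<oplus>\<^bsub>S\<^esub> s)) \<ominus>\<^bsub>N\<^esub> f (D (t \<oplus>\<^bsub>S\<^esub> s)) =
        dbar (f t) \<ominus>\<^bsub>N\<^esub> f (D t) \<oplus>\<^bsub>N\<^esub> (dbar (f s) \<ominus>\<^bsub>N\<^esub> f (D s))"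
      using c c' dD(2) by (simp add: N.M.diff_add_diff) }
  { fix r assume r: "r \<in> carrier S"
    have m: "t \<in> K" "D t \<in> K" "D t \<otimes>\<^bsub>S\<^esub> r \<in> K" "t \<otimes>\<^bsub>S\<^esub> D r \<in> K"
      using t r filterD(5)[OF h(1)] DD(1) by auto
    have "f (D (t \<otimes>\<^bsub>S\<^esub> r)) = f (D t) \<triangleleft>\<^bsub>N\<^esub> r \<oplus>\<^bsub>N\<^esub> f t \<triangleleft>\<^bsub>N\<^esub> D r"
      using homD(2)[OF h(2) m(3,4)] homD(3)[OF h(2) m(2) r] homD(3)[OF h(2) m(1) DD(1)[OF r]] DD(3)[OF tc(1) r]
      by simp
    moreover have "f (t \<otimes>\<^bsub>S\<^esub> r) = f t \<triangleleft>\<^bsub>N\<^esub> r"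
      by (rule homD(3)[OF h(2) m(1) r])
    moreover have "(dbar (f t) \<ominus>\<^bsub>N\<^esub> f (D t)) \<triangleleft>\<^bsub>N\<^esub> r = dbar (f t) \<triangleleft>\<^bsub>N\<^esub> r \<ominus>\<^bsub>N\<^esub> f (D t) \<triangleleft>\<^bsub>N\<^esub> r"
      using c r by (simp add: N.M.minus_eq N.ract_add_left N.ract_minus_left)
    ultimately show "dbar (f (t \<otimes>\<^bsub>S\<^esub> r)) \<ominus>\<^bsub>N\<^esub> f (D (t \<otimes>\<^bsub>S\<^esub> r)) = (dbar (f t) \<ominus>\<^bsub>N\<^esub> f (D t)) \<triangleleft>\<^bsub>N\<^esub> r"
      using c r dD(3)[OF c(1) r] DD(1)[OF r] by (simp add: N.ract_closed N.M.add_diff_add_cancel) }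
qed

text \<open>If \<open>t\<close> is in both reduced domains, then \<open>t\<close> and
  \<open>D t\<close> lie in \<open>L \<inter> K\<close>, where the two representatives
  coincide.\<close>

lemma ext_cls:
  assumes "(K, f) \<in> P"
  shows "ext (cls K f) = cls (leibniz_part K) (\<lambda>t\<in>leibniz_part K. dbar (f t) \<ominus>\<^bsub>N\<^esub> f (D t))"
  unfolding ext_def
proof (rule cls_UN[OF assms])
  fix L g assume L: "(L, g) \<in> P" "cls L g = cls K f"
  from L(2) have e: "\<forall>t\<in>L \<inter> K. g t = f t"
    unfolding cls_eq_iff[OF L(1) assms] .
  show "cls (leibniz_part L) (\<lambda>t\<in>leibniz_part L. dbar (g t) \<ominus>\<^bsub>N\<^esub> g (D t)) = cls (leibniz_part K) (\<lambda>t\<in>leibniz_part K. dbar (f t) \<ominus>\<^bsub>N\<^esub> f (D t))"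
    by (intro cls_eqI ext_pair L(1) assms) (use e in simp)
qed

lemma ext_derivation: "module_derivation S D Q ext"
  unfolding module_derivation_def
proof (intro conjI ballI funcsetI)
  note dD = module_derivationD[OF dbar_derivation] and DD = ring_derivationD[OF D]
  fix x assume "x \<in> carrier Q"
  then obtain K f where x: "(K, f) \<in> P" "x = cls K f" by (rule Q_cases)
  have h: "K \<in> F" "f \<in> H K" using x by (simp_all add: pairs_iff)
  show "ext x \<in> carrier Q"
    unfolding x(2) ext_cls[OF x(1)] by (intro Q_closed ext_pair x(1))
  { fix y assume "y \<in> carrier Q"
    then obtain L g where y: "(L, g) \<in> P" "y = cls L g" by (rule Q_cases)
    have h': "L \<in> F" "g \<in> H L" using y by (simp_all add: pairs_iff)
    have "dbar (f t \<oplus>\<^bsub>N\<^esub> g t) \<ominus>\<^bsub>N\<^esub> (f (D t) \<oplus>\<^bsub>N\<^esub> g (D t)) =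
        dbar (f t) \<ominus>\<^bsub>N\<^esub> f (D t) \<oplus>\<^bsub>N\<^esub> (dbar (g t) \<ominus>\<^bsub>N\<^esub> g (D t))"
      if "t \<in> leibniz_part K" "t \<in> leibniz_part L" for t
    proof -
      have "f t \<in> carrier N" "f (D t) \<in> carrier N" "g t \<in> carrier N" "g (D t) \<in> carrier N"
        using that homD(1)[OF h(2)] homD(1)[OF h'(2)] by blast+
      then show ?thesis
        using dD(1,2) by (simp add: N.M.diff_add_diff)
    qed
    then show "ext (x \<oplus>\<^bsub>Q\<^esub> y) = ext x \<oplus>\<^bsub>Q\<^esub> ext y"
      unfolding x(2) y(2) Q_add[OF x(1) y(1)] ext_cls[OF x(1)] ext_cls[OF y(1)]
        ext_cls[OF Q_add_pair[OF x(1) y(1)]] Q_add[OF ext_pair[OF x(1)] ext_pair[OF y(1)]]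
      by (intro cls_eqI ext_pair Q_add_pair x(1) y(1)) simp }
  { fix r assume r: "r \<in> carrier S"
    have Dr: "D r \<in> carrier S" by (rule DD(1)[OF r])
    \<comment> \<open>The left side is the value at \<open>t\<close> of the extension of
      \<open>x r\<close>, and the last term on the right is the value of \<open>x D(r)\<close>. The
      middle ones form the extension of \<open>x\<close> acted on by \<open>r\<close>. The identity
      is the image under \<open>f\<close> of \<open>D(r t) = D(r) t + r D(t)\<close>.\<close>
    have "dbar (f (r \<otimes>\<^bsub>S\<^esub> t)) \<ominus>\<^bsub>N\<^esub> f (r \<otimes>\<^bsub>S\<^esub> D t) =
        dbar (f (r \<otimes>\<^bsub>S\<^esub> t)) \<ominus>\<^bsub>N\<^esub> f (D (r \<otimes>\<^bsub>S\<^esub> t)) \<oplus>\<^bsub>N\<^esub> f (D r \<otimes>\<^bsub>S\<^esub> t)"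
      if t: "t \<in> carrier S" "r \<otimes>\<^bsub>S\<^esub> t \<in> K" "r \<otimes>\<^bsub>S\<^esub> D t \<in> K" "D r \<otimes>\<^bsub>S\<^esub> t \<in> K" for t
    proof -
      have "f (D (r \<otimes>\<^bsub>S\<^esub> t)) = f (D r \<otimes>\<^bsub>S\<^esub> t) \<oplus>\<^bsub>N\<^esub> f (r \<otimes>\<^bsub>S\<^esub> D t)"
        using homD(2)[OF h(2) t(4) t(3)] DD(3)[OF r t(1)] by simp
      moreover have "f (r \<otimes>\<^bsub>S\<^esub> t) \<in> carrier N" "f (D r \<otimes>\<^bsub>S\<^esub> t) \<in> carrier N" "f (r \<otimes>\<^bsub>S\<^esub> D t) \<in> carrier N"
        using t homD(1)[OF h(2)] by blast+
      ultimately show ?thesis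
        using dD(1) by (simp add: N.M.diff_add_cancel_left)
    qed
    then show "ext (x \<triangleleft>\<^bsub>Q\<^esub> r) = ext x \<triangleleft>\<^bsub>Q\<^esub> r \<oplus>\<^bsub>Q\<^esub> x \<triangleleft>\<^bsub>Q\<^esub> D r"
      unfolding x(2) Q_ract[OF x(1) r] Q_ract[OF x(1) Dr] ext_cls[OF x(1)]
        ext_cls[OF Q_ract_pair[OF x(1) r]] Q_ract[OF ext_pair[OF x(1)] r]
        Q_add[OF Q_ract_pair[OF ext_pair[OF x(1)] r] Q_ract_pair[OF x(1) Dr]]
      by (intro cls_eqI ext_pair Q_ract_pair Q_add_pair x(1) r Dr) simp }
qed

text \<open>The class \<open>q m\<close> is represented by the action on the coset of
  \<open>m\<close>. The Leibniz rule for \<open>dbar\<close> produces the term with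
  \<open>D t\<close> that the formula of \<open>ext\<close> subtracts, and only the action on the
  coset of \<open>d m\<close> is left.\<close>

lemma ext_q:
  assumes m: "m \<in> carrier M"
  shows "ext (q m) = q (d m)"
proof -
  note dD = module_derivationD[OF d] and DD = ring_derivationD[OF D]
  have "dbar (\<pi> m \<triangleleft>\<^bsub>N\<^esub> t) \<ominus>\<^bsub>N\<^esub> \<pi> m \<triangleleft>\<^bsub>N\<^esub> D t = \<pi> (d m) \<triangleleft>\<^bsub>N\<^esub> t" if t: "t \<in> carrier S" for t
  proof -
    note dbD = module_derivationD[OF dbar_derivation proj_closed[OF m]]
    have "dbar (\<pi> m \<triangleleft>\<^bsub>N\<^esub> t) \<ominus>\<^bsub>N\<^esub> \<pi> m \<triangleleft>\<^bsub>N\<^esub> D t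
        = (dbar (\<pi> m) \<triangleleft>\<^bsub>N\<^esub> t \<oplus>\<^bsub>N\<^esub> \<pi> m \<triangleleft>\<^bsub>N\<^esub> D t) \<ominus>\<^bsub>N\<^esub> \<pi> m \<triangleleft>\<^bsub>N\<^esub> D t"
      by (simp only: dbD(3)[OF t])
    also have "\<dots> = dbar (\<pi> m) \<triangleleft>\<^bsub>N\<^esub> t"
      using t DD(1) dbD(1) N.ract_closed[OF dbD(1) t] N.ract_closed[OF proj_closed[OF m] DD(1)[OF t]]
      by (simp only: N.M.minus_eq N.M.a_assoc N.M.a_inv_closed N.M.r_neg N.M.r_zero)
    finally show ?thesis by (simp only: dbar_proj[OF m])
  qed
  then show ?thesis
    unfolding q_eq ext_cls[OF q_pair[OF m]]
    by (intro cls_eqI ext_pair q_pair m dD(1)) simp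
qed

end

lemma extension_unique:
  assumes D: "ring_derivation S D" and e1: "module_derivation S D Q e1" and e2: "module_derivation S D Q e2"
    and eq: "\<And>m. m \<in> carrier M \<Longrightarrow> e1 (q m) = e2 (q m)" and x: "x \<in> carrier Q"
  shows "e1 x = e2 x"
proof -
  obtain K where K: "K \<in> F" and r: "\<And>t. t \<in> K \<Longrightarrow> \<exists>m\<in>carrier M. x \<triangleleft>\<^bsub>Q\<^esub> t = q m"
    using Q_range_dense[OF x] by blast
  note c = module_derivationD(1)[OF e1 x] module_derivationD(1)[OF e2 x]
  have "e1 x \<ominus>\<^bsub>Q\<^esub> e2 x = \<zero>\<^bsub>Q\<^esub>"
  proof (rule Q_torsion_free[OF Q.M.minus_closed[OF c] K])
    fix t assume t: "t \<in> K"
    then have tc: "t \<in> carrier S" using filterD(1)[OF K] by blast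
    obtain m where "m \<in> carrier M" "x \<triangleleft>\<^bsub>Q\<^esub> t = q m" using r[OF t] by blast
    then have "e1 (x \<triangleleft>\<^bsub>Q\<^esub> t) = e2 (x \<triangleleft>\<^bsub>Q\<^esub> t)" using eq by simp
    then have "e1 x \<triangleleft>\<^bsub>Q\<^esub> t \<oplus>\<^bsub>Q\<^esub> x \<triangleleft>\<^bsub>Q\<^esub> D t = e2 x \<triangleleft>\<^bsub>Q\<^esub> t \<oplus>\<^bsub>Q\<^esub> x \<triangleleft>\<^bsub>Q\<^esub> D t"
      by (simp only: module_derivationD(3)[OF e1 x tc] module_derivationD(3)[OF e2 x tc])
    \<comment> \<open>The term \<open>x D(t)\<close> is common to both expansions and cancels
      wherever \<open>D t\<close> lies, so this argument works on all of \<open>K\<close> rather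
      than on its reduced part.\<close>
    then have "e1 x \<triangleleft>\<^bsub>Q\<^esub> t = e2 x \<triangleleft>\<^bsub>Q\<^esub> t"
      using c x tc ring_derivationD(1)[OF D tc] by (simp add: Q.ract_closed)
    then show "(e1 x \<ominus>\<^bsub>Q\<^esub> e2 x) \<triangleleft>\<^bsub>Q\<^esub> t = \<zero>\<^bsub>Q\<^esub>"
      using c tc by (simp add: Q.M.minus_eq Q.ract_add_left Q.ract_minus_left Q.M.r_neg Q.ract_closed)
  qed
  then show ?thesis by (rule Q.M.eq_of_diff_zero[OF c])
qed

end

section \<open>The symmetric filter\<close>

lemma (in ring) right_ideal_colon:
  assumes K: "right_ideal K R" and t: "t \<in> carrier R"
  shows "right_ideal {r \<in> carrier R. t \<otimes> r \<in> K} R"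
  by (rule right_idealI) (use t right_idealD[OF K] in \<open>auto simp: r_minus r_distr simp flip: m_assoc\<close>)

lemma (in ring_hom_ring) right_ideal_vimage:
  assumes K: "right_ideal K S"
  shows "right_ideal {r \<in> carrier R. h r \<in> K} R"
  by (rule R.right_idealI) (use S.right_idealD[OF K] in auto)

text \<open>The symmetric filter will appear as an intersection of two inverse-image filters, one
  for each embedding. Every axiom, the local one included, can be tested in the two filters
  separately.\<close>

lemma right_gabriel_filter_Int:
  assumes "ring R" "right_gabriel_filter R F" "right_gabriel_filter R G"
  shows "right_gabriel_filter R (F \<inter> G)"
proof -
  interpret F: gabriel_filter R F using assms by (simp add: gabriel_filter_def gabriel_filter_axioms_def)
  interpret G: gabriel_filter R G using assms by (simp add: gabriel_filter_def gabriel_filter_axioms_def)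
  show ?thesis
    unfolding right_gabriel_filter_def
  proof (intro conjI ballI allI impI; (elim conjE)?)
    show "F \<inter> G \<noteq> {}"
      using F.carrier_in_filter G.carrier_in_filter by blast
  next
    fix I assume "I \<in> F \<inter> G"
    then show "right_ideal I R" using F.filter_right_ideal by blast
  next
    fix I J assume "I \<in> F \<inter> G" "right_ideal J R" "I \<subseteq> J"
    then show "J \<in> F \<inter> G" using F.filter_superset G.filter_superset by blast
  next
    fix I J assume "I \<in> F \<inter> G" "J \<in> F \<inter> G"
    then show "I \<inter> J \<in> F \<inter> G" using F.filter_Int G.filter_Int by blast
  next
    fix I a assume "I \<in> F \<inter> G" "a \<in> carrier R"
    then show "{r \<in> carrier R. a \<otimes>\<^bsub>R\<^esub> r \<in> I} \<in> F \<inter> G" using F.filter_colon G.filter_colon by blast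
  next
    fix I J assume I: "right_ideal I R" and J: "J \<in> F \<inter> G"
      and l: "\<forall>a\<in>J. {r \<in> carrier R. a \<otimes>\<^bsub>R\<^esub> r \<in> I} \<in> F \<inter> G"
    have "I \<in> F" by (rule F.filter_local[OF I, of J]) (use J l in blast)+
    moreover have "I \<in> G" by (rule G.filter_local[OF I, of J]) (use J l in blast)+
    ultimately show "I \<in> F \<inter> G" by blast
  qed
qed

text \<open>For \<open>t = \<phi>(a) c\<close> with \<open>c\<close> centralising the image of \<open>\<phi>\<close>, the preimage of \<open>(K : t)\<close> contains
  \<open>(\<phi>\<^sup>-\<^sup>1 K : a)\<close>.\<close>

lemma right_gabriel_filter_vimage:
  fixes A (structure) and S (structure)
  assumes "ring_hom_ring A S \<phi>" and "right_gabriel_filter A FA"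
    and gen: "\<And>P t. t \<in> carrier S \<Longrightarrow> P \<zero>\<^bsub>S\<^esub> \<Longrightarrow>
      (\<And>a c. a \<in> carrier A \<Longrightarrow> c \<in> carrier S \<Longrightarrow>
        (\<And>r. r \<in> carrier A \<Longrightarrow> c \<otimes>\<^bsub>S\<^esub> \<phi> r = \<phi> r \<otimes>\<^bsub>S\<^esub> c) \<Longrightarrow> P (\<phi> a \<otimes>\<^bsub>S\<^esub> c)) \<Longrightarrow>
      (\<And>t u. t \<in> carrier S \<Longrightarrow> u \<in> carrier S \<Longrightarrow> P t \<Longrightarrow> P u \<Longrightarrow> P (t \<ominus>\<^bsub>S\<^esub> u)) \<Longrightarrow> P t"
  shows "right_gabriel_filter S {K. right_ideal K S \<and> {r \<in> carrier A. \<phi> r \<in> K} \<in> FA}"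
    (is "right_gabriel_filter S ?F")
proof -
  interpret h: ring_hom_ring A S \<phi> by fact
  interpret A: gabriel_filter A FA
    using assms h.R.ring_axioms by (simp add: gabriel_filter_def gabriel_filter_axioms_def)
  let ?v = "\<lambda>K. {r \<in> carrier A. \<phi> r \<in> K}"
  let ?c = "\<lambda>K t. {s \<in> carrier S. t \<otimes>\<^bsub>S\<^esub> s \<in> K}"
  \<comment> \<open>\<open>P t\<close> is the colon axiom at \<open>t\<close>, stated for every
    \<open>K\<close>. The assumption \<open>gen\<close> acts as an induction principle: additive
    generation by products \<open>\<phi>(a) c\<close> leaves these products and differences, and for
    a difference the two colons are intersected.\<close>
  define P where "P = (\<lambda>t. \<forall>K. right_ideal K S \<and> ?v K \<in> FA \<longrightarrow> ?v (?c K t) \<in> FA)"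
  have v: "right_ideal (?v (?c K t)) A" if "right_ideal K S" "t \<in> carrier S" for K t
    by (rule h.right_ideal_vimage[OF h.S.right_ideal_colon[OF that]])
  have Pt: "P t" if "t \<in> carrier S" for t
    using that
  proof (rule gen)
    show "P \<zero>\<^bsub>S\<^esub>"
      unfolding P_def
    proof (intro allI impI, elim conjE)
      fix K assume K: "right_ideal K S"
      then have "?v (?c K \<zero>\<^bsub>S\<^esub>) = carrier A"
        using h.S.right_idealD(2)[OF K] by auto
      then show "?v (?c K \<zero>\<^bsub>S\<^esub>) \<in> FA"
        using A.carrier_in_filter by simp
    qed
  next
    fix a c assume a: "a \<in> carrier A" and c: "c \<in> carrier S"
      and comm: "\<And>r. r \<in> carrier A \<Longrightarrow> c \<otimes>\<^bsub>S\<^esub> \<phi> r = \<phi> r \<otimes>\<^bsub>S\<^esub> c"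
    show "P (\<phi> a \<otimes>\<^bsub>S\<^esub> c)"
      unfolding P_def
    proof (intro allI impI, elim conjE)
      fix K assume K: "right_ideal K S" "?v K \<in> FA"
      have "{r \<in> carrier A. a \<otimes>\<^bsub>A\<^esub> r \<in> ?v K} \<subseteq> ?v (?c K (\<phi> a \<otimes>\<^bsub>S\<^esub> c))"
      proof
        fix r assume "r \<in> {r \<in> carrier A. a \<otimes>\<^bsub>A\<^esub> r \<in> ?v K}"
        then have r: "r \<in> carrier A" "\<phi> (a \<otimes>\<^bsub>A\<^esub> r) \<in> K" by blast+
        have "(\<phi> a \<otimes>\<^bsub>S\<^esub> c) \<otimes>\<^bsub>S\<^esub> \<phi> r = \<phi> (a \<otimes>\<^bsub>A\<^esub> r) \<otimes>\<^bsub>S\<^esub> c"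
          using a c r(1) comm[OF r(1)] by (simp add: h.S.m_assoc)
        also have "\<dots> \<in> K"
          by (rule h.S.right_idealD(5)[OF K(1) r(2) c])
        finally show "r \<in> ?v (?c K (\<phi> a \<otimes>\<^bsub>S\<^esub> c))"
          using r(1) by simp
      qed
      then show "?v (?c K (\<phi> a \<otimes>\<^bsub>S\<^esub> c)) \<in> FA"
        using A.filter_superset[OF A.filter_colon[OF K(2) a] v[OF K(1)]] a c by simp
    qed
  next
    fix t u assume t: "t \<in> carrier S" and u: "u \<in> carrier S" and "P t" "P u"
    show "P (t \<ominus>\<^bsub>S\<^esub> u)"
      unfolding P_def
    proof (intro allI impI, elim conjE)
      fix K assume K: "right_ideal K S" "?v K \<in> FA"
      then have I: "?v (?c K t) \<inter> ?v (?c K u) \<in> FA"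
        using \<open>P t\<close> \<open>P u\<close> unfolding P_def by (intro A.filter_Int) blast+
      have "?v (?c K t) \<inter> ?v (?c K u) \<subseteq> ?v (?c K (t \<ominus>\<^bsub>S\<^esub> u))"
      proof
        fix r assume "r \<in> ?v (?c K t) \<inter> ?v (?c K u)"
        then have r: "r \<in> carrier A" "t \<otimes>\<^bsub>S\<^esub> \<phi> r \<in> K" "u \<otimes>\<^bsub>S\<^esub> \<phi> r \<in> K" by blast+
        have "(t \<ominus>\<^bsub>S\<^esub> u) \<otimes>\<^bsub>S\<^esub> \<phi> r = t \<otimes>\<^bsub>S\<^esub> \<phi> r \<oplus>\<^bsub>S\<^esub> \<ominus>\<^bsub>S\<^esub> (u \<otimes>\<^bsub>S\<^esub> \<phi> r)"
          using t u r(1) by (simp add: h.S.minus_eq h.S.l_distr h.S.l_minus)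
        also have "\<dots> \<in> K"
          by (intro h.S.right_idealD(3,4)[OF K(1)] r)
        finally show "r \<in> ?v (?c K (t \<ominus>\<^bsub>S\<^esub> u))"
          using r(1) by simp
      qed
      then show "?v (?c K (t \<ominus>\<^bsub>S\<^esub> u)) \<in> FA"
        by (rule A.filter_superset[OF I v[OF K(1) h.S.minus_closed[OF t u]]])
    qed
  qed
  show ?thesis
    unfolding right_gabriel_filter_def
  proof (intro conjI ballI allI impI; (elim conjE)?)
    have "?v (carrier S) = carrier A" by auto
    then show "?F \<noteq> {}"
      using A.carrier_in_filter h.S.right_idealI[of "carrier S"] by auto
  next
    fix I assume "I \<in> ?F"
    then show "right_ideal I S" by blast
  next
    fix I J assume IJ: "I \<in> ?F" "right_ideal J S" "I \<subseteq> J"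
    then have "?v I \<in> FA" "?v I \<subseteq> ?v J" by blast+
    then show "J \<in> ?F"
      using A.filter_superset h.right_ideal_vimage IJ(2) by blast
  next
    fix I J assume "I \<in> ?F" "J \<in> ?F"
    then have IJ: "right_ideal I S" "right_ideal J S" and "?v I \<inter> ?v J \<in> FA"
      using A.filter_Int by blast+
    moreover have "?v I \<inter> ?v J = ?v (I \<inter> J)" by blast
    moreover have "right_ideal (I \<inter> J) S"
      by (rule h.S.right_idealI) (auto intro: h.S.right_idealD(2-5)[OF IJ(1)] h.S.right_idealD(2-5)[OF IJ(2)]
        dest: h.S.right_idealD(1)[OF IJ(1)])
    ultimately show "I \<inter> J \<in> ?F" by simp
  next
    fix K t assume K: "K \<in> ?F" and t: "t \<in> carrier S"
    show "?c K t \<in> ?F"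
      using K Pt[OF t] h.S.right_ideal_colon[OF _ t] unfolding P_def by blast
  next
    fix L K assume L: "right_ideal L S" and K: "K \<in> ?F" and l: "\<forall>a\<in>K. ?c L a \<in> ?F"
    \<comment> \<open>Since \<open>\<phi>\<close> is multiplicative, the preimage of the colon of
      \<open>L\<close> at \<open>\<phi> a\<close> is the colon at \<open>a\<close> of the preimage
      of \<open>L\<close>. The local axiom of \<open>A\<close>, tested on the preimage of
      \<open>K\<close>, then gives that of \<open>S\<close>.\<close>
    have "?v L \<in> FA"
    proof (rule A.filter_local[OF h.right_ideal_vimage[OF L]])
      show "?v K \<in> FA" using K by blast
      fix a assume a: "a \<in> ?v K"
      have "?v (?c L (\<phi> a)) \<in> FA" using l a by blast
      moreover have "?v (?c L (\<phi> a)) = {r \<in> carrier A. a \<otimes>\<^bsub>A\<^esub> r \<in> ?v L}"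
        using a by auto
      ultimately show "{r \<in> carrier A. a \<otimes>\<^bsub>A\<^esub> r \<in> ?v L} \<in> FA" by simp
    qed
    with L show "L \<in> ?F" by blast
  qed
qed

section \<open>Gabriel filters on a tensor product of rings\<close>

context ring_pair
begin

lemma left_embedding: "ring_hom_ring A \<S> (\<lambda>a. a \<odot> \<one>\<^bsub>B\<^esub>)"
  by (rule ring_hom_ringI) (auto simp: A.ring_axioms S.ring_axioms tensor_mult tensor_add_left tensor_one)

lemma right_embedding: "ring_hom_ring B \<S> (\<lambda>b. \<one>\<^bsub>A\<^esub> \<odot> b)"
  by (rule ring_hom_ringI) (auto simp: B.ring_axioms S.ring_axioms tensor_mult tensor_add_right tensor_one)

text \<open>Elements \<open>a \<otimes> 1\<close> and \<open>1 \<otimes> b\<close> commute with each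
  other. Each embedding therefore meets the generation condition of
  \<open>right_gabriel_filter_vimage\<close>, the other one supplying the centralising
  factors.\<close>

lemma tensor_split:
  assumes "a \<in> carrier A" "b \<in> carrier B"
  shows "(a \<odot> \<one>\<^bsub>B\<^esub>) \<otimes>\<^bsub>\<S>\<^esub> (\<one>\<^bsub>A\<^esub> \<odot> b) = a \<odot> b" "(\<one>\<^bsub>A\<^esub> \<odot> b) \<otimes>\<^bsub>\<S>\<^esub> (a \<odot> \<one>\<^bsub>B\<^esub>) = a \<odot> b"
  using assms by (simp_all add: tensor_mult)

lemma right_gabriel_filter_tensor:
  assumes FA: "right_gabriel_filter A FA" and FB: "right_gabriel_filter B FB"
  shows "right_gabriel_filter \<S> {K. right_ideal K \<S> \<and>
    {a \<in> carrier A. a \<odot> \<one>\<^bsub>B\<^esub> \<in> K} \<in> FA \<and> {b \<in> carrier B. \<one>\<^bsub>A\<^esub> \<odot> b \<in> K} \<in> FB}"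
proof -
  have "right_gabriel_filter \<S> {K. right_ideal K \<S> \<and> {a \<in> carrier A. a \<odot> \<one>\<^bsub>B\<^esub> \<in> K} \<in> FA}"
  proof (rule right_gabriel_filter_vimage[OF left_embedding FA], goal_cases)
    case (1 P t)
    show ?case
      using 1(1)
    proof (induction t rule: tensor_induct)
      case zero
      show ?case by (rule 1(2))
    next
      case (tensor a b)
      show ?case
        unfolding tensor_split(1)[OF tensor, symmetric]
        by (rule 1(3)) (use tensor in \<open>simp_all add: tensor_split\<close>)
    next
      case (diff t u)
      then show ?case by (rule 1(4))
    qed
  qed
  moreover have "right_gabriel_filter \<S> {K. right_ideal K \<S> \<and> {b \<in> carrier B. \<one>\<^bsub>A\<^esub> \<odot> b \<in> K} \<in> FB}"
  proof (rule right_gabriel_filter_vimage[OF right_embedding FB], goal_cases)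
    case (1 P t)
    show ?case
      using 1(1)
    proof (induction t rule: tensor_induct)
      case zero
      show ?case by (rule 1(2))
    next
      case (tensor a b)
      show ?case
        unfolding tensor_split(2)[OF tensor, symmetric]
        by (rule 1(3)) (use tensor in \<open>simp_all add: tensor_split\<close>)
    next
      case (diff t u)
      then show ?case by (rule 1(4))
    qed
  qed
  ultimately have "right_gabriel_filter \<S> ({K. right_ideal K \<S> \<and> {a \<in> carrier A. a \<odot> \<one>\<^bsub>B\<^esub> \<in> K} \<in> FA} \<inter>
      {K. right_ideal K \<S> \<and> {b \<in> carrier B. \<one>\<^bsub>A\<^esub> \<odot> b \<in> K} \<in> FB})"
    by (rule right_gabriel_filter_Int[OF S.ring_axioms])
  moreover have "{K. right_ideal K \<S> \<and> {a \<in> carrier A. a \<odot> \<one>\<^bsub>B\<^esub> \<in> K} \<in> FA} \<inter>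
      {K. right_ideal K \<S> \<and> {b \<in> carrier B. \<one>\<^bsub>A\<^esub> \<odot> b \<in> K} \<in> FB} = {K. right_ideal K \<S> \<and>
    {a \<in> carrier A. a \<odot> \<one>\<^bsub>B\<^esub> \<in> K} \<in> FA \<and> {b \<in> carrier B. \<one>\<^bsub>A\<^esub> \<odot> b \<in> K} \<in> FB}"
    by blast
  ultimately show ?thesis by (simp only:)
qed

end

lemma opposite_ring_simps [simp]:
  "carrier (opposite_ring R) = carrier R" "\<one>\<^bsub>opposite_ring R\<^esub> = \<one>\<^bsub>R\<^esub>" "\<zero>\<^bsub>opposite_ring R\<^esub> = \<zero>\<^bsub>R\<^esub>"
  "x \<oplus>\<^bsub>opposite_ring R\<^esub> y = x \<oplus>\<^bsub>R\<^esub> y" "x \<otimes>\<^bsub>opposite_ring R\<^esub> y = y \<otimes>\<^bsub>R\<^esub> x"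
  by (simp_all add: opposite_ring_def)

lemma (in ring) ring_opposite: "ring (opposite_ring R)"
proof (intro ringI abelian_groupI)
  show "monoid (opposite_ring R)"
    by (rule monoidI) (auto simp: m_assoc)
  show "\<exists>y\<in>carrier (opposite_ring R). y \<oplus>\<^bsub>opposite_ring R\<^esub> x = \<zero>\<^bsub>opposite_ring R\<^esub>"
    if "x \<in> carrier (opposite_ring R)" for x
    using that by (intro bexI[of _ "\<ominus> x"]) (auto simp: l_neg)
qed (auto simp: a_ac l_distr r_distr)

section \<open>The symmetric filter on the enveloping ring\<close>

locale enveloping_ring = R: ring R for R :: "('a, 'b) ring_scheme"
begin

sublocale env: ring_pair R "opposite_ring R"
  by (intro ring_pair.intro R.ring_axioms R.ring_opposite)

lemma env_tensor_image_subset: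
  assumes K: "right_ideal K (env_ring R)"
    and g: "\<And>x y. x \<in> U \<Longrightarrow> y \<in> V \<Longrightarrow> env_tensor R x y \<in> K"
  shows "env_tensor_image R U V \<subseteq> K"
proof
  note Kc = env.S.right_idealD[OF K]
  fix t assume "t \<in> env_tensor_image R U V"
  then show "t \<in> K"
    unfolding env_tensor_image_def
  proof (induction rule: generate.induct)
    case (inv t)
    then show ?case using g Kc(4) by (auto simp: a_inv_def)
  qed (use g Kc in auto)
qed

text \<open>The two preimages of \<open>K\<close> are the largest choices of \<open>J\<close> and
  \<open>I\<close>. They suffice because \<open>x \<otimes> y\<close> is both
  \<open>(x \<otimes> 1)(1 \<otimes> y)\<close> and \<open>(1 \<otimes> y)(x \<otimes> 1)\<close>,
  so it lies in the right ideal \<open>K\<close> as soon as one of the left factors does.\<close>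

lemma sym_filter_eq:
  assumes Fl: "left_gabriel_filter R Fl" and Fr: "right_gabriel_filter R Fr"
  shows "sym_filter R Fl Fr = {K. right_ideal K (env_ring R) \<and>
    {a \<in> carrier R. env_tensor R a \<one>\<^bsub>opposite_ring R\<^esub> \<in> K} \<in> Fr \<and>
    {b \<in> carrier (opposite_ring R). env_tensor R \<one>\<^bsub>R\<^esub> b \<in> K} \<in> Fl}"
proof -
  interpret l: gabriel_filter "opposite_ring R" Fl
    using Fl env.B.ring_axioms
    by (simp add: gabriel_filter_def gabriel_filter_axioms_def left_gabriel_filter_def)
  interpret r: gabriel_filter R Fr
    using Fr R.ring_axioms by (simp add: gabriel_filter_def gabriel_filter_axioms_def)
  let ?r = "\<lambda>K. {a \<in> carrier R. env_tensor R a \<one>\<^bsub>opposite_ring R\<^esub> \<in> K}"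
  let ?l = "\<lambda>K. {b \<in> carrier (opposite_ring R). env_tensor R \<one>\<^bsub>R\<^esub> b \<in> K}"
  have "K \<in> sym_filter R Fl Fr \<longleftrightarrow> ?r K \<in> Fr \<and> ?l K \<in> Fl" if K: "right_ideal K (env_ring R)" for K
  proof
    note Kc = env.S.right_idealD[OF K]
    assume "K \<in> sym_filter R Fl Fr"
    then obtain I J where I: "I \<in> Fl" and J: "J \<in> Fr"
      and sub: "env_tensor_image R J (carrier R) <+>\<^bsub>env_ring R\<^esub> env_tensor_image R (carrier R) I \<subseteq> K"
      unfolding sym_filter_def by blast
    have sub': "t \<oplus>\<^bsub>env_ring R\<^esub> u \<in> K"
      if "t \<in> env_tensor_image R J (carrier R)" "u \<in> env_tensor_image R (carrier R) I" for t u
      using that sub unfolding set_add_def' by blast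
    \<comment> \<open>With 0 in each image, the inclusion of the sum in \<open>K\<close> gives the
      inclusion of each summand.\<close>
    have z: "\<zero>\<^bsub>env_ring R\<^esub> \<in> env_tensor_image R U V" for U V
      unfolding env_tensor_image_def using generate.one[of "add_monoid (env_ring R)"] by simp
    have i: "env_tensor R x y \<in> env_tensor_image R U V" if "x \<in> U" "y \<in> V" for x y U V
      unfolding env_tensor_image_def using that by (intro generate.incl) blast
    have "J \<subseteq> ?r K"
    proof
      fix x assume x: "x \<in> J"
      then have "x \<in> carrier R" using r.filterD(1)[OF J] by blast
      then show "x \<in> ?r K"
        using sub'[OF i[OF x, of "\<one>\<^bsub>R\<^esub>"] z] env.tensor_closed[of x "\<one>\<^bsub>R\<^esub>"] by simp
    qed
    then have "?r K \<in> Fr"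
      by (rule r.filter_superset[OF J ring_hom_ring.right_ideal_vimage[OF env.left_embedding K]])
    moreover have "I \<subseteq> ?l K"
    proof
      fix x assume x: "x \<in> I"
      then have "x \<in> carrier R" using l.filterD(1)[OF I] by simp
      then show "x \<in> ?l K"
        using sub'[OF z i[OF _ x, of "\<one>\<^bsub>R\<^esub>"]] env.tensor_closed[of "\<one>\<^bsub>R\<^esub>" x] by simp
    qed
    then have "?l K \<in> Fl"
      by (rule l.filter_superset[OF I ring_hom_ring.right_ideal_vimage[OF env.right_embedding K]])
    ultimately show "?r K \<in> Fr \<and> ?l K \<in> Fl" by blast
  next
    note Kc = env.S.right_idealD[OF K]
    assume F: "?r K \<in> Fr \<and> ?l K \<in> Fl"
    have "env_tensor R x y \<in> K" if x: "x \<in> ?r K" and y: "y \<in> carrier R" for x y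
      using Kc(5)[of "env_tensor R x \<one>\<^bsub>R\<^esub>" "env_tensor R \<one>\<^bsub>R\<^esub> y"] env.tensor_split(1)[of x y]
        env.tensor_closed[of "\<one>\<^bsub>R\<^esub>" y] x y by simp
    then have 1: "env_tensor_image R (?r K) (carrier R) \<subseteq> K"
      by (rule env_tensor_image_subset[OF K])
    have "env_tensor R x y \<in> K" if x: "x \<in> carrier R" and y: "y \<in> ?l K" for x y
      using Kc(5)[of "env_tensor R \<one>\<^bsub>R\<^esub> y" "env_tensor R x \<one>\<^bsub>R\<^esub>"] env.tensor_split(2)[of x y]
        env.tensor_closed[of x "\<one>\<^bsub>R\<^esub>"] x y by simp
    then have 2: "env_tensor_image R (carrier R) (?l K) \<subseteq> K"
      by (rule env_tensor_image_subset[OF K])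
    have "env_tensor_image R (?r K) (carrier R) <+>\<^bsub>env_ring R\<^esub> env_tensor_image R (carrier R) (?l K) \<subseteq> K"
      unfolding set_add_def' using 1 2 Kc(3) by blast
    with F K show "K \<in> sym_filter R Fl Fr"
      unfolding sym_filter_def by blast
  qed
  moreover have "right_ideal K (env_ring R)" if "K \<in> sym_filter R Fl Fr" for K
    using that unfolding sym_filter_def by blast
  ultimately show ?thesis by blast
qed

lemma gabriel_filter_sym:
  assumes "left_gabriel_filter R Fl" and "right_gabriel_filter R Fr"
  shows "gabriel_filter (env_ring R) (sym_filter R Fl Fr)"
  unfolding gabriel_filter_def gabriel_filter_axioms_def sym_filter_eq[OF assms]
  using env.right_gabriel_filter_tensor[OF assms(2) assms(1)[unfolded left_gabriel_filter_def]] env.S.ring_axioms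
  by blast

end

section \<open>Bimodules and the enveloping ring\<close>

lemma bimod_of_env_simps [simp]:
  "carrier (bimod_of_env R Q) = carrier Q" "\<zero>\<^bsub>bimod_of_env R Q\<^esub> = \<zero>\<^bsub>Q\<^esub>"
  "x \<oplus>\<^bsub>bimod_of_env R Q\<^esub> y = x \<oplus>\<^bsub>Q\<^esub> y"
  "x \<triangleleft>\<^bsub>bimod_of_env R Q\<^esub> r = x \<triangleleft>\<^bsub>Q\<^esub> env_tensor R r \<one>\<^bsub>R\<^esub>"
  "r \<triangleright>\<^bsub>bimod_of_env R Q\<^esub> x = x \<triangleleft>\<^bsub>Q\<^esub> env_tensor R \<one>\<^bsub>R\<^esub> r"
  by (simp_all add: bimod_of_env_def)

lemma env_rmodule_simps [simp]:
  "carrier (env_rmodule M) = carrier M" "\<zero>\<^bsub>env_rmodule M\<^esub> = \<zero>\<^bsub>M\<^esub>"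
  "x \<oplus>\<^bsub>env_rmodule M\<^esub> y = x \<oplus>\<^bsub>M\<^esub> y"
  by (simp_all add: env_rmodule_def)

definition env_derivation where
  "env_derivation R \<delta> = tensor_lift (env_ring R)
     (\<lambda>p. env_tensor R (\<delta> (fst p)) (snd p) \<oplus>\<^bsub>env_ring R\<^esub> env_tensor R (fst p) (\<delta> (snd p)))"

context enveloping_ring
begin

lemma env_tensor_closed:
  "a \<in> carrier R \<Longrightarrow> b \<in> carrier R \<Longrightarrow> env_tensor R a b \<in> carrier (env_ring R)"
  using env.tensor_closed[of a b] by simp

section \<open>The derivation of the enveloping ring induced by a derivation of the ring\<close>

context
  fixes \<delta> assumes \<delta>: "ring_derivation R \<delta>"
begin

text \<open>Apply the product rule to \<open>1 = 1 1\<close>. Because of this,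
  \<open>env_derivation\<close> restricts to \<open>\<delta>\<close> on both copies of the ring: in
  \<open>\<delta>(a) \<otimes> 1 + a \<otimes> \<delta>(1)\<close> the second summand
  vanishes.\<close>

lemma derivation_one: "\<delta> \<one>\<^bsub>R\<^esub> = \<zero>\<^bsub>R\<^esub>"
proof -
  have "\<delta> \<one>\<^bsub>R\<^esub> = \<delta> \<one>\<^bsub>R\<^esub> \<oplus>\<^bsub>R\<^esub> \<delta> \<one>\<^bsub>R\<^esub>" "\<delta> \<one>\<^bsub>R\<^esub> \<in> carrier R"
    using ring_derivationD[OF \<delta> R.one_closed] R.one_closed by (metis R.l_one R.r_one)+
  then show ?thesis
    using R.add.l_cancel_one[of "\<delta> \<one>\<^bsub>R\<^esub>" "\<delta> \<one>\<^bsub>R\<^esub>"] by simp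
qed

lemma env_derivation_biadditive:
  "biadditive R (opposite_ring R) (env_ring R)
     (\<lambda>p. env_tensor R (\<delta> (fst p)) (snd p) \<oplus>\<^bsub>env_ring R\<^esub> env_tensor R (fst p) (\<delta> (snd p)))"
  unfolding biadditive_def
proof (intro conjI ballI)
  note DD = ring_derivationD[OF \<delta>]
  show "(\<lambda>p. env_tensor R (\<delta> (fst p)) (snd p) \<oplus>\<^bsub>env_ring R\<^esub> env_tensor R (fst p) (\<delta> (snd p)))
      \<in> carrier R \<times> carrier (opposite_ring R) \<rightarrow> carrier (env_ring R)"
  proof
    fix p assume "p \<in> carrier R \<times> carrier (opposite_ring R)"
    then have "fst p \<in> carrier R" "snd p \<in> carrier R" by auto
    then show "env_tensor R (\<delta> (fst p)) (snd p) \<oplus>\<^bsub>env_ring R\<^esub> env_tensor R (fst p) (\<delta> (snd p)) \<in> carrier (env_ring R)"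
      by (intro env.S.a_closed env_tensor_closed DD(1))
  qed
  fix a b assume a: "a \<in> carrier R" and b: "b \<in> carrier (opposite_ring R)"
  have c: "\<delta> a \<in> carrier R" "\<delta> b \<in> carrier R" using a b DD(1) by simp_all
  { fix a' assume a': "a' \<in> carrier R"
    have c': "\<delta> a' \<in> carrier R" using a' DD(1) by simp
    show "env_tensor R (\<delta> (fst (a \<oplus>\<^bsub>R\<^esub> a', b))) (snd (a \<oplus>\<^bsub>R\<^esub> a', b)) \<oplus>\<^bsub>env_ring R\<^esub>
        env_tensor R (fst (a \<oplus>\<^bsub>R\<^esub> a', b)) (\<delta> (snd (a \<oplus>\<^bsub>R\<^esub> a', b))) =
      env_tensor R (\<delta> (fst (a, b))) (snd (a, b)) \<oplus>\<^bsub>env_ring R\<^esub> env_tensor R (fst (a, b)) (\<delta> (snd (a, b))) \<oplus>\<^bsub>env_ring R\<^esub>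
      (env_tensor R (\<delta> (fst (a', b))) (snd (a', b)) \<oplus>\<^bsub>env_ring R\<^esub> env_tensor R (fst (a', b)) (\<delta> (snd (a', b))))"
      using a a' b c c' by (simp add: DD(2) env.tensor_add_left env.S.a_ac) }
  { fix b' assume b': "b' \<in> carrier (opposite_ring R)"
    have c': "\<delta> b' \<in> carrier R" using b' DD(1) by simp
    show "env_tensor R (\<delta> (fst (a, b \<oplus>\<^bsub>opposite_ring R\<^esub> b'))) (snd (a, b \<oplus>\<^bsub>opposite_ring R\<^esub> b')) \<oplus>\<^bsub>env_ring R\<^esub>
        env_tensor R (fst (a, b \<oplus>\<^bsub>opposite_ring R\<^esub> b')) (\<delta> (snd (a, b \<oplus>\<^bsub>opposite_ring R\<^esub> b'))) =
      env_tensor R (\<delta> (fst (a, b))) (snd (a, b)) \<oplus>\<^bsub>env_ring R\<^esub> env_tensor R (fst (a, b)) (\<delta> (snd (a, b))) \<oplus>\<^bsub>env_ring R\<^esub>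
      (env_tensor R (\<delta> (fst (a, b'))) (snd (a, b')) \<oplus>\<^bsub>env_ring R\<^esub> env_tensor R (fst (a, b')) (\<delta> (snd (a, b'))))"
      using a b b' c c' env.tensor_add_right[of "\<delta> a" b b'] env.tensor_add_right[of a "\<delta> b" "\<delta> b'"]
      by (simp add: DD(2) env.S.a_ac) }
qed

lemma env_derivation_tensor:
  assumes "a \<in> carrier R" "b \<in> carrier R"
  shows "env_derivation R \<delta> (env_tensor R a b) = env_tensor R (\<delta> a) b \<oplus>\<^bsub>env_ring R\<^esub> env_tensor R a (\<delta> b)"
  unfolding env_derivation_def
  using env.tensor_lift_tensor[OF env.S.abelian_group_axioms env_derivation_biadditive] assms by simp

lemma env_derivation_hom: "abelian_group_hom (env_ring R) (env_ring R) (env_derivation R \<delta>)"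
  unfolding env_derivation_def
  by (rule env.tensor_lift_hom[OF env.S.abelian_group_axioms env_derivation_biadditive])

text \<open>Both sides are additive in each factor, so two inductions reduce the claim to pure
  tensors. There the second components multiply in the opposite order, which only permutes the
  summands of the product rule for \<open>\<delta>\<close>.\<close>

lemma ring_derivation_env: "ring_derivation (env_ring R) (env_derivation R \<delta>)"
proof -
  interpret h: abelian_group_hom "env_ring R" "env_ring R" "env_derivation R \<delta>"
    by (rule env_derivation_hom)
  note DD = ring_derivationD[OF \<delta>]
  have hd: "env_derivation R \<delta> (t \<ominus>\<^bsub>env_ring R\<^esub> u) = env_derivation R \<delta> t \<ominus>\<^bsub>env_ring R\<^esub> env_derivation R \<delta> u"
    if "t \<in> carrier (env_ring R)" "u \<in> carrier (env_ring R)" for t u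
    using that by (simp add: env.S.minus_eq)
  have "env_derivation R \<delta> (t \<otimes>\<^bsub>env_ring R\<^esub> u) =
      env_derivation R \<delta> t \<otimes>\<^bsub>env_ring R\<^esub> u \<oplus>\<^bsub>env_ring R\<^esub> t \<otimes>\<^bsub>env_ring R\<^esub> env_derivation R \<delta> u"
    if t: "t \<in> carrier (env_ring R)" and u: "u \<in> carrier (env_ring R)" for t u
    using t
  proof (induction t rule: env.tensor_induct)
    case zero
    then show ?case using u by simp
  next
    case (tensor a b)
    then have b: "b \<in> carrier R" and ab: "env_tensor R a b \<in> carrier (env_ring R)" by auto
    from u show ?case
    proof (induction u rule: env.tensor_induct)
      case zero
      then show ?case using ab by simp
    next
      case (tensor a' b')
      then have b': "b' \<in> carrier R" by simp
      note a = \<open>a \<in> carrier R\<close> and a' = \<open>a' \<in> carrier R\<close>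
      have c: "\<delta> a \<in> carrier R" "\<delta> b \<in> carrier R" "\<delta> a' \<in> carrier R" "\<delta> b' \<in> carrier R"
        using a a' b b' DD(1) by simp_all
      have e: "env_tensor R x y \<otimes>\<^bsub>env_ring R\<^esub> env_tensor R x' y' = env_tensor R (x \<otimes>\<^bsub>R\<^esub> x') (y' \<otimes>\<^bsub>R\<^esub> y)"
        if "x \<in> carrier R" "y \<in> carrier R" "x' \<in> carrier R" "y' \<in> carrier R" for x y x' y'
        using that env.tensor_mult[of x y x' y'] by simp
      have r: "env_tensor R x (y \<oplus>\<^bsub>R\<^esub> y') = env_tensor R x y \<oplus>\<^bsub>env_ring R\<^esub> env_tensor R x y'"
        if "x \<in> carrier R" "y \<in> carrier R" "y' \<in> carrier R" for x y y'
        using that env.tensor_add_right[of x y y'] by simp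
      note tc = env_tensor_closed
      show ?case
        using a a' b b' c
        by (simp add: e env_derivation_tensor DD(2,3) env.tensor_add_left r env.S.l_distr env.S.r_distr
            tc env.S.a_ac)
    next
      case (diff t u)
      note c = diff(1,2) h.hom_closed[OF diff(1)] h.hom_closed[OF diff(2)] ab h.hom_closed[OF ab]
      show ?case
        using c diff(3,4)
        by (simp add: env.S.minus_eq env.S.r_distr env.S.r_minus env.S.minus_add env.S.a_ac)
    qed
  next
    case (diff t t')
    note c = diff(1,2) h.hom_closed[OF diff(1)] h.hom_closed[OF diff(2)] u h.hom_closed[OF u]
    show ?case
      using c diff(3,4)
      by (simp add: env.S.minus_eq env.S.l_distr env.S.l_minus env.S.minus_add env.S.a_ac)
  qed
  then show ?thesis
    unfolding ring_derivation_def by auto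
qed

text \<open>A bimodule derivation obeys the Leibniz rule for the scalars
  \<open>a \<otimes> 1\<close> and \<open>1 \<otimes> b\<close> only. As
  \<open>a \<otimes> b = (1 \<otimes> b)(a \<otimes> 1)\<close>, its action is that of
  \<open>1 \<otimes> b\<close> followed by that of \<open>a \<otimes> 1\<close>; the two rules
  compose to the rule for pure tensors, and additivity does the rest. The converse restricts to
  these scalars, where \<open>env_derivation\<close> is \<open>\<delta>\<close>.\<close>

lemma bimodule_derivation_iff:
  assumes "right_module (env_ring R) Q"
  shows "bimodule_derivation R \<delta> (bimod_of_env R Q) e \<longleftrightarrow>
    module_derivation (env_ring R) (env_derivation R \<delta>) Q e"
proof -
  interpret Q: right_module "env_ring R" Q by fact
  interpret h: abelian_group_hom "env_ring R" "env_ring R" "env_derivation R \<delta>"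
    by (rule env_derivation_hom)
  note DD = ring_derivationD[OF \<delta>]
  note tc = env_tensor_closed
  have 1: "env_derivation R \<delta> (env_tensor R a \<one>\<^bsub>R\<^esub>) = env_tensor R (\<delta> a) \<one>\<^bsub>R\<^esub>" if a: "a \<in> carrier R" for a
    using a tc DD(1) env.tensor_zero_right[of a] by (simp add: env_derivation_tensor derivation_one)
  have 2: "env_derivation R \<delta> (env_tensor R \<one>\<^bsub>R\<^esub> b) = env_tensor R \<one>\<^bsub>R\<^esub> (\<delta> b)" if b: "b \<in> carrier R" for b
    using b tc DD(1) env.tensor_zero_left[of b] by (simp add: env_derivation_tensor derivation_one)
  show ?thesis
  proof
    assume e: "bimodule_derivation R \<delta> (bimod_of_env R Q) e"
    have ec: "e x \<in> carrier Q" and ea: "y \<in> carrier Q \<Longrightarrow> e (x \<oplus>\<^bsub>Q\<^esub> y) = e x \<oplus>\<^bsub>Q\<^esub> e y"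
      and er: "a \<in> carrier R \<Longrightarrow> e (x \<triangleleft>\<^bsub>Q\<^esub> env_tensor R a \<one>\<^bsub>R\<^esub>) =
        e x \<triangleleft>\<^bsub>Q\<^esub> env_tensor R a \<one>\<^bsub>R\<^esub> \<oplus>\<^bsub>Q\<^esub> x \<triangleleft>\<^bsub>Q\<^esub> env_tensor R (\<delta> a) \<one>\<^bsub>R\<^esub>"
      and el: "a \<in> carrier R \<Longrightarrow> e (x \<triangleleft>\<^bsub>Q\<^esub> env_tensor R \<one>\<^bsub>R\<^esub> a) =
        x \<triangleleft>\<^bsub>Q\<^esub> env_tensor R \<one>\<^bsub>R\<^esub> (\<delta> a) \<oplus>\<^bsub>Q\<^esub> e x \<triangleleft>\<^bsub>Q\<^esub> env_tensor R \<one>\<^bsub>R\<^esub> a"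
      if "x \<in> carrier Q" for x y a
      using e that unfolding bimodule_derivation_def bimod_of_env_simps by blast+
    have em: "e (\<ominus>\<^bsub>Q\<^esub> x) = \<ominus>\<^bsub>Q\<^esub> e x" if "x \<in> carrier Q" for x
      using ec ea that by (intro Q.M.additive_minus) auto
    have e0: "e \<zero>\<^bsub>Q\<^esub> = \<zero>\<^bsub>Q\<^esub>"
      using ec ea by (intro Q.M.additive_zero) auto
    have "e (x \<triangleleft>\<^bsub>Q\<^esub> t) = e x \<triangleleft>\<^bsub>Q\<^esub> t \<oplus>\<^bsub>Q\<^esub> x \<triangleleft>\<^bsub>Q\<^esub> env_derivation R \<delta> t"
      if x: "x \<in> carrier Q" and t: "t \<in> carrier (env_ring R)" for x t
      using t
    proof (induction t rule: env.tensor_induct)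
      case zero
      then show ?case using x ec[OF x] e0 by (simp add: Q.ract_zero_right)
    next
      case (tensor a b)
      then have a: "a \<in> carrier R" and b: "b \<in> carrier R" by auto
      have s: "y \<triangleleft>\<^bsub>Q\<^esub> env_tensor R a b = y \<triangleleft>\<^bsub>Q\<^esub> env_tensor R \<one>\<^bsub>R\<^esub> b \<triangleleft>\<^bsub>Q\<^esub> env_tensor R a \<one>\<^bsub>R\<^esub>"
        if "y \<in> carrier Q" "a \<in> carrier R" "b \<in> carrier R" for y a b
        using Q.ract_mult[OF that(1), of "env_tensor R \<one>\<^bsub>R\<^esub> b" "env_tensor R a \<one>\<^bsub>R\<^esub>"] that tc env.tensor_split(2)[of a b]
        by simp
      have c: "\<delta> a \<in> carrier R" "\<delta> b \<in> carrier R" using a b DD(1) by auto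
      let ?u = "x \<triangleleft>\<^bsub>Q\<^esub> env_tensor R \<one>\<^bsub>R\<^esub> b"
      have u: "?u \<in> carrier Q" using x b tc by (simp add: Q.ract_closed)
      have "e (x \<triangleleft>\<^bsub>Q\<^esub> env_tensor R a b) =
          (x \<triangleleft>\<^bsub>Q\<^esub> env_tensor R \<one>\<^bsub>R\<^esub> (\<delta> b) \<oplus>\<^bsub>Q\<^esub> e x \<triangleleft>\<^bsub>Q\<^esub> env_tensor R \<one>\<^bsub>R\<^esub> b) \<triangleleft>\<^bsub>Q\<^esub> env_tensor R a \<one>\<^bsub>R\<^esub>
          \<oplus>\<^bsub>Q\<^esub> ?u \<triangleleft>\<^bsub>Q\<^esub> env_tensor R (\<delta> a) \<one>\<^bsub>R\<^esub>"
        by (simp only: s[OF x a b] er[OF u a] el[OF x b])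
      also have "\<dots> = x \<triangleleft>\<^bsub>Q\<^esub> env_tensor R a (\<delta> b) \<oplus>\<^bsub>Q\<^esub> e x \<triangleleft>\<^bsub>Q\<^esub> env_tensor R a b \<oplus>\<^bsub>Q\<^esub> x \<triangleleft>\<^bsub>Q\<^esub> env_tensor R (\<delta> a) b"
        using x a b c ec[OF x] tc
        by (simp add: s[OF x a c(2)] s[OF ec[OF x] a b] s[OF x c(1) b] Q.ract_add_left Q.ract_closed)
      also have "\<dots> = e x \<triangleleft>\<^bsub>Q\<^esub> env_tensor R a b \<oplus>\<^bsub>Q\<^esub> x \<triangleleft>\<^bsub>Q\<^esub> env_derivation R \<delta> (env_tensor R a b)"
        using x a b c ec[OF x] tc
        by (simp add: env_derivation_tensor Q.ract_add_right Q.ract_closed Q.M.a_ac)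
      finally show ?case .
    next
      case (diff t u)
      note c = h.hom_closed[OF diff(1)] h.hom_closed[OF diff(2)] x ec[OF x] diff(1,2)
      have "e (x \<triangleleft>\<^bsub>Q\<^esub> (t \<ominus>\<^bsub>env_ring R\<^esub> u)) = e (x \<triangleleft>\<^bsub>Q\<^esub> t) \<oplus>\<^bsub>Q\<^esub> \<ominus>\<^bsub>Q\<^esub> e (x \<triangleleft>\<^bsub>Q\<^esub> u)"
        using c by (simp add: env.S.minus_eq Q.ract_add_right Q.ract_minus_right Q.ract_closed ea em)
      then show ?case
        using c diff(3,4)
        by (simp add: env.S.minus_eq Q.ract_add_right Q.ract_minus_right Q.ract_closed Q.M.minus_add Q.M.a_ac)
    qed
    with ec ea show "module_derivation (env_ring R) (env_derivation R \<delta>) Q e"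
      unfolding module_derivation_def by auto
  next
    assume e: "module_derivation (env_ring R) (env_derivation R \<delta>) Q e"
    note eD = module_derivationD[OF e]
    show "bimodule_derivation R \<delta> (bimod_of_env R Q) e"
      unfolding bimodule_derivation_def bimod_of_env_simps
    proof (intro conjI ballI funcsetI)
      fix x assume x: "x \<in> carrier Q"
      then show "e x \<in> carrier Q" by (rule eD(1))
      show "e (x \<oplus>\<^bsub>Q\<^esub> y) = e x \<oplus>\<^bsub>Q\<^esub> e y" if "y \<in> carrier Q" for y
        by (rule eD(2)[OF x that])
      fix r assume r: "r \<in> carrier R"
      show "e (x \<triangleleft>\<^bsub>Q\<^esub> env_tensor R r \<one>\<^bsub>R\<^esub>) =
          e x \<triangleleft>\<^bsub>Q\<^esub> env_tensor R r \<one>\<^bsub>R\<^esub> \<oplus>\<^bsub>Q\<^esub> x \<triangleleft>\<^bsub>Q\<^esub> env_tensor R (\<delta> r) \<one>\<^bsub>R\<^esub>"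
        using eD(3)[OF x tc[OF r R.one_closed]] by (simp only: 1[OF r])
      show "e (x \<triangleleft>\<^bsub>Q\<^esub> env_tensor R \<one>\<^bsub>R\<^esub> r) =
          x \<triangleleft>\<^bsub>Q\<^esub> env_tensor R \<one>\<^bsub>R\<^esub> (\<delta> r) \<oplus>\<^bsub>Q\<^esub> e x \<triangleleft>\<^bsub>Q\<^esub> env_tensor R \<one>\<^bsub>R\<^esub> r"
        using eD(3)[OF x tc[OF R.one_closed r]] eD(1)[OF x] x r tc DD(1)[OF r]
        by (simp add: 2 Q.M.a_comm Q.ract_closed)
    qed
  qed
qed

end

section \<open>A bimodule as a right module over the enveloping ring\<close>

context
  fixes M :: "('a, 'm, 'c) bimod_scheme"
  assumes M: "bimodule R M"
begin

interpretation M: bimodule R M by (rule M)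

lemma env_action_biadditive:
  assumes "x \<in> carrier M"
  shows "biadditive R (opposite_ring R) M (\<lambda>p. (snd p \<triangleright>\<^bsub>M\<^esub> x) \<triangleleft>\<^bsub>M\<^esub> fst p)"
  unfolding biadditive_def
  using assms by (auto simp: M.ract_closed M.lact_closed M.ract_add_right M.ract_add_left M.lact_add_left)

lemma env_ract_eq:
  "x \<triangleleft>\<^bsub>env_rmodule M\<^esub> t = tensor_lift M (\<lambda>p. (snd p \<triangleright>\<^bsub>M\<^esub> x) \<triangleleft>\<^bsub>M\<^esub> fst p) t"
  by (simp add: env_rmodule_def tensor_lift_def frag_lift_def[abs_def])

lemma env_ract_tensor:
  assumes "x \<in> carrier M" "a \<in> carrier R" "b \<in> carrier R"
  shows "x \<triangleleft>\<^bsub>env_rmodule M\<^esub> env_tensor R a b = (b \<triangleright>\<^bsub>M\<^esub> x) \<triangleleft>\<^bsub>M\<^esub> a"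
  unfolding env_ract_eq
  using env.tensor_lift_tensor[OF M.M.abelian_group_axioms env_action_biadditive[OF assms(1)]] assms by simp

lemma env_ract_hom:
  assumes "x \<in> carrier M"
  shows "abelian_group_hom (env_ring R) M (\<lambda>t. x \<triangleleft>\<^bsub>env_rmodule M\<^esub> t)"
  unfolding env_ract_eq
  by (rule env.tensor_lift_hom[OF M.M.abelian_group_axioms env_action_biadditive[OF assms]])

lemma env_ract_diff:
  assumes "x \<in> carrier M" "t \<in> carrier (env_ring R)" "u \<in> carrier (env_ring R)"
  shows "x \<triangleleft>\<^bsub>env_rmodule M\<^esub> (t \<ominus>\<^bsub>env_ring R\<^esub> u) = x \<triangleleft>\<^bsub>env_rmodule M\<^esub> t \<ominus>\<^bsub>M\<^esub> x \<triangleleft>\<^bsub>env_rmodule M\<^esub> u"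
proof -
  interpret h: abelian_group_hom "env_ring R" M "\<lambda>t. x \<triangleleft>\<^bsub>env_rmodule M\<^esub> t"
    by (rule env_ract_hom[OF assms(1)])
  show ?thesis
    using assms h.hom_add[of t "\<ominus>\<^bsub>env_ring R\<^esub> u"] h.hom_a_inv[of u] by (simp add: env.S.minus_eq M.M.minus_eq)
qed

lemma env_ract_zero: "x \<in> carrier M \<Longrightarrow> x \<triangleleft>\<^bsub>env_rmodule M\<^esub> \<zero>\<^bsub>env_ring R\<^esub> = \<zero>\<^bsub>M\<^esub>"
  by (rule abelian_group_hom.hom_zero[OF env_ract_hom])

lemma env_ract_closed:
  "x \<in> carrier M \<Longrightarrow> t \<in> carrier (env_ring R) \<Longrightarrow> x \<triangleleft>\<^bsub>env_rmodule M\<^esub> t \<in> carrier M"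
  by (rule abelian_group_hom.hom_closed[OF env_ract_hom])

lemma env_ract_add_left:
  assumes x: "x \<in> carrier M" and y: "y \<in> carrier M" and t: "t \<in> carrier (env_ring R)"
  shows "(x \<oplus>\<^bsub>M\<^esub> y) \<triangleleft>\<^bsub>env_rmodule M\<^esub> t = x \<triangleleft>\<^bsub>env_rmodule M\<^esub> t \<oplus>\<^bsub>M\<^esub> y \<triangleleft>\<^bsub>env_rmodule M\<^esub> t"
  using t
proof (induction t rule: env.tensor_induct)
  case zero
  then show ?case using x y by (simp add: env_ract_zero)
next
  case (tensor a b)
  then show ?case
    using x y by (simp add: env_ract_tensor M.lact_add_right M.ract_add_left M.lact_closed)
next
  case (diff t u)
  then show ?case
    using x y by (simp add: env_ract_diff env_ract_closed M.M.diff_add_diff)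
qed

lemma env_ract_uminus_left:
  assumes x: "x \<in> carrier M" and t: "t \<in> carrier (env_ring R)"
  shows "(\<ominus>\<^bsub>M\<^esub> x) \<triangleleft>\<^bsub>env_rmodule M\<^esub> t = \<ominus>\<^bsub>M\<^esub> (x \<triangleleft>\<^bsub>env_rmodule M\<^esub> t)"
  using x t env_ract_add_left[of _ _ t]
  by (intro M.M.additive_minus[of "\<lambda>x. x \<triangleleft>\<^bsub>env_rmodule M\<^esub> t"]) (auto intro: env_ract_closed)

text \<open>On pure tensors both sides are \<open>b' (b x a) a'\<close>. The opposite multiplication
  in the second factor turns the left action into a right one, and \<open>lact_ract\<close> lets the
  two actions pass each other.\<close>

lemma env_ract_mult:
  assumes x: "x \<in> carrier M" and t: "t \<in> carrier (env_ring R)" and u: "u \<in> carrier (env_ring R)"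
  shows "x \<triangleleft>\<^bsub>env_rmodule M\<^esub> (t \<otimes>\<^bsub>env_ring R\<^esub> u) = x \<triangleleft>\<^bsub>env_rmodule M\<^esub> t \<triangleleft>\<^bsub>env_rmodule M\<^esub> u"
  using t
proof (induction t rule: env.tensor_induct)
  case zero
  have "\<zero>\<^bsub>M\<^esub> \<triangleleft>\<^bsub>env_rmodule M\<^esub> u = \<zero>\<^bsub>M\<^esub>"
    using u env_ract_add_left[of _ _ u]
    by (intro M.M.additive_zero[of "\<lambda>x. x \<triangleleft>\<^bsub>env_rmodule M\<^esub> u"]) (auto intro: env_ract_closed)
  then show ?case using x u by (simp add: env_ract_zero)
next
  case (tensor a b)
  then have a: "a \<in> carrier R" and b: "b \<in> carrier R"
    and ab: "env_tensor R a b \<in> carrier (env_ring R)" by auto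
  from u show ?case
  proof (induction u rule: env.tensor_induct)
    case zero
    then show ?case
      using x a b ab by (simp add: env_ract_zero env_ract_closed)
  next
    case (tensor a' b')
    then have b': "b' \<in> carrier R" and a': "a' \<in> carrier R" by auto
    have "env_tensor R a b \<otimes>\<^bsub>env_ring R\<^esub> env_tensor R a' b' = env_tensor R (a \<otimes>\<^bsub>R\<^esub> a') (b' \<otimes>\<^bsub>R\<^esub> b)"
      using env.tensor_mult[of a b a' b'] a b a' b' by simp
    then show ?case
      using x a b a' b'
      by (simp add: env_ract_tensor M.lact_closed M.ract_closed M.ract_mult M.lact_mult M.lact_ract)
  next
    case (diff t u)
    have "env_tensor R a b \<otimes>\<^bsub>env_ring R\<^esub> (t \<ominus>\<^bsub>env_ring R\<^esub> u)
        = env_tensor R a b \<otimes>\<^bsub>env_ring R\<^esub> t \<ominus>\<^bsub>env_ring R\<^esub> env_tensor R a b \<otimes>\<^bsub>env_ring R\<^esub> u"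
      using ab diff by (simp add: env.S.minus_eq env.S.r_distr env.S.r_minus)
    then show ?case
      using x ab diff env_ract_closed[OF x ab] by (simp add: env_ract_diff env.S.m_closed)
  qed
next
  case (diff t t')
  have "(t \<ominus>\<^bsub>env_ring R\<^esub> t') \<otimes>\<^bsub>env_ring R\<^esub> u = t \<otimes>\<^bsub>env_ring R\<^esub> u \<ominus>\<^bsub>env_ring R\<^esub> t' \<otimes>\<^bsub>env_ring R\<^esub> u"
    using u diff by (simp add: env.S.minus_eq env.S.l_distr env.S.l_minus)
  then show ?case
    using x u diff
    by (simp add: env_ract_diff env_ract_closed env.S.m_closed M.M.minus_eq env_ract_add_left env_ract_uminus_left)
qed

lemma env_right_module: "right_module (env_ring R) (env_rmodule M)"
proof (intro right_module.intro right_module_axioms.intro env.S.ring_axioms)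
  show "abelian_group (env_rmodule M)"
  proof (rule abelian_groupI)
    show "\<exists>y\<in>carrier (env_rmodule M). y \<oplus>\<^bsub>env_rmodule M\<^esub> x = \<zero>\<^bsub>env_rmodule M\<^esub>"
      if "x \<in> carrier (env_rmodule M)" for x
      using that by (intro bexI[of _ "\<ominus>\<^bsub>M\<^esub> x"]) (auto simp: M.M.l_neg)
  qed (auto simp: M.M.a_ac)
next
  fix x t u assume x: "x \<in> carrier (env_rmodule M)" and t: "t \<in> carrier (env_ring R)"
    and u: "u \<in> carrier (env_ring R)"
  then show "x \<triangleleft>\<^bsub>env_rmodule M\<^esub> (t \<oplus>\<^bsub>env_ring R\<^esub> u)
      = x \<triangleleft>\<^bsub>env_rmodule M\<^esub> t \<oplus>\<^bsub>env_rmodule M\<^esub> x \<triangleleft>\<^bsub>env_rmodule M\<^esub> u"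
    using abelian_group_hom.hom_add[OF env_ract_hom[of x]] by simp
  show "x \<triangleleft>\<^bsub>env_rmodule M\<^esub> (t \<otimes>\<^bsub>env_ring R\<^esub> u) = x \<triangleleft>\<^bsub>env_rmodule M\<^esub> t \<triangleleft>\<^bsub>env_rmodule M\<^esub> u"
    using x t u by (simp add: env_ract_mult)
next
  fix x assume "x \<in> carrier (env_rmodule M)"
  then show "x \<triangleleft>\<^bsub>env_rmodule M\<^esub> \<one>\<^bsub>env_ring R\<^esub> = x"
    using env.tensor_one by (simp add: env_ract_tensor M.lact_one M.ract_one)
qed (simp_all add: env_ract_closed env_ract_add_left)

text \<open>Going to the enveloping ring and back returns the original actions on carrier elements,
  since 1 acts trivially on either side. The records themselves may differ, hence the pointwise
  transfer.\<close>

lemma bimodule_derivation_env: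
  assumes "ring_derivation R \<delta>"
  shows "bimodule_derivation R \<delta> M d \<longleftrightarrow> bimodule_derivation R \<delta> (bimod_of_env R (env_rmodule M)) d"
proof -
  have r: "x \<triangleleft>\<^bsub>env_rmodule M\<^esub> env_tensor R a \<one>\<^bsub>R\<^esub> = x \<triangleleft>\<^bsub>M\<^esub> a"
    and l: "x \<triangleleft>\<^bsub>env_rmodule M\<^esub> env_tensor R \<one>\<^bsub>R\<^esub> a = a \<triangleright>\<^bsub>M\<^esub> x"
    if "x \<in> carrier M" "a \<in> carrier R" for x a
    using that by (simp_all add: env_ract_tensor M.lact_one M.ract_one M.lact_closed)
  show ?thesis
    unfolding bimodule_derivation_def bimod_of_env_simps env_rmodule_simps
    by (intro conj_cong refl ball_cong) (auto simp: Pi_iff r l ring_derivationD(1)[OF assms])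
qed

end

end

section \<open>Extensions to the symmetric module of quotients\<close>

context enveloping_ring
begin

context
  fixes M :: "('a, 'm, 'c) bimod_scheme" and \<delta> d Fl Fr
  assumes M: "bimodule R M" and \<delta>: "ring_derivation R \<delta>" and d: "bimodule_derivation R \<delta> M d"
    and Fl: "left_gabriel_filter R Fl" and Fr: "right_gabriel_filter R Fr"
begin

interpretation gabriel_module "env_ring R" "sym_filter R Fl Fr" "env_rmodule M"
  by (intro gabriel_module.intro gabriel_filter_sym env_right_module M Fl Fr)

lemma env_module_derivation: "module_derivation (env_ring R) (env_derivation R \<delta>) (env_rmodule M) d"
  using d bimodule_derivation_env[OF M \<delta>] bimodule_derivation_iff[OF \<delta> env_right_module[OF M]] by blast

text \<open>The symmetric module of quotients is \<open>bimod_of_env\<close> applied to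
  \<open>Q\<close>, so \<open>bimodule_derivation_iff\<close> translates the notion of extension
  into the one-sided setting where \<open>ext\<close> and \<open>extension_unique\<close>
  apply.\<close>

lemma extends_derivation_iff:
  "extends_derivation R Fl Fr \<delta> M d d' \<longleftrightarrow>
    module_derivation (env_ring R) (env_derivation R \<delta>) Q d' \<and> (\<forall>x\<in>carrier M. d' (q x) = q (d x))"
  unfolding extends_derivation_def sym_module_of_quotients_def sym_quotient_map_def
    bimodule_derivation_iff[OF \<delta> Q_right_module] ..

lemma derivation_extends: "\<exists>d'. extends_derivation R Fl Fr \<delta> M d d'"
  unfolding extends_derivation_iff
  using ext_derivation[OF ring_derivation_env[OF \<delta>] env_module_derivation]
    ext_q[OF ring_derivation_env[OF \<delta>] env_module_derivation]
  by auto

lemma derivation_extension_unique: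
  assumes "extends_derivation R Fl Fr \<delta> M d d1" "extends_derivation R Fl Fr \<delta> M d d2"
    and x: "x \<in> carrier (sym_module_of_quotients R Fl Fr M)"
  shows "d1 x = d2 x"
proof (rule extension_unique[of "env_derivation R \<delta>" d1 d2 x, OF ring_derivation_env[OF \<delta>]])
  show "x \<in> carrier Q"
    using x by (simp add: sym_module_of_quotients_def)
qed (use assms(1,2) in \<open>auto simp: extends_derivation_iff\<close>)

end

end

theorem theorem2:
  fixes R :: "('a, 'b) ring_scheme"
    and M :: "('a, 'm, 'c) bimod_scheme"
    and \<delta> :: "'a \<Rightarrow> 'a" and d :: "'m \<Rightarrow> 'm"
    and Fl Fr :: "'a set set"
  assumes "ring R"
    and "ring_derivation R \<delta>"
    and "bimodule R M"
    and "bimodule_derivation R \<delta> M d"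
    and "left_gabriel_filter R Fl"
    and "right_gabriel_filter R Fr"
  shows
    "(sym_torsion R Fl Fr M = {\<zero>\<^bsub>M\<^esub>} \<longrightarrow> (\<exists>d'. extends_derivation R Fl Fr \<delta> M d d')) \<and>
     (d ` sym_torsion R Fl Fr M \<subseteq> sym_torsion R Fl Fr M \<longrightarrow>
        (\<exists>d'. extends_derivation R Fl Fr \<delta> M d d')) \<and>
     (\<forall>d1 d2. extends_derivation R Fl Fr \<delta> M d d1 \<and> extends_derivation R Fl Fr \<delta> M d d2 \<longrightarrow>
        (\<forall>x\<in>carrier (sym_module_of_quotients R Fl Fr M). d1 x = d2 x)) \<and>
     (differential_filter (env_ring R) (sym_filter R Fl Fr) \<longleftrightarrow>
        (\<forall>\<gamma> (N :: ('a, 'n) bimod) e.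
           ring_derivation R \<gamma> \<and> bimodule R N \<and> bimodule_derivation R \<gamma> N e \<longrightarrow>
             (\<exists>e'. extends_derivation R Fl Fr \<gamma> N e e') \<and>
             (\<forall>e1 e2. extends_derivation R Fl Fr \<gamma> N e e1 \<and> extends_derivation R Fl Fr \<gamma> N e e2 \<longrightarrow>
                (\<forall>x\<in>carrier (sym_module_of_quotients R Fl Fr N). e1 x = e2 x))))"
proof -
  interpret enveloping_ring R using assms(1) by (rule enveloping_ring.intro)
  have ex: "\<exists>d'. extends_derivation R Fl Fr \<delta> M d d'"
    by (rule derivation_extends[OF assms(3,2,4-6)])
  have un: "\<forall>d1 d2. extends_derivation R Fl Fr \<delta> M d d1 \<and> extends_derivation R Fl Fr \<delta> M d d2 \<longrightarrow>
      (\<forall>x\<in>carrier (sym_module_of_quotients R Fl Fr M). d1 x = d2 x)"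
    using derivation_extension_unique[OF assms(3,2,4-6)] by blast
  have diff: "differential_filter (env_ring R) (sym_filter R Fl Fr)"
    by (rule gabriel_filter.differential[OF gabriel_filter_sym[OF assms(5,6)]])
  \<comment> \<open>The bimodules \<open>N\<close> have their own element type \<open>'n\<close>, so
    the general lemmas are applied again instead of reusing \<open>ex\<close> and \<open>un\<close>.
    The equivalence of part (4) is assembled from \<open>diff\<close> for one side and
    \<open>all\<close> for the other.\<close>
  have all: "(\<exists>e'. extends_derivation R Fl Fr \<gamma> N e e') \<and>
      (\<forall>e1 e2. extends_derivation R Fl Fr \<gamma> N e e1 \<and> extends_derivation R Fl Fr \<gamma> N e e2 \<longrightarrow>
        (\<forall>x\<in>carrier (sym_module_of_quotients R Fl Fr N). e1 x = e2 x))"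
    if "ring_derivation R \<gamma>" "bimodule R N" "bimodule_derivation R \<gamma> N e" for \<gamma> e and N :: "('a, 'n) bimod"
    using derivation_extends[OF that(2,1,3) assms(5,6)]
      derivation_extension_unique[OF that(2,1,3) assms(5,6)] by blast
  show ?thesis
  proof (intro conjI impI ex un iffI diff)
    show "\<forall>\<gamma> (N :: ('a, 'n) bimod) e.
        ring_derivation R \<gamma> \<and> bimodule R N \<and> bimodule_derivation R \<gamma> N e \<longrightarrow>
          (\<exists>e'. extends_derivation R Fl Fr \<gamma> N e e') \<and>
          (\<forall>e1 e2. extends_derivation R Fl Fr \<gamma> N e e1 \<and> extends_derivation R Fl Fr \<gamma> N e e2 \<longrightarrow>
             (\<forall>x\<in>carrier (sym_module_of_quotients R Fl Fr N). e1 x = e2 x))"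
      by (intro allI impI, elim conjE, rule all)
  qed
qed

end
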